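(* Let $W$ be the additive white Gaussian noise channel with unit noise variance, i.e.\ $W(y|x)=\frac{1}{\sqrt{2\pi}}\exp\big(-\frac{(y-x)^2}{2}\big)$ for $x,y\in\mathbb{R}$, and let $M^*(W^n,\varepsilon,P)$ be the largest $M\in\mathbb{N}$ for which an $(n,M,\varepsilon,P)_{\mathrm{av}}$-code exists. For all $0<\varepsilon<1$ and $P\in(0,\infty)$, there is a constant $c$ (depending on $\varepsilon$ and $P$ but not on $n$) such that for all $n$, \[ \log M^*(W^n,\varepsilon,P) \ge n\,\mathsf{C}(P)+\sqrt{n\,\mathsf{V}(P)}\,\Phi^{-1}(\varepsilon)+\frac{1}{2}\log n + c, \] i.e.\ $\log M^*(W^n,\varepsilon,P) \ge n\mathsf{C}(P)+\sqrt{n\mathsf{V}(P)}\Phi^{-1}(\varepsilon)+\frac12\log n+O(1)$.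
   Context: Let $W^n(\mathbf{y}|\mathbf{x})=\prod_{i=1}^n W(y_i|x_i)$ for $\mathbf{x},\mathbf{y}\in\mathbb{R}^n$. An $(n,M,\varepsilon,P)_{\mathrm{av}}$-code is a collection $\{(\mathbf{x}(m),\mathcal{D}_m)\}_{m=1}^M$ of codewords $\mathbf{x}(m)\in\mathbb{R}^n$ satisfying the maximal power constraint $\|\mathbf{x}(m)\|_2^2\le nP$ for every $m$, and pairwise disjoint (measurable) decoding regions $\mathcal{D}_m\subset\mathbb{R}^n$, such that the average error probability satisfies $\frac{1}{M}\sum_{m=1}^M W^n(\mathcal{D}_m^c\,|\,\mathbf{x}(m))\le\varepsilon$. The capacity and dispersion functions are $\mathsf{C}(P)=\frac12\log(1+P)$ and $\mathsf{V}(P)=\log^2\mathrm{e}\cdot\frac{P(P+2)}{2(P+1)^2}$ (with logarithms to a common fixed base throughout). $\Phi$ is the standard Gaussian cumulative distribution function and $\Phi^{-1}$ its inverse. *)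

theory Defs
  imports "HOL-Probability.Probability"
begin

definition W_awgn :: "real \<Rightarrow> real \<Rightarrow> real" where
  "W_awgn y x = 1 / sqrt (2 * pi) * exp (- ((y - x)^2) / 2)"

text \<open>Vectors in R^n are represented as functions nat => real, only indices i < n matter.
  The output space R^n is the product measure space over {..<n}.\<close>
definition out_space :: "nat \<Rightarrow> (nat \<Rightarrow> real) measure" where
  "out_space n = PiM {..<n} (\<lambda>_. lborel)"

definition Wn :: "nat \<Rightarrow> (nat \<Rightarrow> real) \<Rightarrow> (nat \<Rightarrow> real) measure" where
  "Wn n x = PiM {..<n} (\<lambda>i. density lborel (\<lambda>y. ennreal (W_awgn y (x i))))"

definition is_av_code ::
  "nat \<Rightarrow> nat \<Rightarrow> real \<Rightarrow> real \<Rightarrow> (nat \<Rightarrow> nat \<Rightarrow> real) \<Rightarrow> (nat \<Rightarrow> (nat \<Rightarrow> real) set) \<Rightarrow> bool"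
  where
  "is_av_code n M eps P x D \<longleftrightarrow>
     (\<forall>m\<in>{1..M}. (\<Sum>i<n. (x m i)^2) \<le> real n * P) \<and>
     (\<forall>m\<in>{1..M}. D m \<in> sets (out_space n)) \<and>
     (\<forall>m\<in>{1..M}. \<forall>m'\<in>{1..M}. m \<noteq> m' \<longrightarrow> D m \<inter> D m' = {}) \<and>
     (1 / real M) * (\<Sum>m=1..M. measure (Wn n (x m)) (space (out_space n) - D m)) \<le> eps"

definition Mstar :: "nat \<Rightarrow> real \<Rightarrow> real \<Rightarrow> nat" where
  "Mstar n eps P = (GREATEST M. \<exists>x D. is_av_code n M eps P x D)"

definition cap :: "real \<Rightarrow> real \<Rightarrow> real" where
  "cap b P = 1/2 * log b (1 + P)"

definition disp :: "real \<Rightarrow> real \<Rightarrow> real" where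
  "disp b P = (log b (exp 1))^2 * (P * (P + 2)) / (2 * (P + 1)^2)"

definition Phi :: "real \<Rightarrow> real" where
  "Phi t = (LBINT s=-\<infinity>..ereal t. 1 / sqrt (2 * pi) * exp (- (s^2) / 2))"

definition Phi_inv :: "real \<Rightarrow> real" where
  "Phi_inv p = (THE t. Phi t = p)"

end

theory Submission
  imports Defs "HOL-Real_Asymp.Real_Asymp"
begin

text \<open>
  Random codewords are drawn uniformly from the sphere of radius \<open>A = sqrt (n P)\<close> (as normalized
  Gaussian vectors) and decoded by maximal inner product with the output. By rotation invariance the
  noise seen from the transmitted codeword is a pair \<open>(x, y)\<close> of independent variables, \<open>x\<close>
  standard normal and \<open>y\<close> chi distributed with \<open>n - 1\<close> degrees of freedom, and an independent
  codeword scores at least as well with probability \<open>B ((A + x) / y)\<close>, where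
  \<open>B v = Pr (v r \<le> a)\<close> for a fresh such pair \<open>(a, r)\<close>. Hence for every threshold \<open>w\<close>
  the error probability is at most
  \<open>Pr (A + x \<le> w y) + M E (B ((A + x) / y); A + x > w y)\<close>.
  The second expectation is of order \<open>(1 + w\<^sup>2) powr (- n / 2) / n\<close>: one factor \<open>1 / sqrt n\<close> comes
  from the Gaussian tail in \<open>B\<close>, the other from the bounded density of \<open>x\<close>. Therefore
  \<open>M = sqrt n (1 + w\<^sup>2) powr (n / 2)\<close> costs only \<open>O (1 / sqrt n)\<close> in error, which is the source
  of the term \<open>ln n / 2\<close>. The chi law is within \<open>O (1 / sqrt n)\<close> in total variation of a normal law of
  variance \<open>1 / 2\<close>, so the first probability is
  \<open>\<Phi> ((w - sqrt P) sqrt n / sqrt (1 + w\<^sup>2 / 2)) + O (1 / sqrt n)\<close>, and it remains to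
  choose \<open>w - sqrt P\<close> of order \<open>1 / sqrt n\<close>.
\<close>

section \<open>Rotation invariance of the Gaussian measure\<close>

text \<open>An excess of order \<open>1 / sqrt n\<close> in the error probability is affordable
  because \<open>Phi\<close> has positive density near \<open>Phi_inv eps\<close>: lowering
  \<open>w\<close> by O(1/n) removes the excess and changes
  \<open>n / 2 * ln (1 + w\<^sup>2)\<close> by O(1) only. Constants may therefore be generous, but
  the order \<open>1 / sqrt n\<close> must be kept everywhere. Only the one-dimensional law of
  \<open>y\<close> is approximated: \<open>x\<close> is exactly normal and independent of
  \<open>y\<close>, so a comparison of two densities replaces a central limit theorem with rate. The
  dispersion is a product of two factors at \<open>w = sqrt P\<close>: \<open>w * y - x\<close> has
  standard deviation close to \<open>sqrt (1 + P / 2)\<close>, which fixes \<open>w - sqrt P\<close>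
  as a multiple of \<open>Phi_inv eps / sqrt n\<close>, and \<open>ln (1 + w\<^sup>2) / 2\<close>
  has slope \<open>sqrt P / (1 + P)\<close>. The square of the product is
  \<open>P * (P + 2) / (2 * (P + 1)\<^sup>2)\<close>, the dispersion in nats. Since
  \<open>Mstar\<close> is a \<open>GREATEST\<close>, code sizes also have to be bounded above for
  each \<open>n\<close>.\<close>

lemma nn_integral_lborel_rotation:
  fixes F :: "real \<times> real \<Rightarrow> ennreal" and p q :: real
  assumes [measurable]: "F \<in> borel_measurable (borel \<Otimes>\<^sub>M borel)"
  shows "(\<integral>\<^sup>+a. \<integral>\<^sup>+b. F (p * a + q * b, a\<^sup>2 + b\<^sup>2) \<partial>lborel \<partial>lborel)
       = (\<integral>\<^sup>+a. \<integral>\<^sup>+b. F (sqrt (p\<^sup>2 + q\<^sup>2) * a, a\<^sup>2 + b\<^sup>2) \<partial>lborel \<partial>lborel)"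
proof -
  \<comment> \<open>The rotation is split into two affine substitutions in one variable each: with
    \<open>b\<close> fixed, \<open>a\<close> is replaced so that the linear form becomes
    \<open>t * a\<close>; then, with \<open>a\<close> fixed, completing the square in
    \<open>b\<close> restores \<open>a\<^sup>2 + b\<^sup>2\<close>. The Jacobians
    \<open>t / p\<close> and \<open>p / t\<close> cancel. The case \<open>p = 0\<close> follows by
    exchanging the variables.\<close>
  have main: "(\<integral>\<^sup>+a. \<integral>\<^sup>+b. F (p * a + q * b, a\<^sup>2 + b\<^sup>2) \<partial>lborel \<partial>lborel)
       = (\<integral>\<^sup>+a. \<integral>\<^sup>+b. F (sqrt (p\<^sup>2 + q\<^sup>2) * a, a\<^sup>2 + b\<^sup>2) \<partial>lborel \<partial>lborel)"
    if p: "p \<noteq> 0" for p q :: real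
  proof -
    define t where "t = sqrt (p\<^sup>2 + q\<^sup>2)"
    have t: "t > 0" and t2: "t\<^sup>2 = p\<^sup>2 + q\<^sup>2"
      using p by (auto simp: t_def add_pos_nonneg)
    have "(\<integral>\<^sup>+a. \<integral>\<^sup>+b. F (p * a + q * b, a\<^sup>2 + b\<^sup>2) \<partial>lborel \<partial>lborel)
        = (\<integral>\<^sup>+b. \<integral>\<^sup>+a. F (p * a + q * b, a\<^sup>2 + b\<^sup>2) \<partial>lborel \<partial>lborel)"
      by (rule lborel_pair.Fubini') measurable
    also have "\<dots> = (\<integral>\<^sup>+b. ennreal \<bar>t / p\<bar> *
        (\<integral>\<^sup>+a. F (p * (- q * b / p + t / p * a) + q * b, (- q * b / p + t / p * a)\<^sup>2 + b\<^sup>2) \<partial>lborel) \<partial>lborel)"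
      using p t by (intro nn_integral_cong nn_integral_real_affine) auto
    also have "\<dots> = ennreal \<bar>t / p\<bar> * (\<integral>\<^sup>+b.
        (\<integral>\<^sup>+a. F (t * a, (t * a - q * b)\<^sup>2 / p\<^sup>2 + b\<^sup>2) \<partial>lborel) \<partial>lborel)"
      using p by (subst nn_integral_cmult[symmetric])
        (auto simp: field_simps power_divide diff_divide_distrib[symmetric])
    also have "(\<integral>\<^sup>+b. (\<integral>\<^sup>+a. F (t * a, (t * a - q * b)\<^sup>2 / p\<^sup>2 + b\<^sup>2) \<partial>lborel) \<partial>lborel)
       = (\<integral>\<^sup>+a. (\<integral>\<^sup>+b. F (t * a, (t * a - q * b)\<^sup>2 / p\<^sup>2 + b\<^sup>2) \<partial>lborel) \<partial>lborel)"
      by (rule lborel_pair.Fubini') measurable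
    also have "\<dots> = (\<integral>\<^sup>+a. ennreal \<bar>p / t\<bar> * (\<integral>\<^sup>+b. F (t * a, a\<^sup>2 + b\<^sup>2) \<partial>lborel) \<partial>lborel)"
    proof (rule nn_integral_cong)
      fix a :: real
      have "(t * a - q * (q * a / t + p / t * b))\<^sup>2 / p\<^sup>2 + (q * a / t + p / t * b)\<^sup>2 = a\<^sup>2 + b\<^sup>2" for b
      proof -
        have 1: "t * a - q * (q * a / t + p / t * b) = p * (p * a - q * b) / t"
        proof -
          have "t * (t * a - q * (q * a / t + p / t * b)) = t\<^sup>2 * a - q * (q * a + p * b)"
            using t by (simp add: field_simps power2_eq_square)
          also have "\<dots> = p * (p * a - q * b)"
            unfolding t2 by (simp add: algebra_simps power2_eq_square)
          finally show ?thesis using t by (metis less_irrefl nonzero_mult_div_cancel_left)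
        qed
        have 2: "q * a / t + p / t * b = (q * a + p * b) / t" using t by (simp add: field_simps)
        have "(p * (p * a - q * b) / t)\<^sup>2 / p\<^sup>2 + ((q * a + p * b) / t)\<^sup>2
            = ((p * a - q * b)\<^sup>2 + (q * a + p * b)\<^sup>2) / t\<^sup>2"
          using p t by (simp add: power_divide power_mult_distrib add_divide_distrib[of "_\<^sup>2"])
        also have "(p * a - q * b)\<^sup>2 + (q * a + p * b)\<^sup>2 = t\<^sup>2 * (a\<^sup>2 + b\<^sup>2)"
          unfolding t2 by (simp add: algebra_simps power2_eq_square)
        finally show ?thesis using 1 2 t by simp
      qed
      moreover have "(\<integral>\<^sup>+b. F (t * a, (t * a - q * b)\<^sup>2 / p\<^sup>2 + b\<^sup>2) \<partial>lborel) =
        ennreal \<bar>p / t\<bar> * (\<integral>\<^sup>+b. F (t * a, (t * a - q * (q * a / t + p / t * b))\<^sup>2 / p\<^sup>2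
            + (q * a / t + p / t * b)\<^sup>2) \<partial>lborel)"
        using p t by (intro nn_integral_real_affine) auto
      ultimately show "(\<integral>\<^sup>+b. F (t * a, (t * a - q * b)\<^sup>2 / p\<^sup>2 + b\<^sup>2) \<partial>lborel) =
        ennreal \<bar>p / t\<bar> * (\<integral>\<^sup>+b. F (t * a, a\<^sup>2 + b\<^sup>2) \<partial>lborel)"
        by simp
    qed
    also have "\<dots> = ennreal \<bar>p / t\<bar> * (\<integral>\<^sup>+a. (\<integral>\<^sup>+b. F (t * a, a\<^sup>2 + b\<^sup>2) \<partial>lborel) \<partial>lborel)"
      by (rule nn_integral_cmult) measurable
    also have "ennreal \<bar>t / p\<bar> * (ennreal \<bar>p / t\<bar> * (\<integral>\<^sup>+a. (\<integral>\<^sup>+b. F (t * a, a\<^sup>2 + b\<^sup>2) \<partial>lborel) \<partial>lborel))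
       = (\<integral>\<^sup>+a. (\<integral>\<^sup>+b. F (t * a, a\<^sup>2 + b\<^sup>2) \<partial>lborel) \<partial>lborel)"
      using p t by (simp add: mult.assoc[symmetric] ennreal_mult[symmetric] abs_mult[symmetric])
    finally show ?thesis unfolding t_def .
  qed
  show ?thesis
  proof (cases "p = 0")
    case False then show ?thesis by (rule main)
  next
    case True
    show ?thesis
    proof (cases "q = 0")
      case True then show ?thesis using \<open>p = 0\<close> by simp
    next
      case False
      have "(\<integral>\<^sup>+a. \<integral>\<^sup>+b. F (p * a + q * b, a\<^sup>2 + b\<^sup>2) \<partial>lborel \<partial>lborel)
        = (\<integral>\<^sup>+b. \<integral>\<^sup>+a. F (p * a + q * b, a\<^sup>2 + b\<^sup>2) \<partial>lborel \<partial>lborel)"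
        by (rule lborel_pair.Fubini') measurable
      also have "\<dots> = (\<integral>\<^sup>+a. \<integral>\<^sup>+b. F (q * a + 0 * b, a\<^sup>2 + b\<^sup>2) \<partial>lborel \<partial>lborel)"
        using True by (simp add: add.commute)
      also have "\<dots> = (\<integral>\<^sup>+a. \<integral>\<^sup>+b. F (sqrt (q\<^sup>2 + 0\<^sup>2) * a, a\<^sup>2 + b\<^sup>2) \<partial>lborel \<partial>lborel)"
        by (rule main[OF False])
      finally show ?thesis using True by simp
    qed
  qed
qed

text \<open>Polar coordinates with the slope \<open>v = b / r\<close> instead of an angle; for fixed
  \<open>v\<close>, rescaling \<open>r\<close> by \<open>sqrt (1 + v\<^sup>2)\<close> separates the
  two integrals. The point is that adding a further square raises the exponent of \<open>r\<close>
  by one, up to a factor that does not depend on \<open>g\<close>.\<close>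

lemma nn_integral_lborel_polar:
  fixes j :: nat and g :: "real \<Rightarrow> ennreal"
  assumes [measurable]: "g \<in> borel_measurable borel"
  shows "(\<integral>\<^sup>+r. \<integral>\<^sup>+b. ennreal (indicator {0<..} r * r ^ j) * g (b\<^sup>2 + r\<^sup>2) \<partial>lborel \<partial>lborel)
    = (\<integral>\<^sup>+v. ennreal (1 / sqrt (1 + v\<^sup>2) ^ (j + 2)) \<partial>lborel)
      * (\<integral>\<^sup>+r. ennreal (indicator {0<..} r * r ^ (j + 1)) * g (r\<^sup>2) \<partial>lborel)"
proof -
  have "(\<integral>\<^sup>+r. \<integral>\<^sup>+b. ennreal (indicator {0<..} r * r ^ j) * g (b\<^sup>2 + r\<^sup>2) \<partial>lborel \<partial>lborel)
    = (\<integral>\<^sup>+r. \<integral>\<^sup>+v. ennreal (indicator {0<..} r * r ^ (j + 1)) * g ((1 + v\<^sup>2) * r\<^sup>2) \<partial>lborel \<partial>lborel)"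
  proof (rule nn_integral_cong)
    fix r :: real
    show "(\<integral>\<^sup>+b. ennreal (indicator {0<..} r * r ^ j) * g (b\<^sup>2 + r\<^sup>2) \<partial>lborel)
      = (\<integral>\<^sup>+v. ennreal (indicator {0<..} r * r ^ (j + 1)) * g ((1 + v\<^sup>2) * r\<^sup>2) \<partial>lborel)"
    proof (cases "r > 0")
      case True
      have "(\<integral>\<^sup>+b. ennreal (r ^ j) * g (b\<^sup>2 + r\<^sup>2) \<partial>lborel)
        = ennreal \<bar>r\<bar> * (\<integral>\<^sup>+v. ennreal (r ^ j) * g ((0 + r * v)\<^sup>2 + r\<^sup>2) \<partial>lborel)"
        using True by (intro nn_integral_real_affine) auto
      also have "\<dots> = (\<integral>\<^sup>+v. ennreal \<bar>r\<bar> * (ennreal (r ^ j) * g ((0 + r * v)\<^sup>2 + r\<^sup>2)) \<partial>lborel)"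
        by (rule nn_integral_cmult[symmetric]) measurable
      also have "\<dots> = (\<integral>\<^sup>+v. ennreal (r ^ (j + 1)) * g ((1 + v\<^sup>2) * r\<^sup>2) \<partial>lborel)"
        using True by (intro nn_integral_cong)
          (simp add: mult.assoc[symmetric] ennreal_mult[symmetric] algebra_simps power_mult_distrib)
      finally show ?thesis using True by simp
    qed simp
  qed
  also have "\<dots> = (\<integral>\<^sup>+v. \<integral>\<^sup>+r. ennreal (indicator {0<..} r * r ^ (j + 1)) * g ((1 + v\<^sup>2) * r\<^sup>2) \<partial>lborel \<partial>lborel)"
    by (rule lborel_pair.Fubini') measurable
  also have "\<dots> = (\<integral>\<^sup>+v. ennreal (1 / sqrt (1 + v\<^sup>2) ^ (j + 2)) *
      (\<integral>\<^sup>+r. ennreal (indicator {0<..} r * r ^ (j + 1)) * g (r\<^sup>2) \<partial>lborel) \<partial>lborel)"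
  proof (rule nn_integral_cong)
    fix v :: real
    define s where "s = sqrt (1 + v\<^sup>2)"
    have s: "s > 0" "s\<^sup>2 = 1 + v\<^sup>2" by (auto simp: s_def add_pos_nonneg)
    have "(\<integral>\<^sup>+r. ennreal (indicator {0<..} r * r ^ (j + 1)) * g ((1 + v\<^sup>2) * r\<^sup>2) \<partial>lborel)
      = ennreal \<bar>1 / s\<bar> * (\<integral>\<^sup>+r. ennreal (indicator {0<..} (0 + 1 / s * r) * (0 + 1 / s * r) ^ (j + 1)) *
            g ((1 + v\<^sup>2) * (0 + 1 / s * r)\<^sup>2) \<partial>lborel)"
      using s by (intro nn_integral_real_affine) auto
    also have "\<dots> = (\<integral>\<^sup>+r. ennreal \<bar>1 / s\<bar> * (ennreal (indicator {0<..} (0 + 1 / s * r) * (0 + 1 / s * r) ^ (j + 1)) *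
            g ((1 + v\<^sup>2) * (0 + 1 / s * r)\<^sup>2)) \<partial>lborel)"
      by (rule nn_integral_cmult[symmetric]) measurable
    also have "\<dots> = (\<integral>\<^sup>+r. ennreal (1 / s ^ (j + 2)) * (ennreal (indicator {0<..} r * r ^ (j + 1)) * g (r\<^sup>2)) \<partial>lborel)"
    proof (rule nn_integral_cong)
      fix r :: real
      have "(1 + v\<^sup>2) * (0 + 1 / s * r)\<^sup>2 = r\<^sup>2"
        using s(1) unfolding s(2)[symmetric] by (simp add: power_divide)
      moreover have "ennreal \<bar>1 / s\<bar> * ennreal (indicator {0<..} (0 + 1 / s * r) * (0 + 1 / s * r) ^ (j + 1))
         = ennreal (1 / s ^ (j + 2)) * ennreal (indicator {0<..} r * r ^ (j + 1))"
        using s(1) by (cases "r > 0")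
          (auto simp: ennreal_mult[symmetric] power_divide indicator_def zero_less_divide_iff)
      ultimately show "ennreal \<bar>1 / s\<bar> * (ennreal (indicator {0<..} (0 + 1 / s * r) * (0 + 1 / s * r) ^ (j + 1)) *
            g ((1 + v\<^sup>2) * (0 + 1 / s * r)\<^sup>2)) = ennreal (1 / s ^ (j + 2)) * (ennreal (indicator {0<..} r * r ^ (j + 1)) * g (r\<^sup>2))"
        by (simp only: mult.assoc[symmetric])
    qed
    also have "\<dots> = ennreal (1 / s ^ (j + 2)) * (\<integral>\<^sup>+r. (ennreal (indicator {0<..} r * r ^ (j + 1)) * g (r\<^sup>2)) \<partial>lborel)"
      by (rule nn_integral_cmult) measurable
    finally show "(\<integral>\<^sup>+r. ennreal (indicator {0<..} r * r ^ (j + 1)) * g ((1 + v\<^sup>2) * r\<^sup>2) \<partial>lborel)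
      = ennreal (1 / sqrt (1 + v\<^sup>2) ^ (j + 2)) *
      (\<integral>\<^sup>+r. ennreal (indicator {0<..} r * r ^ (j + 1)) * g (r\<^sup>2) \<partial>lborel)"
      unfolding s_def .
  qed
  also have "\<dots> = (\<integral>\<^sup>+v. ennreal (1 / sqrt (1 + v\<^sup>2) ^ (j + 2)) \<partial>lborel) *
      (\<integral>\<^sup>+r. ennreal (indicator {0<..} r * r ^ (j + 1)) * g (r\<^sup>2) \<partial>lborel)"
    by (rule nn_integral_multc) measurable
  finally show ?thesis .
qed

section \<open>Joint law of a linear form and the squared norm of a Gaussian vector\<close>

definition gauss :: "nat \<Rightarrow> (nat \<Rightarrow> real) measure" where
  "gauss n = PiM {..<n} (\<lambda>_. std_normal_distribution)"

lemma sets_gauss[measurable_cong]: "sets (gauss n) = sets (PiM {..<n} (\<lambda>_. borel))"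
  unfolding gauss_def by (intro sets_PiM_cong) auto

lemma space_gauss: "space (gauss n) = PiE {..<n} (\<lambda>_. UNIV)"
  by (simp add: gauss_def space_PiM)

lemma prob_space_gauss: "prob_space (gauss n)"
  unfolding gauss_def by (intro prob_space_PiM prob_space_normal_density) simp

lemma nn_integral_gauss_Suc:
  assumes "f \<in> borel_measurable (gauss (Suc n))"
  shows "(\<integral>\<^sup>+z. f z \<partial>gauss (Suc n)) = (\<integral>\<^sup>+b. \<integral>\<^sup>+z. f (z(n := b)) \<partial>gauss n \<partial>std_normal_distribution)"
proof -
  interpret product_sigma_finite "\<lambda>_::nat. std_normal_distribution"
    by (intro product_sigma_finite.intro prob_space_imp_sigma_finite prob_space_normal_density) simp
  show ?thesis
    using assms unfolding gauss_def lessThan_Suc by (intro product_nn_integral_insert_rev) auto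
qed

lemma nn_integral_std_normal:
  assumes [measurable]: "f \<in> borel_measurable borel"
  shows "(\<integral>\<^sup>+x. f x \<partial>std_normal_distribution) = (\<integral>\<^sup>+x. ennreal (std_normal_density x) * f x \<partial>lborel)"
  by (rule nn_integral_density) auto

lemma std_normal_density_mult:
  "std_normal_density a * std_normal_density b = exp (- (a\<^sup>2 + b\<^sup>2) / 2) / (2 * pi)"
  by (simp add: std_normal_density_def exp_add[symmetric] field_simps real_sqrt_mult[symmetric])

text \<open>The joint density depends on \<open>a\<^sup>2 + b\<^sup>2\<close> only, so it can be
  absorbed into the integrand of the Lebesgue version.\<close>

lemma nn_integral_std_normal_rotation:
  assumes f[measurable]: "f \<in> borel_measurable (borel \<Otimes>\<^sub>M borel)"
  shows "(\<integral>\<^sup>+a. \<integral>\<^sup>+b. f (p * a + q * b, a\<^sup>2 + b\<^sup>2) \<partial>std_normal_distribution \<partial>std_normal_distribution)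
       = (\<integral>\<^sup>+a. \<integral>\<^sup>+b. f (sqrt (p\<^sup>2 + q\<^sup>2) * a, a\<^sup>2 + b\<^sup>2) \<partial>std_normal_distribution \<partial>std_normal_distribution)"
proof -
  have *: "(\<integral>\<^sup>+a. \<integral>\<^sup>+b. f (x * a + y * b, a\<^sup>2 + b\<^sup>2) \<partial>std_normal_distribution \<partial>std_normal_distribution)
    = (\<integral>\<^sup>+a. \<integral>\<^sup>+b. (case (x * a + y * b, a\<^sup>2 + b\<^sup>2) of (s, t) \<Rightarrow> ennreal (exp (- t / 2) / (2 * pi)) * f (s, t)) \<partial>lborel \<partial>lborel)" for x y
    by (simp add: nn_integral_std_normal nn_integral_cmult[symmetric] mult.assoc[symmetric]
       ennreal_mult[symmetric] std_normal_density_mult diff_divide_distrib add_divide_distrib)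
  show ?thesis
    unfolding *[of p q] *[of "sqrt (p\<^sup>2 + q\<^sup>2)" 0, simplified]
    by (subst nn_integral_lborel_rotation) auto
qed

definition chi_weight :: "nat \<Rightarrow> real \<Rightarrow> real" where
  "chi_weight j r = indicator {0<..} r * (r ^ j * exp (- r\<^sup>2 / 2))"

lemma chi_weight_nonneg[simp]: "chi_weight j r \<ge> 0"
  by (auto simp: chi_weight_def indicator_def)

lemma measurable_chi_weight[measurable]: "chi_weight j \<in> borel_measurable borel"
  unfolding chi_weight_def by measurable

lemma nn_integral_std_normal_even:
  assumes [measurable]: "g \<in> borel_measurable borel"
  shows "(\<integral>\<^sup>+b. g (b\<^sup>2) \<partial>std_normal_distribution)
    = ennreal (2 / sqrt (2 * pi)) * (\<integral>\<^sup>+r. ennreal (chi_weight 0 r) * g (r\<^sup>2) \<partial>lborel)"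
proof -
  let ?w = "\<lambda>b. ennreal (1 / sqrt (2 * pi)) * (ennreal (chi_weight 0 b) * g (b\<^sup>2))"
  have "(\<integral>\<^sup>+b. g (b\<^sup>2) \<partial>std_normal_distribution) = (\<integral>\<^sup>+b. ennreal (std_normal_density b) * g (b\<^sup>2) \<partial>lborel)"
    by (rule nn_integral_std_normal) measurable
  also have "\<dots> = (\<integral>\<^sup>+b. ?w b + ?w (- b) \<partial>lborel)"
  proof (rule nn_integral_cong_AE)
    have "AE b in lborel. b \<noteq> (0::real)" by (rule AE_lborel_singleton)
    then show "AE b in lborel. ennreal (std_normal_density b) * g (b\<^sup>2) = ?w b + ?w (- b)"
    proof eventually_elim
      case (elim b)
      then show ?case
        by (cases "b > 0")
          (auto simp: chi_weight_def std_normal_density_def mult.assoc[symmetric] ennreal_mult[symmetric])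
    qed
  qed
  also have "\<dots> = (\<integral>\<^sup>+b. ?w b \<partial>lborel) + (\<integral>\<^sup>+b. ?w (- b) \<partial>lborel)"
    by (rule nn_integral_add) measurable
  also have "(\<integral>\<^sup>+b. ?w (- b) \<partial>lborel) = (\<integral>\<^sup>+b. ?w b \<partial>lborel)"
    using nn_integral_real_affine[of ?w "-1" 0] by simp
  also have "(\<integral>\<^sup>+b. ?w b \<partial>lborel) = ennreal (1 / sqrt (2 * pi)) * (\<integral>\<^sup>+b. (ennreal (chi_weight 0 b) * g (b\<^sup>2)) \<partial>lborel)"
    by (rule nn_integral_cmult) measurable
  finally show ?thesis
    by (simp add: distrib_right[symmetric] ennreal_plus[symmetric] del: ennreal_plus)
qed

text \<open>Induction on the dimension: a rotation in the plane of the old component along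
  \<open>u\<close> and the new coordinate produces the new component along \<open>u\<close>, and the
  coordinate left over is merged with the old radius. \<open>K\<close> is chosen before
  \<open>u\<close> and \<open>f\<close>, so constants need not be tracked: the integrand
  \<open>1\<close> determines \<open>K\<close> later.\<close>

lemma gauss_law_aux:
  "\<exists>K. \<forall>u f. f \<in> borel_measurable (borel \<Otimes>\<^sub>M borel) \<longrightarrow>
    (\<integral>\<^sup>+z. f (\<Sum>i<n+2. u i * z i, \<Sum>i<n+2. (z i)\<^sup>2) \<partial>gauss (n+2))
     = K * (\<integral>\<^sup>+a. \<integral>\<^sup>+r. ennreal (chi_weight n r) * f (sqrt (\<Sum>i<n+2. (u i)\<^sup>2) * a, a\<^sup>2 + r\<^sup>2)
         \<partial>lborel \<partial>std_normal_distribution)"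
proof (induction n)
  case 0
  interpret N: prob_space std_normal_distribution by (intro prob_space_normal_density) simp
  interpret NN: pair_sigma_finite std_normal_distribution std_normal_distribution ..
  have e: "(\<Sum>i<0+2. h i) = h 0 + h 1" for h :: "nat \<Rightarrow> real" by (simp add: numeral_2_eq_2)
  show ?case
  proof (intro exI[of _ "ennreal (2 / sqrt (2 * pi))"] allI impI)
    fix u :: "nat \<Rightarrow> real" and f :: "real \<times> real \<Rightarrow> ennreal" assume f[measurable]: "f \<in> borel_measurable (borel \<Otimes>\<^sub>M borel)"
    interpret g0: prob_space "gauss 0" by (rule prob_space_gauss)
    have "(\<integral>\<^sup>+z. f (\<Sum>i<2. u i * z i, \<Sum>i<2. (z i)\<^sup>2) \<partial>gauss 2)
      = (\<integral>\<^sup>+b. \<integral>\<^sup>+z. f (u 0 * z 0 + u 1 * b, (z 0)\<^sup>2 + b\<^sup>2) \<partial>gauss 1 \<partial>std_normal_distribution)"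
      unfolding Suc_1[symmetric] by (subst nn_integral_gauss_Suc) (auto simp: numeral_2_eq_2)
    also have "\<dots> = (\<integral>\<^sup>+b. \<integral>\<^sup>+a. f (u 0 * a + u 1 * b, a\<^sup>2 + b\<^sup>2) \<partial>std_normal_distribution \<partial>std_normal_distribution)"
      unfolding One_nat_def by (subst nn_integral_gauss_Suc) (auto simp: g0.emeasure_space_1)
    also have "\<dots> = (\<integral>\<^sup>+a. \<integral>\<^sup>+b. f (u 0 * a + u 1 * b, a\<^sup>2 + b\<^sup>2) \<partial>std_normal_distribution \<partial>std_normal_distribution)"
      by (rule NN.Fubini') measurable
    also have "\<dots> = (\<integral>\<^sup>+a. \<integral>\<^sup>+b. f (sqrt ((u 0)\<^sup>2 + (u 1)\<^sup>2) * a, a\<^sup>2 + b\<^sup>2) \<partial>std_normal_distribution \<partial>std_normal_distribution)"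
      by (rule nn_integral_std_normal_rotation) measurable
    also have "\<dots> = (\<integral>\<^sup>+a. ennreal (2 / sqrt (2 * pi)) * (\<integral>\<^sup>+r. ennreal (chi_weight 0 r) * f (sqrt ((u 0)\<^sup>2 + (u 1)\<^sup>2) * a, a\<^sup>2 + r\<^sup>2)
         \<partial>lborel) \<partial>std_normal_distribution)"
      by (intro nn_integral_cong nn_integral_std_normal_even[where g="\<lambda>y. f (_, _ + y)"]) measurable
    also have "\<dots> = ennreal (2 / sqrt (2 * pi)) * (\<integral>\<^sup>+a. (\<integral>\<^sup>+r. ennreal (chi_weight 0 r) * f (sqrt ((u 0)\<^sup>2 + (u 1)\<^sup>2) * a, a\<^sup>2 + r\<^sup>2)
         \<partial>lborel) \<partial>std_normal_distribution)"
      by (rule nn_integral_cmult) measurable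
    finally show "(\<integral>\<^sup>+z. f (\<Sum>i<0+2. u i * z i, \<Sum>i<0+2. (z i)\<^sup>2) \<partial>gauss (0+2)) =
      ennreal (2 / sqrt (2 * pi)) * (\<integral>\<^sup>+a. (\<integral>\<^sup>+r. ennreal (chi_weight 0 r) *
        f (sqrt (\<Sum>i<0+2. (u i)\<^sup>2) * a, a\<^sup>2 + r\<^sup>2) \<partial>lborel) \<partial>std_normal_distribution)"
      by (simp only: add_0 e[unfolded add_0])
  qed
next
  case (Suc n)
  then obtain K where K: "\<And>u f. f \<in> borel_measurable (borel \<Otimes>\<^sub>M borel) \<Longrightarrow>
    (\<integral>\<^sup>+z. f (\<Sum>i<n+2. u i * z i, \<Sum>i<n+2. (z i)\<^sup>2) \<partial>gauss (n+2))
     = K * (\<integral>\<^sup>+a. \<integral>\<^sup>+r. ennreal (chi_weight n r) * f (sqrt (\<Sum>i<n+2. (u i)\<^sup>2) * a, a\<^sup>2 + r\<^sup>2)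
         \<partial>lborel \<partial>std_normal_distribution)"
    by blast
  interpret N: prob_space std_normal_distribution by (intro prob_space_normal_density) simp
  interpret NN: pair_sigma_finite std_normal_distribution std_normal_distribution ..
  interpret LN: pair_sigma_finite lborel std_normal_distribution ..
  interpret NL: pair_sigma_finite std_normal_distribution lborel ..
  define S where "S = (\<integral>\<^sup>+v. ennreal (1 / sqrt (1 + v\<^sup>2) ^ (n + 2)) \<partial>lborel)"
  show ?case
  proof (intro exI[of _ "K * (S * ennreal (1 / sqrt (2 * pi)))"] allI impI)
    fix u :: "nat \<Rightarrow> real" and f :: "real \<times> real \<Rightarrow> ennreal" assume f[measurable]: "f \<in> borel_measurable (borel \<Otimes>\<^sub>M borel)"
    define p where "p = sqrt (\<Sum>i<n+2. (u i)\<^sup>2)"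
    define q where "q = u (n+2)"
    define t where "t = sqrt (\<Sum>i<Suc n+2. (u i)\<^sup>2)"
    have t: "t = sqrt (p\<^sup>2 + q\<^sup>2)"
      by (simp add: t_def p_def q_def sum_nonneg)
    have "(\<integral>\<^sup>+z. f (\<Sum>i<Suc n+2. u i * z i, \<Sum>i<Suc n+2. (z i)\<^sup>2) \<partial>gauss (Suc n+2))
      = (\<integral>\<^sup>+b. \<integral>\<^sup>+z. f ((\<Sum>i<n+2. u i * z i) + q * b, (\<Sum>i<n+2. (z i)\<^sup>2) + b\<^sup>2) \<partial>gauss (n+2) \<partial>std_normal_distribution)"
      unfolding add_Suc q_def by (subst nn_integral_gauss_Suc) auto
    \<comment> \<open>The induction hypothesis is applied for each fixed last coordinate
      \<open>b\<close>, to \<open>f\<close> translated by \<open>q * b\<close> and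
      \<open>b\<^sup>2\<close>.\<close>
    also have "\<dots> = (\<integral>\<^sup>+b. K * (\<integral>\<^sup>+a. \<integral>\<^sup>+r. ennreal (chi_weight n r) * f (p * a + q * b, a\<^sup>2 + r\<^sup>2 + b\<^sup>2)
         \<partial>lborel \<partial>std_normal_distribution) \<partial>std_normal_distribution)"
      unfolding p_def
      by (intro nn_integral_cong K[where f="\<lambda>(x, y). f (x + q * _, y + _\<^sup>2)", simplified case_prod_conv]) measurable
    also have "\<dots> = K * (\<integral>\<^sup>+b. \<integral>\<^sup>+a. \<integral>\<^sup>+r. ennreal (chi_weight n r) * f (p * a + q * b, a\<^sup>2 + r\<^sup>2 + b\<^sup>2)
         \<partial>lborel \<partial>std_normal_distribution \<partial>std_normal_distribution)"
      by (rule nn_integral_cmult) measurable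
    also have "(\<integral>\<^sup>+b. \<integral>\<^sup>+a. \<integral>\<^sup>+r. ennreal (chi_weight n r) * f (p * a + q * b, a\<^sup>2 + r\<^sup>2 + b\<^sup>2)
         \<partial>lborel \<partial>std_normal_distribution \<partial>std_normal_distribution)
      = (\<integral>\<^sup>+b. \<integral>\<^sup>+r. \<integral>\<^sup>+a. ennreal (chi_weight n r) * f (p * a + q * b, a\<^sup>2 + r\<^sup>2 + b\<^sup>2)
         \<partial>std_normal_distribution \<partial>lborel \<partial>std_normal_distribution)"
      by (intro nn_integral_cong LN.Fubini') measurable
    also have "\<dots> = (\<integral>\<^sup>+r. \<integral>\<^sup>+b. \<integral>\<^sup>+a. ennreal (chi_weight n r) * f (p * a + q * b, a\<^sup>2 + r\<^sup>2 + b\<^sup>2)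
         \<partial>std_normal_distribution \<partial>std_normal_distribution \<partial>lborel)"
      by (rule LN.Fubini') measurable
    also have "\<dots> = (\<integral>\<^sup>+r. \<integral>\<^sup>+a. \<integral>\<^sup>+b. ennreal (chi_weight n r) * f (p * a + q * b, a\<^sup>2 + r\<^sup>2 + b\<^sup>2)
         \<partial>std_normal_distribution \<partial>std_normal_distribution \<partial>lborel)"
      by (intro nn_integral_cong NN.Fubini') measurable
    \<comment> \<open>With the radius \<open>r\<close> fixed, the rotation acts on \<open>a\<close>
      and \<open>b\<close> alone; afterwards \<open>b\<close> enters only through
      \<open>r\<^sup>2 + b\<^sup>2\<close>.\<close>
    also have "\<dots> = (\<integral>\<^sup>+r. \<integral>\<^sup>+a. \<integral>\<^sup>+b. ennreal (chi_weight n r) * f (t * a, a\<^sup>2 + r\<^sup>2 + b\<^sup>2)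
         \<partial>std_normal_distribution \<partial>std_normal_distribution \<partial>lborel)"
    proof (rule nn_integral_cong)
      fix r :: real
      have "(\<lambda>(x, y). ennreal (chi_weight n r) * f (x, y + r\<^sup>2)) \<in> borel_measurable (borel \<Otimes>\<^sub>M borel)" by measurable
      from nn_integral_std_normal_rotation[OF this, of p q, folded t]
      show "(\<integral>\<^sup>+a. \<integral>\<^sup>+b. ennreal (chi_weight n r) * f (p * a + q * b, a\<^sup>2 + r\<^sup>2 + b\<^sup>2)
         \<partial>std_normal_distribution \<partial>std_normal_distribution) = (\<integral>\<^sup>+a. \<integral>\<^sup>+b. ennreal (chi_weight n r) * f (t * a, a\<^sup>2 + r\<^sup>2 + b\<^sup>2)
         \<partial>std_normal_distribution \<partial>std_normal_distribution)"
        by (simp add: ac_simps)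
    qed
    also have "\<dots> = (\<integral>\<^sup>+a. \<integral>\<^sup>+r. \<integral>\<^sup>+b. ennreal (chi_weight n r) * f (t * a, a\<^sup>2 + r\<^sup>2 + b\<^sup>2)
         \<partial>std_normal_distribution \<partial>lborel \<partial>std_normal_distribution)"
      by (rule NL.Fubini') measurable
    also have "\<dots> = (\<integral>\<^sup>+a. S * ennreal (1 / sqrt (2 * pi)) * (\<integral>\<^sup>+r. ennreal (chi_weight (Suc n) r) * f (t * a, a\<^sup>2 + r\<^sup>2)
         \<partial>lborel) \<partial>std_normal_distribution)"
    proof (rule nn_integral_cong)
      fix a :: real
      \<comment> \<open>The exponentials of \<open>b\<close> and of \<open>r\<close> combine into a
        function of \<open>b\<^sup>2 + r\<^sup>2\<close>, the form that the polar formula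
        requires.\<close>
      define g where "g y = ennreal (1 / sqrt (2 * pi)) * (ennreal (exp (- y / 2)) * f (t * a, a\<^sup>2 + y))" for y
      have [measurable]: "g \<in> borel_measurable borel" unfolding g_def by measurable
      have "(\<integral>\<^sup>+r. \<integral>\<^sup>+b. ennreal (chi_weight n r) * f (t * a, a\<^sup>2 + r\<^sup>2 + b\<^sup>2) \<partial>std_normal_distribution \<partial>lborel)
       = (\<integral>\<^sup>+r. \<integral>\<^sup>+b. ennreal (indicator {0<..} r * r ^ n) * g (b\<^sup>2 + r\<^sup>2) \<partial>lborel \<partial>lborel)"
      proof (subst nn_integral_std_normal, measurable, intro nn_integral_cong)
        fix r b :: real
        have "std_normal_density b * chi_weight n r
          = (indicator {0<..} r * r ^ n) * (1 / sqrt (2 * pi) * exp (- (b\<^sup>2 + r\<^sup>2) / 2))"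
          by (simp add: chi_weight_def std_normal_density_def exp_add[symmetric] add_divide_distrib diff_divide_distrib)
        then have "ennreal (std_normal_density b) * ennreal (chi_weight n r)
          = ennreal (indicator {0<..} r * r ^ n) * (ennreal (1 / sqrt (2 * pi)) * ennreal (exp (- (b\<^sup>2 + r\<^sup>2) / 2)))"
          by (simp only: ennreal_mult''[symmetric] chi_weight_nonneg exp_ge_zero mult_nonneg_nonneg
              divide_nonneg_nonneg zero_le_one real_sqrt_ge_zero pi_ge_zero zero_le_numeral)
        moreover have "a\<^sup>2 + r\<^sup>2 + b\<^sup>2 = a\<^sup>2 + (b\<^sup>2 + r\<^sup>2)" by simp
        ultimately show "ennreal (std_normal_density b) * (ennreal (chi_weight n r) * f (t * a, a\<^sup>2 + r\<^sup>2 + b\<^sup>2))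
          = ennreal (indicator {0<..} r * r ^ n) * g (b\<^sup>2 + r\<^sup>2)"
          unfolding g_def by (simp only: mult.assoc[symmetric])
      qed
      also have "\<dots> = S * (\<integral>\<^sup>+r. ennreal (indicator {0<..} r * r ^ (n + 1)) * g (r\<^sup>2) \<partial>lborel)"
        unfolding S_def by (rule nn_integral_lborel_polar) measurable
      also have "(\<integral>\<^sup>+r. ennreal (indicator {0<..} r * r ^ (n + 1)) * g (r\<^sup>2) \<partial>lborel)
        = (\<integral>\<^sup>+r. ennreal (1 / sqrt (2 * pi)) * (ennreal (chi_weight (Suc n) r) * f (t * a, a\<^sup>2 + r\<^sup>2)) \<partial>lborel)"
        by (intro nn_integral_cong)
          (auto simp: g_def chi_weight_def mult.assoc[symmetric] ennreal_mult[symmetric] indicator_def)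
      also have "\<dots> = ennreal (1 / sqrt (2 * pi)) * (\<integral>\<^sup>+r. (ennreal (chi_weight (Suc n) r) * f (t * a, a\<^sup>2 + r\<^sup>2)) \<partial>lborel)"
        by (rule nn_integral_cmult) measurable
      finally show "(\<integral>\<^sup>+r. \<integral>\<^sup>+b. ennreal (chi_weight n r) * f (t * a, a\<^sup>2 + r\<^sup>2 + b\<^sup>2) \<partial>std_normal_distribution \<partial>lborel)
        = S * ennreal (1 / sqrt (2 * pi)) * (\<integral>\<^sup>+r. ennreal (chi_weight (Suc n) r) * f (t * a, a\<^sup>2 + r\<^sup>2) \<partial>lborel)"
        by (simp add: mult.assoc)
    qed
    also have "\<dots> = S * ennreal (1 / sqrt (2 * pi)) * (\<integral>\<^sup>+a. (\<integral>\<^sup>+r. ennreal (chi_weight (Suc n) r) * f (t * a, a\<^sup>2 + r\<^sup>2)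
         \<partial>lborel) \<partial>std_normal_distribution)"
      by (rule nn_integral_cmult) measurable
    finally show "(\<integral>\<^sup>+z. f (\<Sum>i<Suc n+2. u i * z i, \<Sum>i<Suc n+2. (z i)\<^sup>2) \<partial>gauss (Suc n+2)) =
      K * (S * ennreal (1 / sqrt (2 * pi))) * (\<integral>\<^sup>+a. \<integral>\<^sup>+r. ennreal (chi_weight (Suc n) r) * f (sqrt (\<Sum>i<Suc n+2. (u i)\<^sup>2) * a, a\<^sup>2 + r\<^sup>2)
         \<partial>lborel \<partial>std_normal_distribution)"
      unfolding t_def by (simp only: mult.assoc)
  qed
qed

text \<open>The index is the exponent of the weight, so \<open>chi j\<close> has \<open>j + 1\<close> degrees of freedom.\<close>
definition chi :: "nat \<Rightarrow> real measure" where
  "chi j = density lborel (\<lambda>r. ennreal (chi_weight j r) / (\<integral>\<^sup>+r. ennreal (chi_weight j r) \<partial>lborel))"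

lemma sets_chi[simp, measurable_cong]: "sets (chi j) = sets borel" and space_chi[simp]: "space (chi j) = UNIV"
  by (auto simp: chi_def)

lemma nn_integral_chi:
  assumes [measurable]: "f \<in> borel_measurable borel"
  shows "(\<integral>\<^sup>+r. f r \<partial>chi j) = (\<integral>\<^sup>+r. ennreal (chi_weight j r) * f r \<partial>lborel) / (\<integral>\<^sup>+r. ennreal (chi_weight j r) \<partial>lborel)"
proof -
  define I where "I = (\<integral>\<^sup>+r. ennreal (chi_weight j r) \<partial>lborel)"
  show ?thesis
    unfolding chi_def I_def[symmetric] by (subst nn_integral_density, measurable)
      (simp add: divide_ennreal_def nn_integral_cmult[symmetric] ac_simps)
qed

text \<open>For the integrand \<open>1\<close> the law reads \<open>1 = K * I\<close>; in
  \<open>ennreal\<close> this excludes both \<open>I = 0\<close> and \<open>I = \<infinity>\<close>,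
  since \<open>K * \<infinity>\<close> is \<open>0\<close> or \<open>\<infinity>\<close>.\<close>

lemma chi_weight_integral_nontrivial:
  "(\<integral>\<^sup>+r. ennreal (chi_weight j r) \<partial>lborel) \<noteq> 0" "(\<integral>\<^sup>+r. ennreal (chi_weight j r) \<partial>lborel) \<noteq> \<infinity>"
proof -
  interpret N: prob_space std_normal_distribution by (intro prob_space_normal_density) simp
  interpret G: prob_space "gauss (j+2)" by (rule prob_space_gauss)
  obtain K where K: "\<And>u f. f \<in> borel_measurable (borel \<Otimes>\<^sub>M borel) \<Longrightarrow>
    (\<integral>\<^sup>+z. f (\<Sum>i<j+2. u i * z i, \<Sum>i<j+2. (z i)\<^sup>2) \<partial>gauss (j+2))
     = K * (\<integral>\<^sup>+a. \<integral>\<^sup>+r. ennreal (chi_weight j r) * f (sqrt (\<Sum>i<j+2. (u i)\<^sup>2) * a, a\<^sup>2 + r\<^sup>2)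
         \<partial>lborel \<partial>std_normal_distribution)"
    using gauss_law_aux[of j] by blast
  have "1 = K * (\<integral>\<^sup>+r. ennreal (chi_weight j r) \<partial>lborel)"
    using K[of "\<lambda>_. 1"] N.emeasure_space_1 G.emeasure_space_1 by simp
  moreover have "(\<integral>\<^sup>+r. ennreal (chi_weight j r) \<partial>lborel) \<noteq> 0" by (metis calculation mult_zero_right zero_neq_one)
  ultimately show "(\<integral>\<^sup>+r. ennreal (chi_weight j r) \<partial>lborel) \<noteq> 0" "(\<integral>\<^sup>+r. ennreal (chi_weight j r) \<partial>lborel) \<noteq> \<infinity>"
    by (auto simp: ennreal_mult_top split: if_splits)
qed

lemma prob_space_chi: "prob_space (chi j)"
proof
  show "emeasure (chi j) (space (chi j)) = 1"
    using nn_integral_chi[of "\<lambda>_. 1" j] chi_weight_integral_nontrivial[of j]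
    by (simp add: ennreal_divide_self less_top)
qed

lemma AE_chi_pos: "AE r in chi j. 0 < r"
  unfolding chi_def by (subst AE_density) (auto simp: chi_weight_def indicator_def)

text \<open>The total mass identifies \<open>K\<close> as the inverse of the chi mass. In dimension
  \<open>n = j + 2\<close> the component along \<open>u\<close> is standard normal and the length of
  the orthogonal part is an independent \<open>chi j\<close> variable, with \<open>n - 1\<close>
  degrees of freedom. Both the noise and the competing codeword are reduced to such a pair by this
  law.\<close>

lemma gauss_law:
  assumes f[measurable]: "f \<in> borel_measurable (borel \<Otimes>\<^sub>M borel)"
  shows "(\<integral>\<^sup>+z. f (\<Sum>i<j+2. u i * z i, \<Sum>i<j+2. (z i)\<^sup>2) \<partial>gauss (j+2))
     = (\<integral>\<^sup>+a. \<integral>\<^sup>+r. f (sqrt (\<Sum>i<j+2. (u i)\<^sup>2) * a, a\<^sup>2 + r\<^sup>2) \<partial>chi j \<partial>std_normal_distribution)"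
proof -
  interpret N: prob_space std_normal_distribution by (intro prob_space_normal_density) simp
  interpret G: prob_space "gauss (j+2)" by (rule prob_space_gauss)
  define I where "I = (\<integral>\<^sup>+r. ennreal (chi_weight j r) \<partial>lborel)"
  obtain K where K: "\<And>u f. f \<in> borel_measurable (borel \<Otimes>\<^sub>M borel) \<Longrightarrow>
    (\<integral>\<^sup>+z. f (\<Sum>i<j+2. u i * z i, \<Sum>i<j+2. (z i)\<^sup>2) \<partial>gauss (j+2))
     = K * (\<integral>\<^sup>+a. \<integral>\<^sup>+r. ennreal (chi_weight j r) * f (sqrt (\<Sum>i<j+2. (u i)\<^sup>2) * a, a\<^sup>2 + r\<^sup>2)
         \<partial>lborel \<partial>std_normal_distribution)"
    using gauss_law_aux[of j] by blast
  have "1 = K * I"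
    using K[of "\<lambda>_. 1"] N.emeasure_space_1 G.emeasure_space_1 by (simp add: I_def)
  moreover have "K * I / I = K"
    using chi_weight_integral_nontrivial[of j] unfolding I_def
    by (intro mult_divide_eq_ennreal) auto
  ultimately have KI: "K = inverse I" by (simp add: divide_ennreal_def)
  show ?thesis
    unfolding K[OF f] KI
    by (subst nn_integral_chi, measurable) (simp add: I_def divide_ennreal_def nn_integral_cmult[symmetric] ac_simps)
qed

section \<open>Random coding\<close>

lemma borel_measurable_pred_le[measurable (raw)]:
  fixes f :: "'a \<Rightarrow> 'b::{second_countable_topology, linorder_topology}"
  shows "f \<in> borel_measurable M \<Longrightarrow> g \<in> borel_measurable M \<Longrightarrow> Measurable.pred M (\<lambda>w. f w \<le> g w)"
  unfolding Measurable.pred_def by (rule borel_measurable_le)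

lemma sets_out_space[measurable_cong]: "sets (out_space n) = sets (PiM {..<n} (\<lambda>_. borel))"
  unfolding out_space_def by (intro sets_PiM_cong) auto

lemma space_out_space: "space (out_space n) = PiE {..<n} (\<lambda>_. UNIV)"
  by (simp add: out_space_def space_PiM)

lemma W_awgn_eq_normal: "W_awgn y x = normal_density x 1 y"
  by (simp add: W_awgn_def normal_density_def)

lemma sets_Wn: "sets (Wn n x) = sets (PiM {..<n} (\<lambda>_. borel))"
  unfolding Wn_def by (intro sets_PiM_cong) auto

lemma space_Wn: "space (Wn n x) = PiE {..<n} (\<lambda>_. UNIV)"
  by (simp add: Wn_def space_PiM)

lemma prob_space_Wn: "prob_space (Wn n x)"
  unfolding Wn_def W_awgn_eq_normal by (intro prob_space_PiM prob_space_normal_density) simp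

text \<open>Writes the channel as additive noise, so that every error probability becomes an
  integral over \<open>gauss n\<close>, where rotation invariance is available. Both measures are
  compared on boxes, coordinate by coordinate.\<close>

lemma Wn_eq_distr_gauss:
  "Wn n x = distr (gauss n) (out_space n) (\<lambda>z. \<lambda>i\<in>{..<n}. x i + z i)"
proof -
  interpret product_sigma_finite "\<lambda>i. density lborel (\<lambda>y. ennreal (W_awgn y (x i)))"
    unfolding W_awgn_eq_normal
    by (intro product_sigma_finite.intro prob_space_imp_sigma_finite prob_space_normal_density) simp
  interpret N: product_sigma_finite "\<lambda>_::nat. std_normal_distribution"
    by (intro product_sigma_finite.intro prob_space_imp_sigma_finite prob_space_normal_density) simp
  show ?thesis
    unfolding Wn_def
  proof (rule PiM_eqI[symmetric])
    show "sets (distr (gauss n) (out_space n) (\<lambda>z. \<lambda>i\<in>{..<n}. x i + z i))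
      = sets (Pi\<^sub>M {..<n} (\<lambda>i. density lborel (\<lambda>y. ennreal (W_awgn y (x i)))))"
      using sets_Wn[of n x] by (simp add: Wn_def sets_out_space)
  next
    fix A assume A: "\<And>i. i \<in> {..<n} \<Longrightarrow> A i \<in> sets (density lborel (\<lambda>y. ennreal (W_awgn y (x i))))"
    then have A'[measurable]: "\<And>i. i < n \<Longrightarrow> A i \<in> sets borel" by auto
    have "Pi\<^sub>E {..<n} A \<in> sets (out_space n)"
      unfolding out_space_def by (intro sets_PiM_I_finite) (auto simp: A')
    then have "emeasure (distr (gauss n) (out_space n) (\<lambda>z. \<lambda>i\<in>{..<n}. x i + z i)) (Pi\<^sub>E {..<n} A)
       = emeasure (gauss n) ((\<lambda>z. \<lambda>i\<in>{..<n}. x i + z i) -` (Pi\<^sub>E {..<n} A) \<inter> space (gauss n))"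
      by (intro emeasure_distr) measurable
    also have "(\<lambda>z. \<lambda>i\<in>{..<n}. x i + z i) -` (Pi\<^sub>E {..<n} A) \<inter> space (gauss n)
       = Pi\<^sub>E {..<n} (\<lambda>i. {z. x i + z \<in> A i})"
      by (rule set_eqI) (simp add: space_gauss restrict_PiE_iff PiE_iff conj_commute)
    also have "emeasure (gauss n) (Pi\<^sub>E {..<n} (\<lambda>i. {z. x i + z \<in> A i}))
       = (\<Prod>i<n. emeasure std_normal_distribution {z. x i + z \<in> A i})"
      unfolding gauss_def
    proof (intro N.emeasure_PiM)
      fix i assume "i \<in> {..<n}"
      then have [measurable]: "A i \<in> sets borel" by auto
      have "{z. x i + z \<in> A i} \<in> sets borel" by measurable
      then show "{z. x i + z \<in> A i} \<in> sets std_normal_distribution" by simp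
    qed simp
    also have "\<dots> = (\<Prod>i<n. emeasure (density lborel (\<lambda>y. ennreal (W_awgn y (x i)))) (A i))"
    proof (rule prod.cong)
      fix i assume i: "i \<in> {..<n}"
      then have [measurable]: "A i \<in> sets borel" by auto
      have m: "{z. x i + z \<in> A i} \<in> sets borel" by measurable
      have "emeasure (density lborel (\<lambda>y. ennreal (W_awgn y (x i)))) (A i)
        = (\<integral>\<^sup>+y. ennreal (W_awgn y (x i)) * indicator (A i) y \<partial>lborel)"
        by (rule emeasure_density) (auto simp: W_awgn_eq_normal)
      also have "\<dots> = ennreal \<bar>1\<bar> * (\<integral>\<^sup>+z. ennreal (W_awgn (x i + 1 * z) (x i)) * indicator (A i) (x i + 1 * z) \<partial>lborel)"
        by (rule nn_integral_real_affine) (auto simp: W_awgn_eq_normal)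
      also have "\<dots> = (\<integral>\<^sup>+z. ennreal (std_normal_density z) * indicator {z. x i + z \<in> A i} z \<partial>lborel)"
        by (auto simp: W_awgn_def std_normal_density_def indicator_def intro!: nn_integral_cong)
      also have "\<dots> = emeasure std_normal_distribution {z. x i + z \<in> A i}"
        using m by (intro emeasure_density[symmetric]) auto
      finally show "emeasure std_normal_distribution {z. x i + z \<in> A i}
         = emeasure (density lborel (\<lambda>y. ennreal (W_awgn y (x i)))) (A i)" by simp
    qed simp
    finally show "emeasure (distr (gauss n) (out_space n) (\<lambda>z. \<lambda>i\<in>{..<n}. x i + z i)) (Pi\<^sub>E {..<n} A)
      = (\<Prod>i<n. emeasure (density lborel (\<lambda>y. ennreal (W_awgn y (x i)))) (A i))" .
  qed simp
qed

section \<open>Marginals of a random codebook and the averaging argument\<close>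

lemma nn_integral_PiM_one:
  assumes Q: "prob_space Q" and I: "m \<in> I"
    and [measurable]: "f \<in> borel_measurable Q"
  shows "(\<integral>\<^sup>+G. f (G m) \<partial>PiM I (\<lambda>_. Q)) = (\<integral>\<^sup>+g. f g \<partial>Q)"
proof -
  have "(\<integral>\<^sup>+g. f g \<partial>Q) = (\<integral>\<^sup>+g. f g \<partial>distr (PiM I (\<lambda>_. Q)) Q (\<lambda>G. G m))"
    using distr_PiM_component[of I "\<lambda>_. Q" m] Q I by simp
  also have "\<dots> = (\<integral>\<^sup>+G. f (G m) \<partial>PiM I (\<lambda>_. Q))"
    using I by (intro nn_integral_distr) auto
  finally show ?thesis by simp
qed

text \<open>The union bound involves only two codewords at a time, hence only pairs of coordinates
  of the random codebook.\<close>

lemma nn_integral_PiM_two: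
  assumes Q: "prob_space Q" and I: "m \<in> I" "m' \<in> I" "m \<noteq> m'"
    and [measurable]: "case_prod f \<in> borel_measurable (Q \<Otimes>\<^sub>M Q)"
  shows "(\<integral>\<^sup>+G. f (G m) (G m') \<partial>PiM I (\<lambda>_. Q)) = (\<integral>\<^sup>+g. \<integral>\<^sup>+g'. f g g' \<partial>Q \<partial>Q)"
proof -
  interpret Q: prob_space Q by fact
  interpret P: product_prob_space "\<lambda>_. Q" I ..
  have "(\<integral>\<^sup>+g. \<integral>\<^sup>+g'. f g g' \<partial>Q \<partial>Q) = (\<integral>\<^sup>+G. f (G m) (G m') \<partial>PiM {m, m'} (\<lambda>_. Q))"
    using I(3) by (subst P.product_nn_integral_pair) (auto simp: Q.nn_integral_fst[symmetric] split_beta')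
  also have "\<dots> = (\<integral>\<^sup>+G. f (G m) (G m') \<partial>distr (PiM I (\<lambda>_. Q)) (PiM {m, m'} (\<lambda>_. Q)) (\<lambda>G. restrict G {m, m'}))"
    using P.distr_PiM_restrict_finite[of "{m, m'}"] I by simp
  also have "\<dots> = (\<integral>\<^sup>+G. f (restrict G {m, m'} m) (restrict G {m, m'} m') \<partial>PiM I (\<lambda>_. Q))"
    using I by (intro nn_integral_distr measurable_restrict_subset) auto
  finally show ?thesis by simp
qed

text \<open>If \<open>f\<close> exceeded \<open>c\<close> everywhere, the positive excess
  \<open>f - c\<close> would have integral zero and so vanish almost everywhere, which is impossible
  on a probability space. This extracts one codebook from the average.\<close>

lemma (in prob_space) nn_integral_le_obtains:
  assumes f[measurable]: "f \<in> borel_measurable M" and le: "(\<integral>\<^sup>+x. f x \<partial>M) \<le> ennreal c"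
  shows "\<exists>x\<in>space M. f x \<le> ennreal c"
proof (rule ccontr)
  assume "\<not> ?thesis"
  then have gt: "\<And>x. x \<in> space M \<Longrightarrow> ennreal c < f x" by (auto simp: not_le)
  have "(\<integral>\<^sup>+x. f x \<partial>M) = (\<integral>\<^sup>+x. (f x - ennreal c) + ennreal c \<partial>M)"
    using gt by (intro nn_integral_cong) (simp add: diff_add_cancel_ennreal less_imp_le)
  also have "\<dots> = (\<integral>\<^sup>+x. (f x - ennreal c) \<partial>M) + ennreal c"
    by (subst nn_integral_add) (auto simp: emeasure_space_1)
  finally have "ennreal c + (\<integral>\<^sup>+x. (f x - ennreal c) \<partial>M) \<le> ennreal c + 0"
    using le by (simp only: add.commute[of "ennreal c"] add_0_left)
  then have "(\<integral>\<^sup>+x. (f x - ennreal c) \<partial>M) \<le> 0"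
    unfolding ennreal_add_left_cancel_le by simp
  then have "(\<integral>\<^sup>+x. (f x - ennreal c) \<partial>M) = 0" by simp
  then have "AE x in M. f x - ennreal c = 0" by (subst (asm) nn_integral_0_iff_AE) auto
  then have "AE x in M. False"
    using AE_space
  proof eventually_elim
    case (elim x)
    then show ?case using gt[of x] by (auto simp: diff_eq_0_iff_ennreal)
  qed
  then show False by simp
qed

text \<open>\<open>B\<close> is an event in which the transmitted codeword scores too low; it is
  counted as an error outright. Outside \<open>B\<close> a union bound over the competitors is used.
  Keeping \<open>B\<close> separate matters because a union bound over all noise vectors would be
  too large for atypical noise.\<close>

lemma random_coding:
  fixes X :: "'g \<Rightarrow> nat \<Rightarrow> real" and s :: "'g \<Rightarrow> (nat \<Rightarrow> real) \<Rightarrow> real"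
  assumes Q: "prob_space Q"
    and X[measurable]: "\<And>i. (\<lambda>g. X g i) \<in> borel_measurable Q"
    and power: "\<And>g. g \<in> space Q \<Longrightarrow> (\<Sum>i<n. (X g i)\<^sup>2) \<le> real n * P"
    and s[measurable]: "case_prod s \<in> borel_measurable (Q \<Otimes>\<^sub>M PiM {..<n} (\<lambda>_. borel))"
    and B[measurable]: "Measurable.pred (Q \<Otimes>\<^sub>M PiM {..<n} (\<lambda>_. borel)) (case_prod B)"
    and M: "M \<ge> 1" and eps: "eps \<ge> 0"
    and Y: "\<And>g z. Y g z = (\<lambda>i\<in>{..<n}. X g i + z i)"
    and bound: "(\<integral>\<^sup>+g. \<integral>\<^sup>+z. of_bool (B g z) \<partial>gauss n \<partial>Q) +
       of_nat M * (\<integral>\<^sup>+g. \<integral>\<^sup>+z. of_bool (\<not> B g z) * (\<integral>\<^sup>+g'. of_bool (s g (Y g z) \<le> s g' (Y g z)) \<partial>Q) \<partial>gauss n \<partial>Q)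
       \<le> ennreal eps"
  shows "\<exists>x D. is_av_code n M eps P x D"
proof -
  interpret Q: prob_space Q by fact
  interpret G: prob_space "gauss n" by (rule prob_space_gauss)
  interpret QG: pair_sigma_finite Q "gauss n" ..
  have Ym[measurable]: "case_prod Y \<in> (Q \<Otimes>\<^sub>M PiM {..<n} (\<lambda>_. borel)) \<rightarrow>\<^sub>M PiM {..<n} (\<lambda>_. borel)"
    unfolding Y split_beta' by measurable
  have sY: "(\<lambda>z. s g' (Y g z)) \<in> borel_measurable (PiM {..<n} (\<lambda>_. borel))"
    if "g \<in> space Q" "g' \<in> space Q" for g g'
    using measurable_compose[OF measurable_compose[OF measurable_Pair1'[OF that(1)] Ym]
        measurable_compose[OF measurable_Pair1'[OF that(2)] s]] by simp
  have le_pred: "Measurable.pred N (\<lambda>z. a z \<le> b z)"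
    if [measurable]: "a \<in> borel_measurable N" "b \<in> borel_measurable N" for a b :: "(nat \<Rightarrow> real) \<Rightarrow> real" and N
    by measurable
  define C where "C = PiM {1..M} (\<lambda>_. Q)"
  interpret C: prob_space C unfolding C_def by (intro prob_space_PiM Q)
  have Cm: "m \<in> {1..M} \<Longrightarrow> (\<lambda>G. G m) \<in> C \<rightarrow>\<^sub>M Q" for m
    unfolding C_def by (rule measurable_component_singleton)
  have Csp: "G \<in> space C \<Longrightarrow> m \<in> {1..M} \<Longrightarrow> G m \<in> space Q" for G m
    unfolding C_def space_PiM by auto
  \<comment> \<open>The inequality is strict: an output with a tie belongs to no region, which gives
    disjointness without a tie-breaking rule and counts ties as errors.\<close>
  define D where "D G m = {y \<in> space (out_space n). \<forall>m'\<in>{1..M}-{m}. s (G m') y < s (G m) y}" for G m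
  define p1 where "p1 = (\<integral>\<^sup>+g. \<integral>\<^sup>+z. of_bool (B g z) \<partial>gauss n \<partial>Q)"
  define p2 where "p2 = (\<integral>\<^sup>+g. \<integral>\<^sup>+z. of_bool (\<not> B g z) * (\<integral>\<^sup>+g'. of_bool (s g (Y g z) \<le> s g' (Y g z)) \<partial>Q) \<partial>gauss n \<partial>Q)"
  define U :: "(nat \<Rightarrow> 'g) \<Rightarrow> nat \<Rightarrow> ennreal" where
    "U G m = (\<integral>\<^sup>+z. of_bool (B (G m) z) \<partial>gauss n) +
       (\<Sum>m'\<in>{1..M}-{m}. \<integral>\<^sup>+z. of_bool (\<not> B (G m) z) * of_bool (s (G m) (Y (G m) z) \<le> s (G m') (Y (G m) z)) \<partial>gauss n)" for G m
  have Dm: "D G m \<in> sets (out_space n)" if "G \<in> space C" "m \<in> {1..M}" for G m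
  proof -
    have [measurable]: "s (G m) \<in> borel_measurable (PiM {..<n} (\<lambda>_. borel))" if "m \<in> {1..M}" for m
      using measurable_compose[OF measurable_Pair1'[of "G m" Q] s] Csp[OF \<open>G \<in> space C\<close> that] by simp
    show ?thesis using that(2) unfolding D_def by measurable
  qed
  have err: "emeasure (Wn n (X (G m))) (space (out_space n) - D G m) \<le> U G m"
    if G: "G \<in> space C" and m: "m \<in> {1..M}" for G m
  proof -
    have Gsp: "G m' \<in> space Q" if "m' \<in> {1..M}" for m' using Csp G that by auto
    have [measurable]: "G m \<in> space Q" using Csp G m by auto
    have Ysp: "Y (G m) z \<in> space (out_space n)" for z
      unfolding Y space_out_space by auto
    have "emeasure (Wn n (X (G m))) (space (out_space n) - D G m)
      = emeasure (gauss n) ((\<lambda>z. \<lambda>i\<in>{..<n}. X (G m) i + z i) -` (space (out_space n) - D G m) \<inter> space (gauss n))"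
      unfolding Wn_eq_distr_gauss using Dm[OF G m] by (intro emeasure_distr) auto
    also have "\<dots> = (\<integral>\<^sup>+z. indicator ((\<lambda>z. \<lambda>i\<in>{..<n}. X (G m) i + z i) -` (space (out_space n) - D G m) \<inter> space (gauss n)) z \<partial>gauss n)"
      using Dm[OF G m] by (intro nn_integral_indicator[symmetric] measurable_sets[of _ "gauss n" "out_space n"]) auto
    \<comment> \<open>If the output misses its region and \<open>B\<close> fails, some competitor
      scores at least as well, so the corresponding summand equals one.\<close>
    also have "\<dots> \<le> (\<integral>\<^sup>+z. of_bool (B (G m) z) + (\<Sum>m'\<in>{1..M}-{m}. of_bool (\<not> B (G m) z) * of_bool (s (G m) (Y (G m) z) \<le> s (G m') (Y (G m) z))) \<partial>gauss n)"
    proof (rule nn_integral_mono)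
      fix z assume "z \<in> space (gauss n)"
      show "indicator ((\<lambda>z. \<lambda>i\<in>{..<n}. X (G m) i + z i) -` (space (out_space n) - D G m) \<inter> space (gauss n)) z
        \<le> (of_bool (B (G m) z) + (\<Sum>m'\<in>{1..M}-{m}. of_bool (\<not> B (G m) z) * of_bool (s (G m) (Y (G m) z) \<le> s (G m') (Y (G m) z))) :: ennreal)"
      proof (cases "Y (G m) z \<notin> D G m \<and> \<not> B (G m) z")
        case True
        then obtain m' where m': "m' \<in> {1..M}-{m}" "s (G m) (Y (G m) z) \<le> s (G m') (Y (G m) z)"
          using Ysp unfolding D_def by force
        have "(1::ennreal) \<le> of_bool (s (G m) (Y (G m) z) \<le> s (G m') (Y (G m) z))" using m' by simp
        also have "\<dots> \<le> (\<Sum>m'\<in>{1..M}-{m}. of_bool (s (G m) (Y (G m) z) \<le> s (G m') (Y (G m) z)))"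
          using m' by (intro member_le_sum) auto
        finally show ?thesis using True by (auto simp: indicator_def)
      next
        case False
        then show ?thesis by (auto simp: indicator_def Y)
      qed
    qed
    also have "\<dots> = U G m"
    proof -
      have tm: "(\<lambda>z. of_bool (\<not> B (G m) z) * of_bool (s (G m) (Y (G m) z) \<le> s (G m') (Y (G m) z)) :: ennreal)
          \<in> borel_measurable (gauss n)" if "m' \<in> {1..M} - {m}" for m'
      proof -
        have [measurable]: "Measurable.pred (PiM {..<n} (\<lambda>_. borel)) (\<lambda>z. s (G m) (Y (G m) z) \<le> s (G m') (Y (G m) z))"
          using that m by (intro le_pred sY Gsp) auto
        show ?thesis by measurable
      qed
      show ?thesis unfolding U_def
        by (subst nn_integral_sum[OF tm, symmetric], assumption)
          (intro nn_integral_add borel_measurable_sum tm; (assumption | measurable))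
    qed
    finally show ?thesis .
  qed
  have Um[measurable]: "(\<lambda>G. U G m) \<in> borel_measurable C" if "m \<in> {1..M}" for m
  proof -
    have tm: "(\<lambda>G. \<integral>\<^sup>+z. of_bool (\<not> B (G m) z) * of_bool (s (G m) (Y (G m) z) \<le> s (G m') (Y (G m) z)) \<partial>gauss n :: ennreal)
          \<in> borel_measurable C" if "m' \<in> {1..M} - {m}" for m'
    proof -
      have [measurable]: "(\<lambda>G. G m) \<in> C \<rightarrow>\<^sub>M Q" "(\<lambda>G. G m') \<in> C \<rightarrow>\<^sub>M Q"
        using that \<open>m \<in> {1..M}\<close> Cm by auto
      show ?thesis by measurable
    qed
    have [measurable]: "(\<lambda>G. G m) \<in> C \<rightarrow>\<^sub>M Q" using Cm that by auto
    show ?thesis unfolding U_def by (intro borel_measurable_add borel_measurable_sum tm) measurable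
  qed
  have intU: "(\<integral>\<^sup>+G. U G m \<partial>C) \<le> ennreal eps" if m: "m \<in> {1..M}" for m
  proof -
    let ?T = "\<lambda>g g'. \<integral>\<^sup>+z. of_bool (\<not> B g z) * of_bool (s g (Y g z) \<le> s g' (Y g z)) \<partial>gauss n :: ennreal"
    have [measurable]: "(\<lambda>G. G m) \<in> C \<rightarrow>\<^sub>M Q" using Cm m by auto
    have "(\<integral>\<^sup>+G. U G m \<partial>C) = (\<integral>\<^sup>+G. (\<integral>\<^sup>+z. of_bool (B (G m) z) \<partial>gauss n) \<partial>C) +
       (\<Sum>m'\<in>{1..M}-{m}. \<integral>\<^sup>+G. ?T (G m) (G m') \<partial>C)"
    proof -
      have tm: "(\<lambda>G. ?T (G m) (G m')) \<in> borel_measurable C" if "m' \<in> {1..M} - {m}" for m'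
      proof -
        have [measurable]: "(\<lambda>G. G m) \<in> C \<rightarrow>\<^sub>M Q" "(\<lambda>G. G m') \<in> C \<rightarrow>\<^sub>M Q"
          using that m Cm by auto
        show ?thesis by measurable
      qed
      show ?thesis unfolding U_def
        by (subst nn_integral_sum[OF tm, symmetric], assumption)
          (intro nn_integral_add borel_measurable_sum tm; (assumption | measurable))
    qed
    also have "(\<integral>\<^sup>+G. (\<integral>\<^sup>+z. of_bool (B (G m) z) \<partial>gauss n) \<partial>C) = p1"
      unfolding C_def p1_def using m by (intro nn_integral_PiM_one Q) auto
    also have "(\<Sum>m'\<in>{1..M}-{m}. \<integral>\<^sup>+G. ?T (G m) (G m') \<partial>C) = (\<Sum>m'\<in>{1..M}-{m}. p2)"
    proof (rule sum.cong)
      fix m' assume m': "m' \<in> {1..M}-{m}"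
      have "(\<integral>\<^sup>+G. ?T (G m) (G m') \<partial>C) = (\<integral>\<^sup>+g. \<integral>\<^sup>+g'. ?T g g' \<partial>Q \<partial>Q)"
        unfolding C_def using m m' by (intro nn_integral_PiM_two Q) auto
      also have "\<dots> = p2"
        unfolding p2_def
      proof (rule nn_integral_cong)
        fix g assume [measurable]: "g \<in> space Q"
        have "(\<integral>\<^sup>+g'. ?T g g' \<partial>Q) = (\<integral>\<^sup>+z. \<integral>\<^sup>+g'. of_bool (\<not> B g z) * of_bool (s g (Y g z) \<le> s g' (Y g z)) \<partial>Q \<partial>gauss n)"
          by (intro QG.Fubini'[symmetric]) measurable
        also have "\<dots> = (\<integral>\<^sup>+z. of_bool (\<not> B g z) * (\<integral>\<^sup>+g'. of_bool (s g (Y g z) \<le> s g' (Y g z)) \<partial>Q) \<partial>gauss n)"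
          by (intro nn_integral_cong nn_integral_cmult) (measurable; simp add: space_gauss space_PiM)
        finally show "(\<integral>\<^sup>+g'. ?T g g' \<partial>Q) = \<dots>" .
      qed
      finally show "(\<integral>\<^sup>+G. ?T (G m) (G m') \<partial>C) = p2" .
    qed simp
    also have "p1 + (\<Sum>m'\<in>{1..M}-{m}. p2) \<le> p1 + of_nat M * p2"
      using card_Diff1_le[of "{Suc 0..M}" m] by (intro add_left_mono) (auto intro!: mult_right_mono)
    also have "\<dots> \<le> ennreal eps" using bound by (simp add: p1_def p2_def)
    finally show ?thesis .
  qed
  have "(\<integral>\<^sup>+G. (\<Sum>m=1..M. U G m) \<partial>C) = (\<Sum>m=1..M. \<integral>\<^sup>+G. U G m \<partial>C)"
    by (intro nn_integral_sum) auto
  also have "\<dots> \<le> (\<Sum>m=1..M. ennreal eps)" by (intro sum_mono intU) auto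
  also have "\<dots> = ennreal (real M * eps)" using eps by (simp add: ennreal_mult' ennreal_of_nat_eq_real_of_nat)
  finally obtain G where G: "G \<in> space C" "(\<Sum>m=1..M. U G m) \<le> ennreal (real M * eps)"
    using C.nn_integral_le_obtains[of "\<lambda>G. \<Sum>m=1..M. U G m"] by auto
  have "ennreal (\<Sum>m=1..M. measure (Wn n (X (G m))) (space (out_space n) - D G m))
     = (\<Sum>m=1..M. emeasure (Wn n (X (G m))) (space (out_space n) - D G m))"
    by (subst sum_ennreal[symmetric])
      (auto intro!: sum.cong simp: finite_measure.emeasure_eq_measure[OF prob_space.axioms(1)[OF prob_space_Wn]])
  also have "\<dots> \<le> (\<Sum>m=1..M. U G m)" by (intro sum_mono err G(1)) auto
  also note G(2)
  finally have "(\<Sum>m=1..M. measure (Wn n (X (G m))) (space (out_space n) - D G m)) \<le> real M * eps"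
    using eps by (subst (asm) ennreal_le_iff) auto
  then have avg: "1 / real M * (\<Sum>m=1..M. measure (Wn n (X (G m))) (space (out_space n) - D G m)) \<le> eps"
    using M by (simp add: divide_le_eq mult.commute)
  have disj: "D G m \<inter> D G m' = {}" if "m \<in> {1..M}" "m' \<in> {1..M}" "m \<noteq> m'" for m m'
  proof -
    have False if y: "y \<in> D G m" "y \<in> D G m'" for y
    proof -
      have "s (G m') y < s (G m) y" using y(1) \<open>m' \<in> {1..M}\<close> \<open>m \<noteq> m'\<close> unfolding D_def by blast
      moreover have "s (G m) y < s (G m') y" using y(2) \<open>m \<in> {1..M}\<close> \<open>m \<noteq> m'\<close> unfolding D_def by blast
      ultimately show False by simp
    qed
    then show ?thesis by blast
  qed
  have "is_av_code n M eps P (\<lambda>m. X (G m)) (D G)"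
    unfolding is_av_code_def using avg disj Dm[OF G(1)] power[OF Csp[OF G(1)]] by blast
  then show ?thesis by blast
qed

section \<open>Moments and tails of the chi distribution\<close>

definition chi_const :: "nat \<Rightarrow> real" where
  "chi_const j = (\<integral>r. chi_weight j r \<partial>lborel)"

lemma nn_integral_chi_weight: "(\<integral>\<^sup>+r. ennreal (chi_weight j r) \<partial>lborel) = ennreal (chi_const j)"
  and integrable_chi_weight[simp]: "integrable lborel (chi_weight j)"
  and chi_const_pos[simp]: "chi_const j > 0"
proof -
  note fin = chi_weight_integral_nontrivial[of j]
  show int: "integrable lborel (chi_weight j)"
    using fin(2) by (intro integrableI_nonneg) (auto simp: less_top)
  show eq: "(\<integral>\<^sup>+r. ennreal (chi_weight j r) \<partial>lborel) = ennreal (chi_const j)"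
    unfolding chi_const_def by (intro nn_integral_eq_integral int) auto
  show "chi_const j > 0" using fin(1) unfolding eq by (simp add: ennreal_eq_0_iff not_le)
qed

text \<open>By symmetry the half-line carries half of the absolute moment; the factor
  \<open>sqrt (2 * pi)\<close> undoes the normalization of the density.\<close>

lemma chi_const_eq_moment:
  assumes "has_bochner_integral lborel (\<lambda>x. std_normal_density x * \<bar>x\<bar> ^ j) v"
  shows "chi_const j = sqrt (2 * pi) / 2 * v"
proof -
  have v: "v \<ge> 0" using assms by (auto simp: has_bochner_integral_iff)
  have "ennreal v = (\<integral>\<^sup>+x. ennreal (std_normal_density x * \<bar>x\<bar> ^ j) \<partial>lborel)"
    using assms by (subst nn_integral_eq_integral) (auto simp: has_bochner_integral_iff)
  also have "\<dots> = (\<integral>\<^sup>+x. ennreal (sqrt (x\<^sup>2) ^ j) \<partial>std_normal_distribution)"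
    by (subst nn_integral_std_normal) (auto simp: ennreal_mult)
  also have "\<dots> = ennreal (2 / sqrt (2 * pi)) * (\<integral>\<^sup>+r. ennreal (chi_weight 0 r) * ennreal (sqrt (r\<^sup>2) ^ j) \<partial>lborel)"
    by (rule nn_integral_std_normal_even) measurable
  also have "(\<integral>\<^sup>+r. ennreal (chi_weight 0 r) * ennreal (sqrt (r\<^sup>2) ^ j) \<partial>lborel) = (\<integral>\<^sup>+r. ennreal (chi_weight j r) \<partial>lborel)"
    by (intro nn_integral_cong) (auto simp: chi_weight_def ennreal_mult[symmetric] indicator_def)
  also have "\<dots> = ennreal (chi_const j)" by (rule nn_integral_chi_weight)
  finally have "v = 2 / sqrt (2 * pi) * chi_const j"
    using v by (simp add: ennreal_mult[symmetric] less_imp_le)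
  then show ?thesis by simp
qed

text \<open>The Gaussian moment recursion, read off from the closed forms of the absolute moments;
  these differ for even and odd orders, hence the parity split.\<close>

lemma chi_const_rec: "chi_const (j + 2) = (real j + 1) * chi_const j"
proof (cases "even j")
  case True
  then obtain i where j: "j = 2 * i" by auto
  have *: "has_bochner_integral lborel (\<lambda>x. std_normal_density x * \<bar>x\<bar> ^ (2 * k)) (fact (2 * k) / (2 ^ k * fact k))" for k
    using std_normal_moment_even[of k] by (simp add: power_even_abs)
  have e: "j + 2 = 2 * (i + 1)" using j by simp
  have c1: "chi_const (j + 2) = sqrt (2 * pi) / 2 * (fact (2 * (i + 1)) / (2 ^ (i + 1) * fact (i + 1)))"
    unfolding e by (rule chi_const_eq_moment[OF *])
  have c0: "chi_const j = sqrt (2 * pi) / 2 * (fact (2 * i) / (2 ^ i * fact i))"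
    unfolding j by (rule chi_const_eq_moment[OF *])
  have eq: "fact (2 * (i + 1)) / (2 ^ (i + 1) * fact (i + 1)) = (real j + 1) * (fact (2 * i) / (2 ^ i * fact i) :: real)"
    by (simp add: j divide_simps)
  show ?thesis unfolding c1 c0 eq by (simp only: mult_ac)
next
  case False
  then obtain i where j: "j = 2 * i + 1" using oddE by blast
  have *: "has_bochner_integral lborel (\<lambda>x. std_normal_density x * \<bar>x\<bar> ^ (2 * k + 1)) (sqrt (2 / pi) * 2 ^ k * fact k)" for k
    by (rule std_normal_moment_abs_odd)
  have e: "j + 2 = 2 * (i + 1) + 1" using j by simp
  have c1: "chi_const (j + 2) = sqrt (2 * pi) / 2 * (sqrt (2 / pi) * 2 ^ (i + 1) * fact (i + 1))"
    unfolding e by (rule chi_const_eq_moment[OF *])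
  have c0: "chi_const j = sqrt (2 * pi) / 2 * (sqrt (2 / pi) * 2 ^ i * fact i)"
    unfolding j by (rule chi_const_eq_moment[OF *])
  show ?thesis unfolding c1 c0 by (simp add: algebra_simps j)
qed

text \<open>Integrates \<open>r \<le> (t + r\<^sup>2 / t) / 2\<close> against the weight. With
  \<open>t\<close> free this is a linear substitute for the Cauchy-Schwarz inequality between
  consecutive moments.\<close>

lemma chi_const_am_gm:
  assumes "t > 0"
  shows "chi_const (j + 1) \<le> (t * chi_const j + chi_const (j + 2) / t) / 2"
proof -
  have "chi_const (j + 1) \<le> (\<integral>r. (t * chi_weight j r + chi_weight (j + 2) r / t) / 2 \<partial>lborel)"
    unfolding chi_const_def
  proof (rule integral_mono)
    fix r :: real
    show "chi_weight (j + 1) r \<le> (t * chi_weight j r + chi_weight (j + 2) r / t) / 2"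
    proof (cases "r > 0")
      case True
      have "0 \<le> (t - r)\<^sup>2 / t" using assms by simp
      then have "2 * r \<le> t + r\<^sup>2 / t" using assms by (simp add: power2_eq_square field_simps)
      then have "r \<le> (t + r\<^sup>2 / t) / 2" by simp
      then have "(r ^ j * exp (- r\<^sup>2 / 2)) * r \<le> (r ^ j * exp (- r\<^sup>2 / 2)) * ((t + r\<^sup>2 / t) / 2)"
        using True by (intro mult_left_mono) auto
      then show ?thesis using True assms by (simp add: chi_weight_def power2_eq_square field_simps)
    qed (simp add: chi_weight_def)
  qed auto
  also have "\<dots> = (t * chi_const j + chi_const (j + 2) / t) / 2"
    unfolding chi_const_def by simp
  finally show ?thesis .
qed

text \<open>At \<open>t = sqrt (j + 1)\<close> the recursion makes the two terms of the mean
  equal.\<close>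

lemma chi_const_upper: "chi_const (j + 1) \<le> sqrt (real j + 1) * chi_const j"
proof -
  have "chi_const (j + 1) \<le> (sqrt (real j + 1) * chi_const j + (real j + 1) * chi_const j / sqrt (real j + 1)) / 2"
    using chi_const_am_gm[of "sqrt (real j + 1)" j] by (simp add: chi_const_rec[simplified])
  also have "(real j + 1) * chi_const j / sqrt (real j + 1) = sqrt (real j + 1) * chi_const j"
    by (simp add: real_div_sqrt flip: times_divide_eq_left)
  finally show ?thesis by (simp add: mult.commute)
qed

text \<open>The same choice of \<open>t\<close>, with \<open>chi_const j\<close> rewritten through
  \<open>chi_const (j + 2)\<close>.\<close>

lemma chi_const_lower: "sqrt (real j + 1) * chi_const (j + 1) \<le> chi_const (j + 2)"
proof -
  define q where "q = sqrt (real j + 1)"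
  have q: "q > 0" "q * q = real j + 1" by (auto simp: q_def)
  have "chi_const (j + 1) \<le> (q * chi_const j + chi_const (j + 2) / q) / 2"
    using chi_const_am_gm[of q j] q by simp
  also have "chi_const j = chi_const (j + 2) / (q * q)"
    using chi_const_rec[of j] q(2) by (simp add: field_simps)
  finally show ?thesis unfolding q_def[symmetric] using q(1) by (simp add: field_simps)
qed

text \<open>Needed because the substitution \<open>v = (A + x) / y\<close> in the competitor
  estimate leaves a Jacobian \<open>y\<close>.\<close>

lemma nn_integral_chi_mean: "(\<integral>\<^sup>+r. ennreal r \<partial>chi j) \<le> ennreal (sqrt (real j + 1))"
proof -
  have "(\<integral>\<^sup>+r. ennreal r \<partial>chi j) = (\<integral>\<^sup>+r. ennreal (chi_weight (j + 1) r) \<partial>lborel) / (\<integral>\<^sup>+r. ennreal (chi_weight j r) \<partial>lborel)"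
    by (subst nn_integral_chi) (auto intro!: arg_cong2[where f="(/)"] nn_integral_cong
        simp: chi_weight_def ennreal_mult[symmetric] indicator_def mult_ac)
  also have "\<dots> = ennreal (chi_const (j + 1) / chi_const j)"
    unfolding nn_integral_chi_weight by (simp add: divide_ennreal less_imp_le)
  also have "\<dots> \<le> ennreal (sqrt (real j + 1))"
    using chi_const_upper[of j] by (intro ennreal_leI) (simp add: divide_le_eq)
  finally show ?thesis .
qed

text \<open>The integrand is inflated by \<open>a v / (r w\<^sup>2) \<ge> 1\<close>, which turns both Gaussian tails into
  exact integrals.\<close>
lemma gaussian_double_tail:
  fixes w r :: real
  assumes w: "w > 0" and r: "r > 0"
  shows "(\<integral>\<^sup>+v. of_bool (w < v) * (\<integral>\<^sup>+a. of_bool (v * r \<le> a) \<partial>std_normal_distribution) \<partial>lborel)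
    \<le> ennreal (exp (- (w * r)\<^sup>2 / 2) / (sqrt (2 * pi) * w\<^sup>2 * r ^ 3))"
proof -
  have inner: "(\<integral>\<^sup>+a. of_bool (v * r \<le> a) \<partial>std_normal_distribution) \<le> ennreal (exp (- (v * r)\<^sup>2 / 2) / (sqrt (2 * pi) * (v * r)))"
    if v: "v > 0" for v
  proof -
    have vr: "v * r > 0" using v r by simp
    have "(\<integral>\<^sup>+a. of_bool (v * r \<le> a) \<partial>std_normal_distribution)
       = (\<integral>\<^sup>+a. ennreal (std_normal_density a) * of_bool (v * r \<le> a) \<partial>lborel)"
      by (rule nn_integral_std_normal) measurable
    also have "\<dots> \<le> (\<integral>\<^sup>+a. ennreal (a * exp (- a\<^sup>2 / 2) / (sqrt (2 * pi) * (v * r))) * indicator {v * r..} a \<partial>lborel)"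
      using vr by (intro nn_integral_mono)
        (auto simp: std_normal_density_def indicator_def divide_simps intro!: ennreal_leI)
    also have "\<dots> = ennreal (0 - (- exp (- (v * r)\<^sup>2 / 2) / (sqrt (2 * pi) * (v * r))))"
    proof (rule nn_integral_FTC_atLeast[where F="\<lambda>a. - exp (- a\<^sup>2 / 2) / (sqrt (2 * pi) * (v * r))" and T=0])
      show "((\<lambda>a. - exp (- a\<^sup>2 / 2) / (sqrt (2 * pi) * (v * r))) \<longlongrightarrow> 0) at_top"
      proof -
        have "((\<lambda>a::real. - exp (- a\<^sup>2 / 2)) \<longlongrightarrow> 0) at_top" by real_asymp
        then show ?thesis by (rule tendsto_divide_zero)
      qed
    next
      fix x assume "v * r \<le> x"
      show "((\<lambda>a. - exp (- a\<^sup>2 / 2) / (sqrt (2 * pi) * (v * r))) has_real_derivative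
          x * exp (- x\<^sup>2 / 2) / (sqrt (2 * pi) * (v * r))) (at x)"
        using vr by (auto intro!: derivative_eq_intros)
      show "0 \<le> x * exp (- x\<^sup>2 / 2) / (sqrt (2 * pi) * (v * r))"
        using vr v r \<open>v * r \<le> x\<close> by (intro divide_nonneg_nonneg mult_nonneg_nonneg; linarith?) auto
    qed auto
    finally show ?thesis by simp
  qed
  have "(\<integral>\<^sup>+v. of_bool (w < v) * (\<integral>\<^sup>+a. of_bool (v * r \<le> a) \<partial>std_normal_distribution) \<partial>lborel)
    \<le> (\<integral>\<^sup>+v. ennreal (v * exp (- (v * r)\<^sup>2 / 2) / (sqrt (2 * pi) * r * w\<^sup>2)) * indicator {w..} v \<partial>lborel)"
  proof (rule nn_integral_mono)
    fix v :: real
    show "of_bool (w < v) * (\<integral>\<^sup>+a. of_bool (v * r \<le> a) \<partial>std_normal_distribution)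
      \<le> ennreal (v * exp (- (v * r)\<^sup>2 / 2) / (sqrt (2 * pi) * r * w\<^sup>2)) * indicator {w..} v"
    proof (cases "w < v")
      case True
      have "exp (- (v * r)\<^sup>2 / 2) / (sqrt (2 * pi) * (v * r)) \<le> v * exp (- (v * r)\<^sup>2 / 2) / (sqrt (2 * pi) * r * w\<^sup>2)"
      proof -
        have "1 / v \<le> v / w\<^sup>2" using w True by (simp add: divide_simps power2_eq_square mult_mono)
        then have "1 / v * (exp (- (v * r)\<^sup>2 / 2) / (sqrt (2 * pi) * r)) \<le> v / w\<^sup>2 * (exp (- (v * r)\<^sup>2 / 2) / (sqrt (2 * pi) * r))"
          using r by (intro mult_right_mono) auto
        then show ?thesis by (simp add: mult_ac)
      qed
      then have "ennreal (exp (- (v * r)\<^sup>2 / 2) / (sqrt (2 * pi) * (v * r))) \<le> ennreal (v * exp (- (v * r)\<^sup>2 / 2) / (sqrt (2 * pi) * r * w\<^sup>2))"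
        by (rule ennreal_leI)
      then show ?thesis using True w order_trans[OF inner] by (auto simp: indicator_def)
    qed simp
  qed
  also have "\<dots> = ennreal (0 - (- exp (- (w * r)\<^sup>2 / 2) / (sqrt (2 * pi) * w\<^sup>2 * r ^ 3)))"
  proof (rule nn_integral_FTC_atLeast[where F="\<lambda>v. - exp (- (v * r)\<^sup>2 / 2) / (sqrt (2 * pi) * w\<^sup>2 * r ^ 3)" and T=0])
    show "((\<lambda>v. - exp (- (v * r)\<^sup>2 / 2) / (sqrt (2 * pi) * w\<^sup>2 * r ^ 3)) \<longlongrightarrow> 0) at_top"
      using r w by real_asymp
  next
    fix x assume "w \<le> x"
    show "((\<lambda>v. - exp (- (v * r)\<^sup>2 / 2) / (sqrt (2 * pi) * w\<^sup>2 * r ^ 3)) has_real_derivative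
        x * exp (- (x * r)\<^sup>2 / 2) / (sqrt (2 * pi) * r * w\<^sup>2)) (at x)"
      using r w by (auto intro!: derivative_eq_intros simp: power2_eq_square power3_eq_cube divide_simps)
    show "0 \<le> x * exp (- (x * r)\<^sup>2 / 2) / (sqrt (2 * pi) * r * w\<^sup>2)"
      using w r \<open>w \<le> x\<close> by (intro divide_nonneg_nonneg mult_nonneg_nonneg) auto
  qed auto
  finally show ?thesis by simp
qed

text \<open>Multiplying the chi weight by \<open>exp (- (w * r)\<^sup>2 / 2)\<close> gives a chi
  weight at the scale \<open>s = sqrt (1 + w\<^sup>2)\<close>, the source of the exponential rate.
  The factor \<open>r ^ 3\<close> in the denominator lowers the exponent from \<open>i + 3\<close>
  to \<open>i\<close>, which is why the index is shifted by three; the quotient of normalizations is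
  bounded by one recursion step and one \<open>chi_const_lower\<close> step.\<close>

lemma nn_integral_chi_tail:
  fixes w :: real
  assumes w: "w > 0"
  shows "(\<integral>\<^sup>+r. ennreal (exp (- (w * r)\<^sup>2 / 2) / (sqrt (2 * pi) * w\<^sup>2 * r ^ 3)) \<partial>chi (i + 3))
    \<le> ennreal (1 / (sqrt (2 * pi) * w\<^sup>2 * sqrt (1 + w\<^sup>2) ^ (i + 1) * ((real i + 1) * sqrt (real i + 2))))"
proof -
  define s where "s = sqrt (1 + w\<^sup>2)"
  have s: "s > 0" "s\<^sup>2 = 1 + w\<^sup>2" by (auto simp: s_def add_pos_nonneg)
  define c where "c = 1 / (sqrt (2 * pi) * w\<^sup>2)"
  have c: "c \<ge> 0" by (simp add: c_def)
  have "(\<integral>\<^sup>+r. ennreal (chi_weight (i + 3) r) * ennreal (exp (- (w * r)\<^sup>2 / 2) / (sqrt (2 * pi) * w\<^sup>2 * r ^ 3)) \<partial>lborel)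
    = (\<integral>\<^sup>+r. ennreal (c / s ^ i * chi_weight i (s * r)) \<partial>lborel)"
  proof (rule nn_integral_cong)
    fix r :: real
    have "chi_weight (i + 3) r * (exp (- (w * r)\<^sup>2 / 2) / (sqrt (2 * pi) * w\<^sup>2 * r ^ 3)) = c / s ^ i * chi_weight i (s * r)"
    proof (cases "r > 0")
      case True
      have "(s * r)\<^sup>2 = r\<^sup>2 + (w * r)\<^sup>2" using s(2) by (simp add: power_mult_distrib algebra_simps)
      then have "exp (- (s * r)\<^sup>2 / 2) = exp (- r\<^sup>2 / 2) * exp (- (w * r)\<^sup>2 / 2)"
        by (simp add: exp_add[symmetric] add_divide_distrib diff_divide_distrib)
      then show ?thesis using True s(1)
        by (simp add: chi_weight_def c_def power_add power_mult_distrib field_simps)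
    qed (use s in \<open>auto simp: chi_weight_def indicator_def zero_less_mult_iff\<close>)
    moreover have "chi_weight (i + 3) r = 0" if "r \<le> 0" using that by (simp add: chi_weight_def)
    ultimately show "ennreal (chi_weight (i + 3) r) * ennreal (exp (- (w * r)\<^sup>2 / 2) / (sqrt (2 * pi) * w\<^sup>2 * r ^ 3))
      = ennreal (c / s ^ i * chi_weight i (s * r))"
      by (metis chi_weight_nonneg ennreal_mult')
  qed
  also have "\<dots> = ennreal (c / s ^ i) * (\<integral>\<^sup>+r. ennreal (chi_weight i (s * r)) \<partial>lborel)"
    using c s(1) by (subst nn_integral_cmult[symmetric]) (auto simp: ennreal_mult'[symmetric])
  also have "(\<integral>\<^sup>+r. ennreal (chi_weight i (s * r)) \<partial>lborel) = ennreal (1 / s) * ennreal (chi_const i)"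
    using nn_integral_real_affine[of "\<lambda>r. ennreal (chi_weight i (s * r))" "1 / s" 0] s(1)
    by (simp add: nn_integral_chi_weight)
  also have "ennreal (c / s ^ i) * (ennreal (1 / s) * ennreal (chi_const i)) = ennreal (c / s ^ (i + 1) * chi_const i)"
    using c s(1) by (simp add: ennreal_mult[symmetric] less_imp_le field_simps)
  finally have "(\<integral>\<^sup>+r. ennreal (exp (- (w * r)\<^sup>2 / 2) / (sqrt (2 * pi) * w\<^sup>2 * r ^ 3)) \<partial>chi (i + 3))
    = ennreal (c / s ^ (i + 1) * chi_const i) / ennreal (chi_const (i + 3))"
    by (subst nn_integral_chi) (auto simp: nn_integral_chi_weight)
  also have "\<dots> = ennreal (c / s ^ (i + 1) * (chi_const i / chi_const (i + 3)))"
    using c s(1) by (subst divide_ennreal) (auto simp: less_imp_le)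
  also have "\<dots> \<le> ennreal (c / s ^ (i + 1) * (1 / ((real i + 1) * sqrt (real i + 2))))"
  proof (intro ennreal_leI mult_left_mono)
    have "chi_const (i + 3) \<ge> sqrt (real i + 2) * ((real i + 1) * chi_const i)"
      using chi_const_lower[of "i + 1"] chi_const_rec[of i] by (simp add: numeral_eq_Suc add.commute)
    then have "chi_const i / chi_const (i + 3) \<le> chi_const i / (sqrt (real i + 2) * ((real i + 1) * chi_const i))"
      by (intro divide_left_mono) (auto simp: less_imp_le)
    also have "\<dots> = 1 / ((real i + 1) * sqrt (real i + 2))"
      using less_imp_neq[OF chi_const_pos[of i]]
      by (subst mult.assoc[symmetric], subst nonzero_divide_mult_cancel_right) (auto simp: mult.commute)
    finally show "chi_const i / chi_const (i + 3) \<le> 1 / ((real i + 1) * sqrt (real i + 2))" .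
  qed (use c s(1) in auto)
  finally show ?thesis by (simp add: c_def s_def mult_ac)
qed

text \<open>Bounding the density of \<open>x\<close> by \<open>1 / sqrt (2 * pi)\<close> turns the
  average over \<open>x\<close> into a Lebesgue integral over \<open>v = (A + x) / y\<close>. The
  function \<open>T\<close> and the range \<open>v > w\<close> then no longer involve
  \<open>y\<close> or \<open>A\<close>, so the expression factors into the mean of \<open>y\<close>
  and one integral of \<open>T\<close>. The result has order \<open>1 / i\<close> times the
  exponential factor.\<close>

lemma competitor_bound:
  fixes A w :: real
  assumes w: "w > 0"
  shows "(\<integral>\<^sup>+x. \<integral>\<^sup>+y. of_bool (w * y < A + x) * (\<integral>\<^sup>+a. \<integral>\<^sup>+r. of_bool ((A + x) / y * r \<le> a) \<partial>chi (i + 3) \<partial>std_normal_distribution)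
      \<partial>chi (i + 3) \<partial>std_normal_distribution)
    \<le> ennreal (sqrt (real i + 4) / (2 * pi * w\<^sup>2 * sqrt (1 + w\<^sup>2) ^ (i + 1) * ((real i + 1) * sqrt (real i + 2))))"
    (is "?L \<le> _")
proof -
  interpret N: prob_space std_normal_distribution by (intro prob_space_normal_density) simp
  interpret X: prob_space "chi (i + 3)" by (rule prob_space_chi)
  interpret XN: pair_sigma_finite "chi (i + 3)" std_normal_distribution ..
  interpret XL: pair_sigma_finite "chi (i + 3)" lborel ..
  define T :: "real \<Rightarrow> ennreal" where "T v = (\<integral>\<^sup>+a. \<integral>\<^sup>+r. of_bool (v * r \<le> a) \<partial>chi (i + 3) \<partial>std_normal_distribution)" for v
  have [measurable]: "T \<in> borel_measurable borel" unfolding T_def by measurable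
  define I where "I = (\<integral>\<^sup>+v. of_bool (w < v) * T v \<partial>lborel)"
  define c where "c = 1 / (sqrt (2 * pi) * w\<^sup>2 * sqrt (1 + w\<^sup>2) ^ (i + 1) * ((real i + 1) * sqrt (real i + 2)))"
  have c: "c \<ge> 0" unfolding c_def by simp
  have "I = (\<integral>\<^sup>+v. \<integral>\<^sup>+r. of_bool (w < v) * (\<integral>\<^sup>+a. of_bool (v * r \<le> a) \<partial>std_normal_distribution) \<partial>chi (i + 3) \<partial>lborel)"
    unfolding I_def T_def
    by (subst XN.Fubini', measurable) (simp add: nn_integral_cmult[symmetric])
  \<comment> \<open>With the competitor's radius \<open>r\<close> outermost, the double tail can be
    estimated for each \<open>r\<close> before averaging over the chi law.\<close>
  also have "\<dots> = (\<integral>\<^sup>+r. \<integral>\<^sup>+v. of_bool (w < v) * (\<integral>\<^sup>+a. of_bool (v * r \<le> a) \<partial>std_normal_distribution) \<partial>lborel \<partial>chi (i + 3))"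
    by (rule XL.Fubini') measurable
  also have "\<dots> \<le> (\<integral>\<^sup>+r. ennreal (exp (- (w * r)\<^sup>2 / 2) / (sqrt (2 * pi) * w\<^sup>2 * r ^ 3)) \<partial>chi (i + 3))"
    using AE_chi_pos[of "i + 3"] by (intro nn_integral_mono_AE) (rule eventually_mono, assumption, rule gaussian_double_tail[OF w])
  also have "\<dots> \<le> ennreal c" unfolding c_def by (rule nn_integral_chi_tail[OF w])
  finally have I: "I \<le> ennreal c" .
  have "?L = (\<integral>\<^sup>+y. \<integral>\<^sup>+x. of_bool (w * y < A + x) * T ((A + x) / y) \<partial>std_normal_distribution \<partial>chi (i + 3))"
    unfolding T_def[symmetric] by (rule XN.Fubini') measurable
  also have "\<dots> \<le> (\<integral>\<^sup>+y. ennreal y * (ennreal (1 / sqrt (2 * pi)) * I) \<partial>chi (i + 3))"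
  proof (rule nn_integral_mono_AE)
    show "AE y in chi (i + 3). (\<integral>\<^sup>+x. of_bool (w * y < A + x) * T ((A + x) / y) \<partial>std_normal_distribution)
      \<le> ennreal y * (ennreal (1 / sqrt (2 * pi)) * I)"
      using AE_chi_pos[of "i + 3"]
    proof eventually_elim
      case (elim y)
      have "(\<integral>\<^sup>+x. of_bool (w * y < A + x) * T ((A + x) / y) \<partial>std_normal_distribution)
         = (\<integral>\<^sup>+x. ennreal (std_normal_density x) * (of_bool (w * y < A + x) * T ((A + x) / y)) \<partial>lborel)"
        by (rule nn_integral_std_normal) measurable
      also have "\<dots> \<le> (\<integral>\<^sup>+x. ennreal (1 / sqrt (2 * pi)) * (of_bool (w * y < A + x) * T ((A + x) / y)) \<partial>lborel)"
        by (intro nn_integral_mono mult_right_mono ennreal_leI) (auto simp: std_normal_density_def divide_right_mono)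
      \<comment> \<open>The substitution \<open>x = - A + y * v\<close> turns the condition
        \<open>w * y < A + x\<close> into \<open>w < v\<close>.\<close>
      also have "\<dots> = ennreal \<bar>y\<bar> * (\<integral>\<^sup>+v. ennreal (1 / sqrt (2 * pi)) * (of_bool (w * y < A + (- A + y * v)) * T ((A + (- A + y * v)) / y)) \<partial>lborel)"
        using elim by (intro nn_integral_real_affine) auto
      also have "\<dots> = ennreal y * (ennreal (1 / sqrt (2 * pi)) * I)"
        using elim unfolding I_def
        by (subst nn_integral_cmult[symmetric]) (auto simp: mult.commute[of w] intro!: arg_cong2[where f="(*)"] nn_integral_cong)
      finally show ?case .
    qed
  qed
  also have "\<dots> = (\<integral>\<^sup>+y. ennreal y \<partial>chi (i + 3)) * (ennreal (1 / sqrt (2 * pi)) * I)"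
    by (rule nn_integral_multc) measurable
  also have "\<dots> \<le> ennreal (sqrt (real i + 4)) * (ennreal (1 / sqrt (2 * pi)) * ennreal c)"
    using nn_integral_chi_mean[of "i + 3"] I by (intro mult_mono) (auto simp: add.commute)
  also have "\<dots> = ennreal (sqrt (real i + 4) * (1 / sqrt (2 * pi) * c))"
    using c by (simp add: ennreal_mult[symmetric])
  also have "sqrt (real i + 4) * (1 / sqrt (2 * pi) * c)
     = sqrt (real i + 4) / ((sqrt (2 * pi) * sqrt (2 * pi)) * w\<^sup>2 * sqrt (1 + w\<^sup>2) ^ (i + 1) * ((real i + 1) * sqrt (real i + 2)))"
    unfolding c_def by (simp only: times_divide_eq_right divide_divide_eq_left mult_ac mult_1_right)
  also have "sqrt (2 * pi) * sqrt (2 * pi) = 2 * pi" by simp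
  finally show ?thesis .
qed

section \<open>Normal approximation of the chi distribution\<close>

text \<open>The remainder vanishes at \<open>0\<close> and has derivative
  \<open>t\<^sup>2 / (1 + t)\<close>, so comparison with \<open>0\<close> yields its sign on either
  side.\<close>

lemma ln_taylor_mono:
  fixes x y :: real
  assumes "- 1 < x" "x \<le> y"
  shows "ln (1 + x) - x + x\<^sup>2 / 2 \<le> ln (1 + y) - y + y\<^sup>2 / 2"
proof (rule DERIV_nonneg_imp_nondecreasing[OF assms(2)])
  fix t assume t: "x \<le> t" "t \<le> y"
  show "\<exists>d. ((\<lambda>t. ln (1 + t) - t + t\<^sup>2 / 2) has_real_derivative d) (at t) \<and> 0 \<le> d"
  proof (intro exI conjI)
    show "((\<lambda>t. ln (1 + t) - t + t\<^sup>2 / 2) has_real_derivative (t\<^sup>2 / (1 + t))) (at t)"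
      using t assms by (auto intro!: derivative_eq_intros simp: field_simps power2_eq_square)
    show "0 \<le> t\<^sup>2 / (1 + t)" using t assms by simp
  qed
qed

text \<open>On \<open>t \<ge> - 1 / 2\<close> the derivative \<open>t\<^sup>2 / (1 + t)\<close> is
  at most \<open>2 * t\<^sup>2\<close>, the derivative of \<open>2 / 3 * t ^ 3\<close>. Comparison
  with \<open>0\<close> bounds the remainder above for positive and below for negative
  arguments.\<close>

lemma ln_taylor_cubic_mono:
  fixes x y :: real
  assumes "- (1/2) \<le> x" "x \<le> y"
  shows "2 / 3 * x ^ 3 - (ln (1 + x) - x + x\<^sup>2 / 2) \<le> 2 / 3 * y ^ 3 - (ln (1 + y) - y + y\<^sup>2 / 2)"
proof (rule DERIV_nonneg_imp_nondecreasing[OF assms(2)])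
  fix t assume t: "x \<le> t" "t \<le> y"
  show "\<exists>d. ((\<lambda>t. 2 / 3 * t ^ 3 - (ln (1 + t) - t + t\<^sup>2 / 2)) has_real_derivative d) (at t) \<and> 0 \<le> d"
  proof (intro exI conjI)
    show "((\<lambda>t. 2 / 3 * t ^ 3 - (ln (1 + t) - t + t\<^sup>2 / 2)) has_real_derivative (2 * t\<^sup>2 - t\<^sup>2 / (1 + t))) (at t)"
      using t assms by (auto intro!: derivative_eq_intros simp: field_simps power2_eq_square)
    have "t\<^sup>2 / (1 + t) \<le> t\<^sup>2 / (1 / 2)" using t assms by (intro divide_left_mono) auto
    then show "0 \<le> 2 * t\<^sup>2 - t\<^sup>2 / (1 + t)" by simp
  qed
qed

text \<open>Relative to its mode \<open>m = sqrt j\<close>, the weight equals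
  \<open>exp (- (r - m)\<^sup>2 + m\<^sup>2 p (r / m - 1))\<close> with \<open>p y = ln (1 + y) - y + y\<^sup>2 / 2\<close> of third order.\<close>
lemma chi_weight_relative:
  fixes m r :: real
  assumes m: "m > 0" "m\<^sup>2 = real j" and r: "r > 0"
  defines "y \<equiv> r / m - 1"
  shows "chi_weight j r / chi_weight j m = exp (- (r - m)\<^sup>2 + m\<^sup>2 * (ln (1 + y) - y + y\<^sup>2 / 2))"
proof -
  have w: "chi_weight j x = exp (m\<^sup>2 * ln x - x\<^sup>2 / 2)" if "x > 0" for x
  proof -
    have "exp (real j * ln x + (- x\<^sup>2 / 2)) = x ^ j * exp (- x\<^sup>2 / 2)"
      unfolding exp_add using that by (simp add: exp_of_nat_mult)
    then show ?thesis using that by (simp add: chi_weight_def m(2))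
  qed
  have "chi_weight j r / chi_weight j m = exp (m\<^sup>2 * (ln r - ln m) - r\<^sup>2 / 2 + m\<^sup>2 / 2)"
    unfolding w[OF r] w[OF m(1)] exp_diff[symmetric] by (simp add: algebra_simps)
  also have "ln r - ln m = ln (1 + y)" unfolding y_def using r m by (simp add: ln_div)
  also have "m\<^sup>2 * ln (1 + y) - r\<^sup>2 / 2 + m\<^sup>2 / 2 = - (r - m)\<^sup>2 + m\<^sup>2 * (ln (1 + y) - y + y\<^sup>2 / 2)"
  proof -
    have "r = m * (1 + y)" using m by (simp add: y_def)
    then show ?thesis by (simp add: power2_eq_square algebra_simps)
  qed
  finally show ?thesis .
qed

text \<open>Left of the mode the remainder is nonpositive and the Gaussian term alone suffices.
  Right of it the remainder \<open>e\<close> is at most cubic, and the second summand pays for it;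
  it keeps half of the Gaussian exponent and so stays integrable.\<close>

lemma chi_weight_upper:
  fixes m r :: real
  assumes m: "m > 0" "m\<^sup>2 = real j"
  shows "chi_weight j r / chi_weight j m \<le> exp (- (r - m)\<^sup>2) + \<bar>r - m\<bar> ^ 3 / m * exp (- (r - m)\<^sup>2 / 2)"
proof (cases "r > 0")
  case r: True
  define y where "y = r / m - 1"
  define e where "e = m\<^sup>2 * (ln (1 + y) - y + y\<^sup>2 / 2)"
  have rel: "chi_weight j r / chi_weight j m = exp (- (r - m)\<^sup>2 + e)"
    unfolding e_def y_def by (rule chi_weight_relative[OF m r])
  have y1: "y > -1" using r m by (simp add: y_def)
  have ry: "r - m = m * y" using m by (simp add: y_def field_simps)
  show ?thesis
  proof (cases "r \<ge> m")
    case True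
    then have y: "y \<ge> 0" using m by (simp add: y_def)
    have e3: "e \<le> \<bar>r - m\<bar> ^ 3 / m"
    proof -
      have "ln (1 + y) - y + y\<^sup>2 / 2 \<le> 2 / 3 * y ^ 3"
        using ln_taylor_cubic_mono[of 0 y] y by simp
      also have "\<dots> \<le> y ^ 3" using y by simp
      finally have "e \<le> m\<^sup>2 * y ^ 3" unfolding e_def using m by (intro mult_left_mono) auto
      also have "\<dots> = \<bar>r - m\<bar> ^ 3 / m"
        using m y unfolding ry by (simp add: abs_mult power_mult_distrib power2_eq_square power3_eq_cube)
      finally show ?thesis .
    qed
    \<comment> \<open>The bound \<open>ln (1 + y) \<le> y\<close> gives
      \<open>e \<le> (r - m)\<^sup>2 / 2\<close>, so at most half of the Gaussian exponent is lost
      however large \<open>r\<close> is.\<close>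
    have e2: "- (r - m)\<^sup>2 + e \<le> - (r - m)\<^sup>2 / 2"
    proof -
      have "ln (1 + y) \<le> y" using y1 ln_add_one_self_le_self2[of y] by simp
      then have "m\<^sup>2 * ln (1 + y) \<le> m\<^sup>2 * y" by (intro mult_left_mono) auto
      then show ?thesis unfolding e_def ry by (simp add: power_mult_distrib algebra_simps)
    qed
    have "1 - e \<le> exp (- e)" using exp_ge_add_one_self[of "- e"] by simp
    then have "exp e * (1 - e) \<le> exp e * exp (- e)" by (intro mult_left_mono) auto
    then have "exp e \<le> 1 + e * exp e" by (simp add: exp_add[symmetric] algebra_simps)
    then have "exp (- (r - m)\<^sup>2) * exp e \<le> exp (- (r - m)\<^sup>2) * (1 + e * exp e)" by (intro mult_left_mono) auto
    then have "exp (- (r - m)\<^sup>2 + e) \<le> exp (- (r - m)\<^sup>2) + e * exp (- (r - m)\<^sup>2 + e)"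
      unfolding exp_add by (simp add: algebra_simps)
    also have "e * exp (- (r - m)\<^sup>2 + e) \<le> \<bar>r - m\<bar> ^ 3 / m * exp (- (r - m)\<^sup>2 / 2)"
      using e3 e2 m by (intro mult_mono) auto
    finally show ?thesis unfolding rel by simp
  next
    case False
    then have y: "y \<le> 0" using m by (simp add: y_def divide_le_eq)
    have "ln (1 + y) - y + y\<^sup>2 / 2 \<le> 0" using ln_taylor_mono[of y 0] y y1 by simp
    then have "e \<le> 0" unfolding e_def using m by (intro mult_nonneg_nonpos) auto
    then have "exp (- (r - m)\<^sup>2 + e) \<le> exp (- (r - m)\<^sup>2)" by simp
    moreover have "0 \<le> \<bar>r - m\<bar> ^ 3 / m * exp (- (r - m)\<^sup>2 / 2)" using m by simp
    ultimately show ?thesis unfolding rel by linarith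
  qed
next
  case False
  have "0 \<le> exp (- (r - m)\<^sup>2) + \<bar>r - m\<bar> ^ 3 / m * exp (- (r - m)\<^sup>2 / 2)" using m by simp
  then show ?thesis using False by (simp add: chi_weight_def)
qed

text \<open>For \<open>r \<ge> m / 2\<close> the cubic bound and \<open>exp e \<ge> 1 + e\<close>
  suffice. For smaller \<open>r\<close> the left side is nonpositive: the constant 4 makes
  \<open>4 * (m / 2) ^ 3 / m = m\<^sup>2 / 2\<close>, which is at least 1 as soon as
  \<open>j \<ge> 2\<close>.\<close>

lemma chi_weight_lower:
  fixes m r :: real
  assumes m: "m > 0" "m\<^sup>2 = real j" and j: "j \<ge> 2"
  shows "exp (- (r - m)\<^sup>2) * (1 - 4 * \<bar>r - m\<bar> ^ 3 / m) \<le> chi_weight j r / chi_weight j m"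
proof (cases "r \<ge> m / 2")
  case True
  then have r: "r > 0" using m by linarith
  define y where "y = r / m - 1"
  define e where "e = m\<^sup>2 * (ln (1 + y) - y + y\<^sup>2 / 2)"
  have rel: "chi_weight j r / chi_weight j m = exp (- (r - m)\<^sup>2 + e)"
    unfolding e_def y_def by (rule chi_weight_relative[OF m r])
  have y1: "y \<ge> - (1/2)" using True m by (simp add: y_def field_simps)
  have ry: "r - m = m * y" using m by (simp add: y_def field_simps)
  have "- (4 * \<bar>y\<bar> ^ 3) \<le> ln (1 + y) - y + y\<^sup>2 / 2"
  proof (cases "y \<ge> 0")
    case True
    have "0 \<le> ln (1 + y) - y + y\<^sup>2 / 2" using ln_taylor_mono[of 0 y] True by simp
    moreover have "0 \<le> 4 * \<bar>y\<bar> ^ 3" by simp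
    ultimately show ?thesis by linarith
  next
    case False
    have "2 / 3 * y ^ 3 \<le> ln (1 + y) - y + y\<^sup>2 / 2" using ln_taylor_cubic_mono[of y 0] False y1 by simp
    moreover have "y ^ 3 = - (\<bar>y\<bar> ^ 3)" using False by (simp add: power3_eq_cube)
    moreover have "0 \<le> \<bar>y\<bar> ^ 3" by simp
    ultimately show ?thesis by linarith
  qed
  then have "m\<^sup>2 * (- (4 * \<bar>y\<bar> ^ 3)) \<le> e" unfolding e_def by (intro mult_left_mono) auto
  also have "m\<^sup>2 * (- (4 * \<bar>y\<bar> ^ 3)) = - (4 * \<bar>r - m\<bar> ^ 3 / m)"
  proof -
    have "\<bar>r - m\<bar> = m * \<bar>y\<bar>" using m ry by (simp add: abs_mult)
    then show ?thesis using m(1) by (simp add: power_mult_distrib power2_eq_square power3_eq_cube)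
  qed
  finally have "1 - 4 * \<bar>r - m\<bar> ^ 3 / m \<le> exp e" using exp_ge_add_one_self[of e] by linarith
  then have "exp (- (r - m)\<^sup>2) * (1 - 4 * \<bar>r - m\<bar> ^ 3 / m) \<le> exp (- (r - m)\<^sup>2) * exp e" by (intro mult_left_mono) auto
  then show ?thesis unfolding rel exp_add .
next
  case False
  then have "m / 2 \<le> \<bar>r - m\<bar>" by linarith
  then have "(m / 2) ^ 3 \<le> \<bar>r - m\<bar> ^ 3" using m by (intro power_mono) auto
  then have "4 * (m / 2) ^ 3 / m \<le> 4 * \<bar>r - m\<bar> ^ 3 / m" using m by (intro divide_right_mono) auto
  moreover have "4 * (m / 2) ^ 3 / m = m\<^sup>2 / 2" using m by (simp add: power3_eq_cube power2_eq_square)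
  moreover have "m\<^sup>2 \<ge> 2" using j m(2) by simp
  ultimately have "1 - 4 * \<bar>r - m\<bar> ^ 3 / m \<le> 0" by linarith
  then have "exp (- (r - m)\<^sup>2) * (1 - 4 * \<bar>r - m\<bar> ^ 3 / m) \<le> 0" by (intro mult_nonneg_nonpos) auto
  also have "0 \<le> chi_weight j r / chi_weight j m" by simp
  finally show ?thesis .
qed

section \<open>Total variation comparison with the normal law of variance 1/2\<close>

lemma normal_density_half: "normal_density m (1 / sqrt 2) r = exp (- (r - m)\<^sup>2) / sqrt pi"
  by (simp add: normal_density_def power_divide)

text \<open>Integrates the upper bound for the weight: \<open>sqrt pi\<close> is the mass of the
  Gaussian term, and \<open>4 / m\<close> comes from the third absolute moment of the unit normal
  law.\<close>

lemma chi_const_le: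
  fixes m :: real
  assumes m: "m > 0" "m\<^sup>2 = real j"
  shows "chi_const j / chi_weight j m \<le> sqrt pi * (1 + 4 / m)"
proof -
  let ?B = "\<lambda>r. sqrt pi * normal_density m (1 / sqrt 2) r + sqrt (2 * pi) / m * (normal_density m 1 r * \<bar>r - m\<bar> ^ (2 * 1 + 1))"
  have i1: "integrable lborel (normal_density m (1 / sqrt 2))" by (rule integrable_normal_density) simp
  note h2 = normal_moment_abs_odd[of 1 m 1, unfolded has_bochner_integral_iff, simplified]
  have i2: "integrable lborel (\<lambda>r. normal_density m 1 r * \<bar>r - m\<bar> ^ (2 * 1 + 1))" using h2 by simp
  have "chi_const j / chi_weight j m = (\<integral>r. chi_weight j r / chi_weight j m \<partial>lborel)"
    unfolding chi_const_def by simp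
  also have "\<dots> \<le> (\<integral>r. ?B r \<partial>lborel)"
  proof (rule integral_mono)
    show "integrable lborel (\<lambda>r. chi_weight j r / chi_weight j m)" by simp
    show "integrable lborel ?B" using i1 i2 by (intro Bochner_Integration.integrable_add integrable_mult_right) auto
    fix r
    have "?B r = exp (- (r - m)\<^sup>2) + \<bar>r - m\<bar> ^ 3 / m * exp (- (r - m)\<^sup>2 / 2)"
      unfolding normal_density_half by (simp add: normal_density_def)
    then show "chi_weight j r / chi_weight j m \<le> ?B r" using chi_weight_upper[OF m] by simp
  qed
  also have "\<dots> = sqrt pi + sqrt (2 * pi) / m * (2 * sqrt (2 / pi))"
    using i1 i2 h2 by (subst Bochner_Integration.integral_add) (auto simp: numeral_3_eq_3)
  also have "sqrt (2 * pi) / m * (2 * sqrt (2 / pi)) = 4 / m"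
  proof -
    have "sqrt (2 * pi) * sqrt (2 / pi) = 2" by (simp add: real_sqrt_mult[symmetric])
    then have "sqrt (2 * pi) * sqrt (2 / pi) * (2 / m) = 2 * (2 / m)" by (simp only:)
    then show ?thesis by (simp add: mult_ac)
  qed
  also have "sqrt pi + 4 / m \<le> sqrt pi * (1 + 4 / m)"
  proof -
    have "sqrt pi \<ge> 1" using pi_ge_two by simp
    then have "1 * (4 / m) \<le> sqrt pi * (4 / m)" using m by (intro mult_right_mono) auto
    then show ?thesis by (simp add: algebra_simps)
  qed
  finally show ?thesis .
qed

text \<open>Since both densities have mass one, the excess of \<open>f\<close> over \<open>g\<close>
  on \<open>h\<close> equals the deficit of \<open>f\<close> on \<open>1 - h\<close>. Hence a
  one-sided pointwise estimate, \<open>f\<close> not far below \<open>g\<close>, controls the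
  difference. The constant is \<open>12 = 4 * 2 + 4\<close>, with 2 a bound for the third absolute
  moment.\<close>

lemma chi_normal_comparison:
  fixes h :: "real \<Rightarrow> real"
  assumes j: "j \<ge> 2" and [measurable]: "h \<in> borel_measurable borel" and h: "\<And>r. 0 \<le> h r" "\<And>r. h r \<le> 1"
  shows "(\<integral>r. chi_weight j r / chi_const j * h r \<partial>lborel)
    \<le> (\<integral>r. normal_density (sqrt j) (1 / sqrt 2) r * h r \<partial>lborel) + 12 / sqrt j"
proof -
  define m where "m = sqrt j"
  have m: "m > 0" "m\<^sup>2 = real j" using j by (auto simp: m_def)
  let ?f = "\<lambda>r. chi_weight j r / chi_const j"
  let ?g = "normal_density m (1 / sqrt 2)"
  have w: "chi_weight j m > 0" using m by (simp add: chi_weight_def)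
  have if': "integrable lborel ?f" by simp
  have ig: "integrable lborel ?g" by (rule integrable_normal_density) simp
  have bnd: "integrable lborel (\<lambda>r. k r * u r)"
    if "integrable lborel k" "u \<in> borel_measurable borel" "\<And>r. 0 \<le> u r" "\<And>r. u r \<le> 1" for k u :: "real \<Rightarrow> real"
    using that by (intro Bochner_Integration.integrable_bound[OF that(1)]) (auto simp: abs_mult mult_left_le)
  note h3 = normal_moment_abs_odd[of "1 / sqrt 2" m 1, unfolded has_bochner_integral_iff]
  have i3: "integrable lborel (\<lambda>r. ?g r * \<bar>r - m\<bar> ^ 3)" using h3 by (simp add: numeral_3_eq_3)
  have v3: "(\<integral>r. ?g r * \<bar>r - m\<bar> ^ 3 \<partial>lborel) \<le> 2"
  proof -
    have "(\<integral>r. ?g r * \<bar>r - m\<bar> ^ 3 \<partial>lborel) = 2 * (1 / sqrt 2) ^ 3 * sqrt (2 / pi)"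
      using h3 by (simp add: numeral_3_eq_3)
    also have "\<dots> \<le> 2 * 1 * 1"
      using pi_ge_two by (intro mult_mono power_le_one) auto
    finally show ?thesis by simp
  qed
  \<comment> \<open>The lower bound for the weight is divided by the upper bound for the
    normalization: \<open>(1 - a) / (1 + 4 / m)\<close> is at least \<open>1 - a - 4 / m\<close>
    when \<open>a \<le> 1\<close>; for \<open>a > 1\<close> the claimed lower bound for
    \<open>f\<close> is nonpositive.\<close>
  have pw: "?g r - ?f r \<le> ?g r * ((4 * \<bar>r - m\<bar> ^ 3 + 4) / m)" for r
  proof -
    define a where "a = 4 * \<bar>r - m\<bar> ^ 3 / m"
    define J where "J = chi_const j / chi_weight j m"
    define E where "E = exp (- (r - m)\<^sup>2)"
    have J: "J > 0" unfolding J_def using w by simp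
    have Jle: "J \<le> sqrt pi * (1 + 4 / m)" unfolding J_def by (rule chi_const_le[OF m])
    have f: "?f r = (chi_weight j r / chi_weight j m) / J" unfolding J_def using w by simp
    have g: "?g r = E / sqrt pi" by (simp add: normal_density_half E_def)
    have lower: "E * (1 - a) \<le> chi_weight j r / chi_weight j m"
      unfolding E_def a_def by (rule chi_weight_lower[OF m j])
    have a0: "a \<ge> 0" unfolding a_def using m by simp
    have "E / sqrt pi * (1 - a - 4 / m) \<le> ?f r"
    proof (cases "a \<le> 1")
      case True
      have "(1 - 4 / m) * (1 + 4 / m) \<le> 1" by (simp add: algebra_simps)
      then have "1 - 4 / m \<le> 1 / (1 + 4 / m)" using m by (simp add: pos_le_divide_eq add_pos_pos)
      then have "(1 - a) * (1 - 4 / m) \<le> (1 - a) * (1 / (1 + 4 / m))" using True by (intro mult_left_mono) auto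
      moreover have "1 - a - 4 / m \<le> (1 - a) * (1 - 4 / m)"
      proof -
        have "0 \<le> a * (4 / m)" using a0 m by simp
        moreover have "(1 - a) * (1 - 4 / m) = 1 - a - 4 / m + a * (4 / m)"
          by (simp add: left_diff_distrib right_diff_distrib diff_divide_distrib)
        ultimately show ?thesis by linarith
      qed
      ultimately have "E / sqrt pi * (1 - a - 4 / m) \<le> E / sqrt pi * ((1 - a) * (1 / (1 + 4 / m)))"
        by (intro mult_left_mono) (auto simp: E_def)
      also have "\<dots> = E * (1 - a) / (sqrt pi * (1 + 4 / m))" by simp
      also have "\<dots> \<le> E * (1 - a) / J"
        using Jle J True by (intro divide_left_mono) (auto simp: E_def intro!: mult_pos_pos add_pos_pos m(1))
      also have "\<dots> \<le> ?f r" unfolding f using lower J by (intro divide_right_mono) auto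
      finally show ?thesis .
    next
      case False
      have "4 / m \<ge> 0" using m by simp
      then have "E / sqrt pi * (1 - a - 4 / m) \<le> 0" using False
        by (intro mult_nonneg_nonpos) (linarith | simp add: E_def)+
      also have "0 \<le> ?f r" by (simp add: less_imp_le)
      finally show ?thesis .
    qed
    then show ?thesis unfolding g a_def by (simp add: algebra_simps add_divide_distrib)
  qed
  have tot: "(\<integral>r. ?f r \<partial>lborel) = 1" using chi_const_pos[of j] by (simp add: chi_const_def[symmetric] del: chi_const_pos)
  have totg: "(\<integral>r. ?g r \<partial>lborel) = 1" by (rule integral_normal_density) simp
  have "(\<integral>r. ?f r * h r \<partial>lborel) - (\<integral>r. ?g r * h r \<partial>lborel)
     = (\<integral>r. ?g r * (1 - h r) \<partial>lborel) - (\<integral>r. ?f r * (1 - h r) \<partial>lborel)"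
  proof -
    have "(\<integral>r. ?g r * (1 - h r) \<partial>lborel) = (\<integral>r. ?g r - ?g r * h r \<partial>lborel)"
      by (simp only: right_diff_distrib mult_1_right)
    also have "\<dots> = 1 - (\<integral>r. ?g r * h r \<partial>lborel)"
      using totg by (subst Bochner_Integration.integral_diff[OF ig bnd[OF ig _ h]]) auto
    finally have 1: "(\<integral>r. ?g r * (1 - h r) \<partial>lborel) = 1 - (\<integral>r. ?g r * h r \<partial>lborel)" .
    have "(\<integral>r. ?f r * (1 - h r) \<partial>lborel) = (\<integral>r. ?f r - ?f r * h r \<partial>lborel)"
      by (simp only: right_diff_distrib mult_1_right)
    also have "\<dots> = 1 - (\<integral>r. ?f r * h r \<partial>lborel)"
      using tot by (subst Bochner_Integration.integral_diff[OF if' bnd[OF if' _ h]]) auto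
    finally show ?thesis using 1 by simp
  qed
  also have "\<dots> = (\<integral>r. (?g r - ?f r) * (1 - h r) \<partial>lborel)"
    unfolding left_diff_distrib
    by (rule Bochner_Integration.integral_diff[symmetric]) (intro bnd if' ig; use h in simp)+
  also have "\<dots> \<le> (\<integral>r. 4 / m * (?g r * \<bar>r - m\<bar> ^ 3) + 4 / m * ?g r \<partial>lborel)"
  proof (rule integral_mono)
    show "integrable lborel (\<lambda>r. (?g r - ?f r) * (1 - h r))"
      using h by (intro bnd Bochner_Integration.integrable_diff ig if') auto
    show "integrable lborel (\<lambda>r. 4 / m * (?g r * \<bar>r - m\<bar> ^ 3) + 4 / m * ?g r)"
      using i3 ig by (intro Bochner_Integration.integrable_add integrable_mult_right) auto
    fix r
    have p0: "0 \<le> ?g r * ((4 * \<bar>r - m\<bar> ^ 3 + 4) / m)" using m by simp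
    have "(?g r - ?f r) * (1 - h r) \<le> (?g r * ((4 * \<bar>r - m\<bar> ^ 3 + 4) / m)) * (1 - h r)"
      using pw[of r] h[of r] by (intro mult_right_mono) auto
    also have "\<dots> \<le> ?g r * ((4 * \<bar>r - m\<bar> ^ 3 + 4) / m)"
      using p0 h[of r] by (intro mult_left_le) auto
    also have "\<dots> = 4 / m * (?g r * \<bar>r - m\<bar> ^ 3) + 4 / m * ?g r"
      by (simp add: algebra_simps add_divide_distrib)
    finally show "(?g r - ?f r) * (1 - h r) \<le> 4 / m * (?g r * \<bar>r - m\<bar> ^ 3) + 4 / m * ?g r" .
  qed
  also have "\<dots> = 4 / m * (\<integral>r. ?g r * \<bar>r - m\<bar> ^ 3 \<partial>lborel) + 4 / m"
    using i3 ig totg by (subst Bochner_Integration.integral_add) auto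
  also have "\<dots> \<le> 4 / m * 2 + 4 / m" using v3 m by (intro add_right_mono mult_left_mono) auto
  also have "\<dots> = 12 / m" by simp
  finally show ?thesis unfolding m_def by simp
qed

section \<open>The standard normal distribution function\<close>

lemma measure_std_normal:
  assumes [measurable]: "S \<in> sets borel"
  shows "measure std_normal_distribution S = (\<integral>x. std_normal_density x * indicator S x \<partial>lborel)"
proof -
  have "measure std_normal_distribution S = (\<integral>x. indicator S x \<partial>std_normal_distribution)" by simp
  also have "\<dots> = (\<integral>x. std_normal_density x * indicator S x \<partial>lborel)" by (rule integral_real_density) auto
  finally show ?thesis .
qed

lemma Phi_eq_measure: "Phi t = measure std_normal_distribution {..t}"
proof -
  have "measure std_normal_distribution {..t} = (\<integral>x. std_normal_density x * indicator {..t} x \<partial>lborel)"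
    by (rule measure_std_normal) simp
  also have "\<dots> = (\<integral>x. indicator {..<t} x *\<^sub>R (1 / sqrt (2 * pi) * exp (- (x^2) / 2)) \<partial>lborel)"
  proof (rule integral_cong_AE)
    show "AE x in lborel. std_normal_density x * indicator {..t} x = indicator {..<t} x *\<^sub>R (1 / sqrt (2 * pi) * exp (- (x^2) / 2))"
      using AE_lborel_singleton[of t] by eventually_elim (auto simp: std_normal_density_def indicator_def)
  qed auto
  also have "\<dots> = Phi t"
    unfolding Phi_def interval_lebesgue_integral_def set_lebesgue_integral_def by simp
  finally show ?thesis by simp
qed

lemma emeasure_std_normal_atMost: "(\<integral>\<^sup>+x. of_bool (x \<le> t) \<partial>std_normal_distribution) = ennreal (Phi t)"
proof -
  interpret N: prob_space std_normal_distribution by (intro prob_space_normal_density) simp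
  have "(\<integral>\<^sup>+x. of_bool (x \<le> t) \<partial>std_normal_distribution) = (\<integral>\<^sup>+x. indicator {..t} x \<partial>std_normal_distribution)"
    by (intro nn_integral_cong) (auto simp: indicator_def)
  then show ?thesis by (simp add: Phi_eq_measure N.emeasure_eq_measure)
qed

lemma Phi_nonneg: "0 \<le> Phi t" and Phi_le_1: "Phi t \<le> 1"
proof -
  interpret N: prob_space std_normal_distribution by (intro prob_space_normal_density) simp
  show "0 \<le> Phi t" "Phi t \<le> 1" by (auto simp: Phi_eq_measure)
qed

lemma Phi_diff_eq:
  assumes "x \<le> y"
  shows "Phi y - Phi x = (\<integral>s. std_normal_density s * indicator {x<..y} s \<partial>lborel)"
proof -
  interpret N: prob_space std_normal_distribution by (intro prob_space_normal_density) simp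
  have "{..y} - {..x} = {x<..y}" by auto
  then have "Phi y - Phi x = measure std_normal_distribution {x<..y}"
    unfolding Phi_eq_measure using assms N.finite_measure_Diff[of "{..y}" "{..x}"] by simp
  also have "\<dots> = (\<integral>s. std_normal_density s * indicator {x<..y} s \<partial>lborel)" by (rule measure_std_normal) simp
  finally show ?thesis .
qed

lemma integrable_std_normal_indicator: "integrable lborel (\<lambda>s. std_normal_density s * indicator {x<..y} s)"
  by (rule Bochner_Integration.integrable_bound[OF integrable_normal_density[of 1 0]])
    (auto simp: indicator_def)

lemma Phi_diff_le:
  assumes "x \<le> y"
  shows "Phi y - Phi x \<le> y - x"
proof -
  have "Phi y - Phi x \<le> (\<integral>s. indicator {x<..y} s \<partial>lborel)"
    unfolding Phi_diff_eq[OF assms]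
  proof (rule integral_mono)
    show "integrable lborel (\<lambda>s. std_normal_density s * indicator {x<..y} s)" by (rule integrable_std_normal_indicator)
    show "integrable lborel (indicator {x<..y} :: real \<Rightarrow> real)"
      using assms by (intro integrable_real_indicator) auto
    fix s :: real
    have "exp (- s\<^sup>2 / 2) \<le> 1" by simp
    also have "1 \<le> sqrt (2 * pi)" using pi_ge_two by simp
    finally have "std_normal_density s \<le> 1" by (simp add: std_normal_density_def)
    then show "std_normal_density s * indicator {x<..y} s \<le> (indicator {x<..y} s :: real)"
      by (simp add: indicator_def)
  qed
  then show ?thesis using assms by simp
qed

text \<open>Converts a shift of the argument into a proportional drop of probability; this drop
  absorbs the error terms of order \<open>1 / sqrt n\<close>.\<close>

lemma Phi_diff_ge:
  assumes "x \<le> y" and d: "\<And>s. x \<le> s \<Longrightarrow> s \<le> y \<Longrightarrow> d \<le> std_normal_density s"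
  shows "d * (y - x) \<le> Phi y - Phi x"
proof -
  have "d * (y - x) = (\<integral>s. d * indicator {x<..y} s \<partial>lborel)" using assms by simp
  also have "\<dots> \<le> Phi y - Phi x"
    unfolding Phi_diff_eq[OF assms(1)]
  proof (rule integral_mono)
    show "integrable lborel (\<lambda>s. std_normal_density s * indicator {x<..y} s)" by (rule integrable_std_normal_indicator)
    show "integrable lborel (\<lambda>s. d * indicator {x<..y} s :: real)"
      using assms(1) by (intro integrable_mult_right integrable_real_indicator) auto
    show "d * indicator {x<..y} s \<le> std_normal_density s * indicator {x<..y} s" for s
      using d[of s] by (auto simp: indicator_def)
  qed
  finally show ?thesis .
qed

lemma std_normal_density_lower:
  assumes "\<bar>s\<bar> \<le> K" shows "std_normal_density K \<le> std_normal_density s"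
proof -
  have "\<bar>s\<bar>\<^sup>2 \<le> K\<^sup>2" using assms by (intro power_mono) auto
  then show ?thesis by (simp add: std_normal_density_def divide_right_mono)
qed

lemma Phi_mono: "x \<le> y \<Longrightarrow> Phi x \<le> Phi y"
  using Phi_diff_ge[of x y 0] by auto

lemma Phi_strict_mono:
  assumes "x < y" shows "Phi x < Phi y"
proof -
  define K where "K = max \<bar>x\<bar> \<bar>y\<bar>"
  have "std_normal_density K * (y - x) \<le> Phi y - Phi x"
    using assms by (intro Phi_diff_ge std_normal_density_lower) (auto simp: K_def)
  moreover have "0 < std_normal_density K * (y - x)"
    using assms by (intro mult_pos_pos normal_density_pos) auto
  ultimately show ?thesis by linarith
qed

lemma continuous_on_Phi: "continuous_on S Phi"
proof (rule continuous_on_subset[OF _ subset_UNIV])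
  have "\<bar>Phi y - Phi x\<bar> \<le> 1 * \<bar>y - x\<bar>" for x y
    using Phi_diff_le[of x y] Phi_diff_le[of y x] Phi_mono[of x y] Phi_mono[of y x]
    by (cases "x \<le> y") auto
  then have "1-lipschitz_on UNIV Phi"
    by (intro lipschitz_onI) (auto simp: dist_real_def)
  then show "continuous_on UNIV Phi" by (rule lipschitz_on_continuous_on)
qed

text \<open>\<open>Phi_inv\<close> is a definite description, so a solution must be shown to exist
  and to be unique: the limits of the distribution function with continuity give the first, strict
  monotonicity the second.\<close>

lemma Phi_Phi_inv:
  assumes "0 < p" "p < 1"
  shows "Phi (Phi_inv p) = p"
proof -
  interpret real_distribution std_normal_distribution by (rule real_dist_normal_dist)
  have c: "cdf std_normal_distribution = Phi" by (auto simp: cdf_def Phi_eq_measure)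
  have "eventually (\<lambda>t. Phi t < p) at_bot"
    using order_tendstoD(2)[OF cdf_lim_at_bot, of p] assms by (simp add: c)
  then obtain a where a: "Phi a < p" by (auto simp: eventually_at_bot_linorder)
  have "eventually (\<lambda>t. p < Phi t) at_top"
    using order_tendstoD(1)[OF cdf_lim_at_top_prob, of p] assms by (simp add: c)
  then obtain b where b: "p < Phi b" by (auto simp: eventually_at_top_linorder)
  have "a \<le> b" using a b Phi_mono[of b a] by linarith
  then obtain t where t: "Phi t = p"
    using IVT'[of Phi a p b] a b continuous_on_Phi by auto
  have "Phi_inv p = t"
    unfolding Phi_inv_def
  proof (rule the_equality)
    fix u assume u: "Phi u = p"
    show "u = t"
      using Phi_strict_mono[of u t] Phi_strict_mono[of t u] u t by (cases u t rule: linorder_cases) auto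
  qed (fact t)
  then show ?thesis using t by simp
qed

text \<open>\<open>Phi (w * r - A)\<close> is the probability that an independent standard normal
  \<open>a\<close> is at most \<open>w * r - A\<close>. With \<open>r = m + b / sqrt 2\<close> the
  event concerns \<open>a - w / sqrt 2 * b\<close>, which by rotation is normal with standard
  deviation \<open>sqrt (1 + w\<^sup>2 / 2)\<close>.\<close>

lemma normal_Phi_integral:
  fixes A w m :: real
  shows "(\<integral>\<^sup>+r. ennreal (normal_density m (1 / sqrt 2) r) * ennreal (Phi (w * r - A)) \<partial>lborel)
    = ennreal (Phi ((w * m - A) / sqrt (1 + w\<^sup>2 / 2)))"
proof -
  interpret N: prob_space std_normal_distribution by (intro prob_space_normal_density) simp
  interpret NN: pair_sigma_finite std_normal_distribution std_normal_distribution ..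
  define q where "q = sqrt (1 + w\<^sup>2 / 2)"
  have q: "q > 0" by (auto simp: q_def add_pos_nonneg)
  have [measurable]: "Phi \<in> borel_measurable borel" by (intro borel_measurable_continuous_onI continuous_on_Phi)
  have "(\<integral>\<^sup>+r. ennreal (normal_density m (1 / sqrt 2) r) * ennreal (Phi (w * r - A)) \<partial>lborel)
    = ennreal \<bar>1 / sqrt 2\<bar> * (\<integral>\<^sup>+b. ennreal (normal_density m (1 / sqrt 2) (m + 1 / sqrt 2 * b)) * ennreal (Phi (w * (m + 1 / sqrt 2 * b) - A)) \<partial>lborel)"
    by (rule nn_integral_real_affine) auto
  also have "\<dots> = (\<integral>\<^sup>+b. ennreal (std_normal_density b) * ennreal (Phi (w * (m + 1 / sqrt 2 * b) - A)) \<partial>lborel)"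
  proof (subst nn_integral_cmult[symmetric], measurable, intro nn_integral_cong)
    fix b :: real
    have "1 / sqrt 2 * normal_density m (1 / sqrt 2) (m + 1 / sqrt 2 * b) = std_normal_density b"
      by (simp add: normal_density_half std_normal_density_def power_divide real_sqrt_mult)
    then show "ennreal \<bar>1 / sqrt 2\<bar> * (ennreal (normal_density m (1 / sqrt 2) (m + 1 / sqrt 2 * b)) * ennreal (Phi (w * (m + 1 / sqrt 2 * b) - A)))
      = ennreal (std_normal_density b) * ennreal (Phi (w * (m + 1 / sqrt 2 * b) - A))"
      by (simp add: mult.assoc[symmetric] ennreal_mult'[symmetric])
  qed
  also have "\<dots> = (\<integral>\<^sup>+b. \<integral>\<^sup>+a. of_bool (a \<le> w * (m + 1 / sqrt 2 * b) - A) \<partial>std_normal_distribution \<partial>std_normal_distribution)"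
    unfolding emeasure_std_normal_atMost by (rule nn_integral_std_normal[symmetric]) measurable
  also have "\<dots> = (\<integral>\<^sup>+a. \<integral>\<^sup>+b. of_bool (a \<le> w * (m + 1 / sqrt 2 * b) - A) \<partial>std_normal_distribution \<partial>std_normal_distribution)"
    by (rule NN.Fubini') measurable
  also have "\<dots> = (\<integral>\<^sup>+a. \<integral>\<^sup>+b. (\<lambda>(x, _). of_bool (x \<le> w * m - A)) (1 * a + (- w / sqrt 2) * b, a\<^sup>2 + b\<^sup>2) \<partial>std_normal_distribution \<partial>std_normal_distribution)"
    by (intro nn_integral_cong) (auto simp: algebra_simps)
  also have "\<dots> = (\<integral>\<^sup>+a. \<integral>\<^sup>+b. (\<lambda>(x, _). of_bool (x \<le> w * m - A)) (sqrt (1\<^sup>2 + (- w / sqrt 2)\<^sup>2) * a, a\<^sup>2 + b\<^sup>2) \<partial>std_normal_distribution \<partial>std_normal_distribution)"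
    by (rule nn_integral_std_normal_rotation) measurable
  also have "\<dots> = (\<integral>\<^sup>+a. of_bool (a \<le> (w * m - A) / q) \<partial>std_normal_distribution)"
    using q N.emeasure_space_1 by (simp add: power_divide q_def[symmetric] pos_le_divide_eq mult.commute)
  also have "\<dots> = ennreal (Phi ((w * m - A) / q))" by (rule emeasure_std_normal_atMost)
  finally show ?thesis unfolding q_def .
qed

text \<open>Averaging over \<open>x\<close> first is exact and leaves
  \<open>Phi (w * y - A)\<close>, a function of \<open>y\<close> with values in the unit interval,
  to which the comparison of the chi and normal laws applies.\<close>

lemma own_score_bound:
  fixes A w :: real
  assumes j: "j \<ge> 2"
  shows "(\<integral>\<^sup>+x. \<integral>\<^sup>+y. of_bool (A + x \<le> w * y) \<partial>chi j \<partial>std_normal_distribution)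
    \<le> ennreal (Phi ((w * sqrt j - A) / sqrt (1 + w\<^sup>2 / 2)) + 12 / sqrt j)"
proof -
  interpret N: prob_space std_normal_distribution by (intro prob_space_normal_density) simp
  interpret X: prob_space "chi j" by (rule prob_space_chi)
  interpret XN: pair_sigma_finite "chi j" std_normal_distribution ..
  have [measurable]: "Phi \<in> borel_measurable borel" by (intro borel_measurable_continuous_onI continuous_on_Phi)
  let ?h = "\<lambda>y. Phi (w * y - A)"
  have i1: "integrable lborel (\<lambda>r. chi_weight j r / chi_const j * ?h r)"
    by (rule Bochner_Integration.integrable_bound[of _ "\<lambda>r. chi_weight j r / chi_const j"])
      (auto simp: abs_mult Phi_nonneg Phi_le_1 mult_left_le less_imp_le divide_right_mono)
  have i2: "integrable lborel (\<lambda>r. normal_density (sqrt j) (1 / sqrt 2) r * ?h r)"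
    by (rule Bochner_Integration.integrable_bound[OF integrable_normal_density[of "1 / sqrt 2" "sqrt j"]])
      (auto simp: abs_mult Phi_nonneg Phi_le_1 mult_left_le)
  have "(\<integral>\<^sup>+x. \<integral>\<^sup>+y. of_bool (A + x \<le> w * y) \<partial>chi j \<partial>std_normal_distribution)
    = (\<integral>\<^sup>+y. \<integral>\<^sup>+x. of_bool (A + x \<le> w * y) \<partial>std_normal_distribution \<partial>chi j)"
    by (rule XN.Fubini') measurable
  also have "\<dots> = (\<integral>\<^sup>+y. \<integral>\<^sup>+x. of_bool (x \<le> w * y - A) \<partial>std_normal_distribution \<partial>chi j)"
    by (simp add: le_diff_eq add.commute)
  also have "\<dots> = (\<integral>\<^sup>+y. ennreal (chi_weight j y) * ennreal (?h y) \<partial>lborel) / ennreal (chi_const j)"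
    unfolding emeasure_std_normal_atMost by (subst nn_integral_chi) (auto simp: nn_integral_chi_weight)
  also have "\<dots> = (\<integral>\<^sup>+y. ennreal (chi_weight j y / chi_const j * ?h y) \<partial>lborel)"
  proof -
    have "(\<integral>\<^sup>+y. ennreal (chi_weight j y / chi_const j * ?h y) \<partial>lborel)
      = (\<integral>\<^sup>+y. ennreal (1 / chi_const j) * (ennreal (chi_weight j y) * ennreal (?h y)) \<partial>lborel)"
      by (intro nn_integral_cong) (simp add: ennreal_mult[symmetric] Phi_nonneg less_imp_le)
    also have "\<dots> = ennreal (1 / chi_const j) * (\<integral>\<^sup>+y. (ennreal (chi_weight j y) * ennreal (?h y)) \<partial>lborel)"
      by (rule nn_integral_cmult) measurable
    finally show ?thesis
      by (simp add: divide_ennreal_def inverse_ennreal mult.commute inverse_eq_divide)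
  qed
  also have "\<dots> = ennreal (\<integral>y. chi_weight j y / chi_const j * ?h y \<partial>lborel)"
    using i1 by (intro nn_integral_eq_integral) (auto simp: Phi_nonneg less_imp_le)
  also have "\<dots> \<le> ennreal ((\<integral>y. normal_density (sqrt j) (1 / sqrt 2) y * ?h y \<partial>lborel) + 12 / sqrt j)"
    by (intro ennreal_leI chi_normal_comparison j) (auto simp: Phi_nonneg Phi_le_1)
  also have "(\<integral>y. normal_density (sqrt j) (1 / sqrt 2) y * ?h y \<partial>lborel) = Phi ((w * sqrt j - A) / sqrt (1 + w\<^sup>2 / 2))"
  proof -
    have "ennreal (\<integral>y. normal_density (sqrt j) (1 / sqrt 2) y * ?h y \<partial>lborel)
       = (\<integral>\<^sup>+y. ennreal (normal_density (sqrt j) (1 / sqrt 2) y * ?h y) \<partial>lborel)"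
      using i2 by (intro nn_integral_eq_integral[symmetric]) (auto simp: Phi_nonneg)
    also have "\<dots> = ennreal (Phi ((w * sqrt j - A) / sqrt (1 + w\<^sup>2 / 2)))"
      unfolding normal_Phi_integral[symmetric] by (intro nn_integral_cong) (simp add: ennreal_mult Phi_nonneg)
    finally show ?thesis
      by (subst (asm) ennreal_inj) (auto simp: Phi_nonneg intro!: integral_nonneg)
  qed
  finally show ?thesis .
qed

section \<open>Spherical codes\<close>

text \<open>The law with \<open>u = 0\<close> represents the squared norm as
  \<open>a\<^sup>2 + r\<^sup>2\<close> with \<open>r > 0\<close> almost surely.\<close>

lemma AE_gauss_nonzero: "AE g in gauss (j + 2). (\<Sum>i<j + 2. (g i)\<^sup>2) \<noteq> 0"
proof -
  have "(\<integral>\<^sup>+g. of_bool ((\<Sum>i<j + 2. (g i)\<^sup>2) = 0) \<partial>gauss (j + 2))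
     = (\<integral>\<^sup>+g. (\<lambda>(x, q). of_bool (q = 0)) (\<Sum>i<j + 2. 0 * g i, \<Sum>i<j + 2. (g i)\<^sup>2) \<partial>gauss (j + 2))"
    by simp
  also have "\<dots> = (\<integral>\<^sup>+a. \<integral>\<^sup>+r. (\<lambda>(x, q). of_bool (q = 0)) (sqrt (\<Sum>i<j + 2. 0\<^sup>2) * a, a\<^sup>2 + r\<^sup>2) \<partial>chi j \<partial>std_normal_distribution)"
    by (rule gauss_law) measurable
  also have "\<dots> = (\<integral>\<^sup>+a. \<integral>\<^sup>+r. 0 \<partial>chi j \<partial>std_normal_distribution)"
  proof (rule nn_integral_cong, rule nn_integral_cong_AE)
    fix a :: real
    show "AE r in chi j. (\<lambda>(x, q). of_bool (q = 0)) (sqrt (\<Sum>i<j + 2. 0\<^sup>2) * a, a\<^sup>2 + r\<^sup>2) = (0 :: ennreal)"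
      using AE_chi_pos[of j] by eventually_elim (auto simp: sum_power2_eq_zero_iff)
  qed
  finally have "(\<integral>\<^sup>+g. of_bool ((\<Sum>i<j + 2. (g i)\<^sup>2) = 0) \<partial>gauss (j + 2)) = 0" by simp
  then have "AE g in gauss (j + 2). of_bool ((\<Sum>i<j + 2. (g i)\<^sup>2) = 0) = (0 :: ennreal)"
    by (subst (asm) nn_integral_0_iff_AE) auto
  then show ?thesis by eventually_elim (auto split: if_splits simp: of_bool_def)
qed

text \<open>The null vector is sent to the first basis vector, so the norm is one for every sample
  and not only almost surely: \<open>random_coding\<close> asks for the power constraint at every
  point.\<close>

definition unit_vec :: "nat \<Rightarrow> (nat \<Rightarrow> real) \<Rightarrow> nat \<Rightarrow> real" where
  "unit_vec n g i = (if i < n then if (\<Sum>k<n. (g k)\<^sup>2) = 0 then of_bool (i = 0) else g i / sqrt (\<Sum>k<n. (g k)\<^sup>2) else 0)"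

lemma measurable_unit_vec[measurable]: "(\<lambda>g. unit_vec n g i) \<in> borel_measurable (PiM {..<n} (\<lambda>_. borel))"
proof (cases "i < n")
  case True
  have "{g \<in> space (PiM {..<n} (\<lambda>_. borel)). (\<Sum>k<n. (g k)\<^sup>2) = (0::real)} \<in> sets (PiM {..<n} (\<lambda>_. borel))"
    by (rule borel_measurable_eq) measurable
  with True show ?thesis unfolding unit_vec_def by (auto intro!: measurable_If)
qed (simp add: unit_vec_def)

lemma norm_unit_vec:
  assumes "n > 0" shows "(\<Sum>i<n. (unit_vec n g i)\<^sup>2) = 1"
proof (cases "(\<Sum>k<n. (g k)\<^sup>2) = 0")
  case True
  then have "(\<Sum>i<n. (unit_vec n g i)\<^sup>2) = (\<Sum>i<n. if i = 0 then 1 else 0)"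
    by (intro sum.cong) (auto simp: unit_vec_def)
  then show ?thesis using assms by simp
next
  case False
  then have "(\<Sum>i<n. (unit_vec n g i)\<^sup>2) = (\<Sum>i<n. (g i)\<^sup>2 / (\<Sum>k<n. (g k)\<^sup>2))"
    by (intro sum.cong) (auto simp: unit_vec_def power_divide sum_nonneg)
  then show ?thesis using False by (simp add: sum_divide_distrib[symmetric])
qed

text \<open>The premise says that the competitor's angle with the output does not exceed that of the
  transmitted codeword. It forces \<open>a > 0\<close>; squaring then cancels
  \<open>t\<^sup>2 * a\<^sup>2\<close>, and comparing cosines becomes comparing the slopes
  \<open>t / y\<close> and \<open>a / r\<close>.\<close>

lemma cap_condition:
  fixes t y a r :: real
  assumes "t > 0" "y > 0" "r > 0" and le: "t \<le> sqrt (t\<^sup>2 + y\<^sup>2) * a / sqrt (a\<^sup>2 + r\<^sup>2)"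
  shows "t / y * r \<le> a"
proof -
  have p: "sqrt (a\<^sup>2 + r\<^sup>2) > 0" using assms by (simp add: add_nonneg_pos)
  have le': "t * sqrt (a\<^sup>2 + r\<^sup>2) \<le> sqrt (t\<^sup>2 + y\<^sup>2) * a" using le p by (simp add: pos_le_divide_eq)
  have "0 < t * sqrt (a\<^sup>2 + r\<^sup>2)" using assms p by simp
  then have "0 < sqrt (t\<^sup>2 + y\<^sup>2) * a" using le' by linarith
  then have a: "a > 0" by (auto simp: zero_less_mult_iff not_sum_power2_lt_zero)
  have "(t * sqrt (a\<^sup>2 + r\<^sup>2))\<^sup>2 \<le> (sqrt (t\<^sup>2 + y\<^sup>2) * a)\<^sup>2"
    using le' assms p by (intro power_mono) auto
  then have "(t * r)\<^sup>2 \<le> (y * a)\<^sup>2" by (simp add: power_mult_distrib algebra_simps)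
  then have "t * r \<le> y * a" by (rule power2_le_imp_le) (use a assms in simp)
  then show ?thesis using assms by (simp add: field_simps)
qed

text \<open>Both laws are applied in dimension \<open>n = i + 5\<close>, so the chi index is
  \<open>n - 2 = i + 3\<close>, as the competitor estimate requires. The estimates hold for each
  transmitted direction separately, because only its unit length enters.\<close>

lemma spherical_code:
  fixes P w eps :: real
  assumes P: "P \<ge> 0" and w: "w > 0" and M: "M \<ge> 1" and n: "n = i + 5"
  assumes bound: "Phi ((w * sqrt (real i + 3) - sqrt (real n * P)) / sqrt (1 + w\<^sup>2 / 2)) + 12 / sqrt (real i + 3)
    + real M * (sqrt (real i + 4) / (2 * pi * w\<^sup>2 * sqrt (1 + w\<^sup>2) ^ (i + 1) * ((real i + 1) * sqrt (real i + 2)))) \<le> eps"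
  shows "\<exists>x D. is_av_code n M eps P x D"
proof -
  define A where "A = sqrt (real n * P)"
  define u where "u = unit_vec n"
  define j where "j = i + 3"
  have nj: "n = j + 2" using n by (simp add: j_def)
  have n0: "n > 0" using n by simp
  have u1: "(\<Sum>i<n. (u g i)\<^sup>2) = 1" for g unfolding u_def by (rule norm_unit_vec[OF n0])
  have um[measurable]: "(\<lambda>g. u g k) \<in> borel_measurable (PiM {..<n} (\<lambda>_. borel))" for k unfolding u_def by measurable
  define s where "s g y = (\<Sum>k<n. u g k * y k)" for g y :: "nat \<Rightarrow> real"
  \<comment> \<open>The square root is the length of the noise component orthogonal to the
    transmitted direction, the variable \<open>y\<close> of the reduced problem.\<close>
  define B where "B g z \<longleftrightarrow> A + s g z \<le> w * sqrt ((\<Sum>k<n. (z k)\<^sup>2) - (s g z)\<^sup>2)" for g z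
  define Y where "Y g z = (\<lambda>k\<in>{..<n}. A * u g k + z k)" for g z
  define p1 where "p1 = Phi ((w * sqrt j - A) / sqrt (1 + w\<^sup>2 / 2)) + 12 / sqrt j"
  define p2 where "p2 = sqrt (real i + 4) / (2 * pi * w\<^sup>2 * sqrt (1 + w\<^sup>2) ^ (i + 1) * ((real i + 1) * sqrt (real i + 2)))"
  have p1: "p1 \<ge> 0" unfolding p1_def by (simp add: Phi_nonneg)
  have p2: "p2 \<ge> 0" unfolding p2_def by simp
  have le: "p1 + real M * p2 \<le> eps" using bound by (simp add: p1_def p2_def A_def j_def add.commute)
  interpret G: prob_space "gauss n" by (rule prob_space_gauss)
  have sm[measurable]: "case_prod s \<in> borel_measurable (gauss n \<Otimes>\<^sub>M PiM {..<n} (\<lambda>_. borel))"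
    unfolding s_def split_beta' by measurable
  have first: "(\<integral>\<^sup>+z. of_bool (B g z) \<partial>gauss n) \<le> ennreal p1" for g
  proof -
    have "(\<integral>\<^sup>+z. of_bool (B g z) \<partial>gauss n)
      = (\<integral>\<^sup>+z. (\<lambda>(x, q). of_bool (A + x \<le> w * sqrt (q - x\<^sup>2))) (\<Sum>k<n. u g k * z k, \<Sum>k<n. (z k)\<^sup>2) \<partial>gauss n)"
      by (simp add: B_def s_def)
    also have "\<dots> = (\<integral>\<^sup>+x. \<integral>\<^sup>+y. (\<lambda>(x, q). of_bool (A + x \<le> w * sqrt (q - x\<^sup>2))) (sqrt (\<Sum>k<n. (u g k)\<^sup>2) * x, x\<^sup>2 + y\<^sup>2) \<partial>chi j \<partial>std_normal_distribution)"
      unfolding nj by (rule gauss_law) measurable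
    also have "\<dots> = (\<integral>\<^sup>+x. \<integral>\<^sup>+y. of_bool (A + x \<le> w * y) \<partial>chi j \<partial>std_normal_distribution)"
    proof (rule nn_integral_cong, rule nn_integral_cong_AE)
      fix x :: real
      show "AE y in chi j. (\<lambda>(x, q). of_bool (A + x \<le> w * sqrt (q - x\<^sup>2))) (sqrt (\<Sum>k<n. (u g k)\<^sup>2) * x, x\<^sup>2 + y\<^sup>2)
        = (of_bool (A + x \<le> w * y) :: ennreal)"
        using AE_chi_pos[of j] by eventually_elim (simp add: u1)
    qed
    also have "\<dots> \<le> ennreal p1" unfolding p1_def by (rule own_score_bound) (simp add: j_def)
    finally show ?thesis .
  qed
  \<comment> \<open>The competitor's success probability outside \<open>B\<close>, written through
    the linear form \<open>x\<close> and the squared norm \<open>q\<close> of the noise, so that the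
    Gaussian law applies to it; \<open>A\<^sup>2 + 2 * A * x + q\<close> is the squared norm of the
    output.\<close>
  define H :: "real \<times> real \<Rightarrow> ennreal" where
    "H = (\<lambda>(x, q). of_bool (\<not> A + x \<le> w * sqrt (q - x\<^sup>2)) *
       (\<integral>\<^sup>+a. \<integral>\<^sup>+r. of_bool (A + x \<le> sqrt (A\<^sup>2 + 2 * A * x + q) * a / sqrt (a\<^sup>2 + r\<^sup>2)) \<partial>chi j \<partial>std_normal_distribution))"
  interpret N: prob_space std_normal_distribution by (intro prob_space_normal_density) simp
  interpret X: prob_space "chi j" by (rule prob_space_chi)
  have Hm[measurable]: "H \<in> borel_measurable (borel \<Otimes>\<^sub>M borel)"
    unfolding H_def split_beta' not_le by measurable
  have sY: "s g (Y g z) = A + s g z" for g z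
  proof -
    have "s g (Y g z) = A * (\<Sum>k<n. (u g k)\<^sup>2) + s g z"
      by (simp add: s_def Y_def sum.distrib sum_distrib_left power2_eq_square algebra_simps)
    then show ?thesis by (simp add: u1)
  qed
  have nY: "(\<Sum>k<n. (Y g z k)\<^sup>2) = A\<^sup>2 + 2 * A * s g z + (\<Sum>k<n. (z k)\<^sup>2)" for g z
  proof -
    have "(\<Sum>k<n. (Y g z k)\<^sup>2) = A\<^sup>2 * (\<Sum>k<n. (u g k)\<^sup>2) + 2 * A * s g z + (\<Sum>k<n. (z k)\<^sup>2)"
      by (simp add: s_def Y_def sum.distrib sum_distrib_left power2_eq_square algebra_simps)
    then show ?thesis by (simp add: u1)
  qed
  have compet: "of_bool (\<not> B g z) * (\<integral>\<^sup>+g'. of_bool (s g (Y g z) \<le> s g' (Y g z)) \<partial>gauss n)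
      = H (\<Sum>k<n. u g k * z k, \<Sum>k<n. (z k)\<^sup>2)" for g z
  proof -
    define y where "y = Y g z"
    define t where "t = s g y"
    \<comment> \<open>Second use of the law, now with the fixed output \<open>y\<close> as the
      linear form and the competitor's Gaussian vector as the random one; normalization divides by
      \<open>sqrt q\<close>.\<close>
    have "(\<integral>\<^sup>+g'. of_bool (t \<le> s g' y) \<partial>gauss n)
      = (\<integral>\<^sup>+g'. (\<lambda>(x, q). of_bool (t \<le> x / sqrt q)) (\<Sum>k<n. y k * g' k, \<Sum>k<n. (g' k)\<^sup>2) \<partial>gauss n)"
    proof (rule nn_integral_cong_AE)
      have "AE g in gauss n. (\<Sum>i<n. (g i)\<^sup>2) \<noteq> 0" unfolding nj by (rule AE_gauss_nonzero)
      then show "AE g' in gauss n. of_bool (t \<le> s g' y) = (\<lambda>(x, q). of_bool (t \<le> x / sqrt q) :: ennreal) (\<Sum>k<n. y k * g' k, \<Sum>k<n. (g' k)\<^sup>2)"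
      proof eventually_elim
        case (elim g')
        then have "s g' y = (\<Sum>k<n. y k * g' k) / sqrt (\<Sum>k<n. (g' k)\<^sup>2)"
          by (simp add: s_def u_def unit_vec_def sum_divide_distrib mult.commute)
        then show ?case by simp
      qed
    qed
    also have "\<dots> = (\<integral>\<^sup>+a. \<integral>\<^sup>+r. (\<lambda>(x, q). of_bool (t \<le> x / sqrt q)) (sqrt (\<Sum>k<n. (y k)\<^sup>2) * a, a\<^sup>2 + r\<^sup>2) \<partial>chi j \<partial>std_normal_distribution)"
      unfolding nj by (rule gauss_law) measurable
    finally show ?thesis
      by (simp add: H_def B_def y_def t_def sY nY) (simp add: s_def)
  qed
  have second: "(\<integral>\<^sup>+z. H (\<Sum>k<n. u g k * z k, \<Sum>k<n. (z k)\<^sup>2) \<partial>gauss n) \<le> ennreal p2" for g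
  proof -
    have "(\<integral>\<^sup>+z. H (\<Sum>k<n. u g k * z k, \<Sum>k<n. (z k)\<^sup>2) \<partial>gauss n)
       = (\<integral>\<^sup>+x. \<integral>\<^sup>+y. H (sqrt (\<Sum>k<n. (u g k)\<^sup>2) * x, x\<^sup>2 + y\<^sup>2) \<partial>chi j \<partial>std_normal_distribution)"
      unfolding nj by (rule gauss_law) measurable
    also have "\<dots> \<le> (\<integral>\<^sup>+x. \<integral>\<^sup>+y. of_bool (w * y < A + x) * (\<integral>\<^sup>+a. \<integral>\<^sup>+r. of_bool ((A + x) / y * r \<le> a) \<partial>chi j \<partial>std_normal_distribution)
      \<partial>chi j \<partial>std_normal_distribution)"
    proof (rule nn_integral_mono, rule nn_integral_mono_AE)
      fix x :: real
      show "AE y in chi j. H (sqrt (\<Sum>k<n. (u g k)\<^sup>2) * x, x\<^sup>2 + y\<^sup>2)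
        \<le> of_bool (w * y < A + x) * (\<integral>\<^sup>+a. \<integral>\<^sup>+r. of_bool ((A + x) / y * r \<le> a) \<partial>chi j \<partial>std_normal_distribution)"
        using AE_chi_pos[of j]
      proof eventually_elim
        case (elim y)
        have sq: "A\<^sup>2 + 2 * A * x + (x\<^sup>2 + y\<^sup>2) = (A + x)\<^sup>2 + y\<^sup>2" by (simp add: power2_eq_square algebra_simps)
        show ?case
        proof (cases "w * y < A + x")
          case True
          have t: "A + x > 0" using True elim w by (meson mult_pos_pos order_less_trans)
          have "H (sqrt (\<Sum>k<n. (u g k)\<^sup>2) * x, x\<^sup>2 + y\<^sup>2)
            = (\<integral>\<^sup>+a. \<integral>\<^sup>+r. of_bool (A + x \<le> sqrt ((A + x)\<^sup>2 + y\<^sup>2) * a / sqrt (a\<^sup>2 + r\<^sup>2)) \<partial>chi j \<partial>std_normal_distribution)"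
            using True elim unfolding H_def by (simp add: u1 sq del: times_divide_eq_left)
          also have "\<dots> \<le> (\<integral>\<^sup>+a. \<integral>\<^sup>+r. of_bool ((A + x) / y * r \<le> a) \<partial>chi j \<partial>std_normal_distribution)"
          proof (rule nn_integral_mono, rule nn_integral_mono_AE)
            fix a :: real
            show "AE r in chi j. of_bool (A + x \<le> sqrt ((A + x)\<^sup>2 + y\<^sup>2) * a / sqrt (a\<^sup>2 + r\<^sup>2)) \<le> (of_bool ((A + x) / y * r \<le> a) :: ennreal)"
              using AE_chi_pos[of j]
            proof eventually_elim
              case (elim r)
              then show ?case using cap_condition[OF t \<open>0 < y\<close> elim, of a] by (auto simp: of_bool_def)
            qed
          qed
          finally show ?thesis using True by simp
        next
          case False
          then show ?thesis using elim by (simp add: H_def u1)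
        qed
      qed
    qed
    also have "\<dots> \<le> ennreal p2" unfolding p2_def j_def by (rule competitor_bound[OF w])
    finally show ?thesis .
  qed
  show ?thesis
  proof (rule random_coding[where Q="gauss n" and X="\<lambda>g k. A * u g k" and s=s and B=B and Y=Y])
    show "prob_space (gauss n)" by (rule prob_space_gauss)
    show "(\<lambda>g. A * u g k) \<in> borel_measurable (gauss n)" for k by measurable
    show "(\<Sum>k<n. (A * u g k)\<^sup>2) \<le> real n * P" for g
    proof -
      have "(\<Sum>k<n. (A * u g k)\<^sup>2) = A\<^sup>2 * (\<Sum>k<n. (u g k)\<^sup>2)" by (simp add: power_mult_distrib sum_distrib_left)
      then show ?thesis using P by (simp add: u1 A_def)
    qed
    show "case_prod s \<in> borel_measurable (gauss n \<Otimes>\<^sub>M PiM {..<n} (\<lambda>_. borel))" by (rule sm)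
    show "Measurable.pred (gauss n \<Otimes>\<^sub>M PiM {..<n} (\<lambda>_. borel)) (case_prod B)"
      unfolding B_def split_beta' by measurable
    show "1 \<le> M" by (rule M)
    show "0 \<le> eps" using p1 p2 le mult_nonneg_nonneg[of "real M" p2] by linarith
    show "Y g z = (\<lambda>k\<in>{..<n}. A * u g k + z k)" for g z by (simp add: Y_def)
    have "(\<integral>\<^sup>+g. \<integral>\<^sup>+z. of_bool (B g z) \<partial>gauss n \<partial>gauss n) \<le> (\<integral>\<^sup>+g. ennreal p1 \<partial>gauss n)"
      by (intro nn_integral_mono first)
    also have "\<dots> = ennreal p1" by (simp add: G.emeasure_space_1)
    finally have a: "(\<integral>\<^sup>+g. \<integral>\<^sup>+z. of_bool (B g z) \<partial>gauss n \<partial>gauss n) \<le> ennreal p1" .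
    have "(\<integral>\<^sup>+g. \<integral>\<^sup>+z. of_bool (\<not> B g z) * (\<integral>\<^sup>+g'. of_bool (s g (Y g z) \<le> s g' (Y g z)) \<partial>gauss n) \<partial>gauss n \<partial>gauss n)
      \<le> (\<integral>\<^sup>+g. ennreal p2 \<partial>gauss n)"
      unfolding compet by (intro nn_integral_mono second)
    also have "\<dots> = ennreal p2" by (simp add: G.emeasure_space_1)
    finally have b: "(\<integral>\<^sup>+g. \<integral>\<^sup>+z. of_bool (\<not> B g z) * (\<integral>\<^sup>+g'. of_bool (s g (Y g z) \<le> s g' (Y g z)) \<partial>gauss n) \<partial>gauss n \<partial>gauss n) \<le> ennreal p2" .
    have "(\<integral>\<^sup>+g. \<integral>\<^sup>+z. of_bool (B g z) \<partial>gauss n \<partial>gauss n) +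
      of_nat M * (\<integral>\<^sup>+g. \<integral>\<^sup>+z. of_bool (\<not> B g z) * (\<integral>\<^sup>+g'. of_bool (s g (Y g z) \<le> s g' (Y g z)) \<partial>gauss n) \<partial>gauss n \<partial>gauss n)
      \<le> ennreal p1 + of_nat M * ennreal p2"
      by (intro add_mono mult_left_mono a b) auto
    also have "\<dots> = ennreal (p1 + real M * p2)"
      using p1 p2 by (simp add: ennreal_of_nat_eq_real_of_nat ennreal_mult[symmetric])
    also have "\<dots> \<le> ennreal eps" using le by (rule ennreal_leI)
    finally show "(\<integral>\<^sup>+g. \<integral>\<^sup>+z. of_bool (B g z) \<partial>gauss n \<partial>gauss n) +
      of_nat M * (\<integral>\<^sup>+g. \<integral>\<^sup>+z. of_bool (\<not> B g z) * (\<integral>\<^sup>+g'. of_bool (s g (Y g z) \<le> s g' (Y g z)) \<partial>gauss n) \<partial>gauss n \<partial>gauss n)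
      \<le> ennreal eps" .
  qed
qed

section \<open>Boundedness of the code size\<close>

text \<open>Expresses all channel laws as densities over one product Lebesgue measure, where they
  can be compared pointwise.\<close>

lemma PiM_density:
  fixes f :: "'i \<Rightarrow> 'a \<Rightarrow> ennreal"
  assumes "finite I" "\<And>i. sigma_finite_measure (N i)" "\<And>i. sigma_finite_measure (density (N i) (f i))"
    and f[measurable]: "\<And>i. f i \<in> borel_measurable (N i)"
  shows "PiM I (\<lambda>i. density (N i) (f i)) = density (PiM I N) (\<lambda>x. \<Prod>i\<in>I. f i (x i))"
proof -
  interpret D: product_sigma_finite "\<lambda>i. density (N i) (f i)" by (rule product_sigma_finite.intro) fact
  interpret N: product_sigma_finite N by (rule product_sigma_finite.intro) fact
  show ?thesis
  proof (rule D.PiM_eqI[symmetric])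
    show "finite I" by fact
    show "sets (density (PiM I N) (\<lambda>x. \<Prod>i\<in>I. f i (x i))) = sets (PiM I (\<lambda>i. density (N i) (f i)))"
      by (simp, intro sets_PiM_cong) auto
    fix A assume A: "\<And>i. i \<in> I \<Longrightarrow> A i \<in> sets (density (N i) (f i))"
    have Pi: "Pi\<^sub>E I A \<in> sets (PiM I N)" using A \<open>finite I\<close> by (intro sets_PiM_I_finite) auto
    have m: "(\<lambda>x. \<Prod>i\<in>I. f i (x i)) \<in> borel_measurable (PiM I N)" by measurable
    have "emeasure (density (PiM I N) (\<lambda>x. \<Prod>i\<in>I. f i (x i))) (Pi\<^sub>E I A)
      = (\<integral>\<^sup>+x. (\<Prod>i\<in>I. f i (x i)) * indicator (Pi\<^sub>E I A) x \<partial>PiM I N)"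
      using Pi m by (intro emeasure_density)
    also have "\<dots> = (\<integral>\<^sup>+x. (\<Prod>i\<in>I. f i (x i) * indicator (A i) (x i)) \<partial>PiM I N)"
    proof (rule nn_integral_cong)
      fix x assume x: "x \<in> space (PiM I N)"
      show "(\<Prod>i\<in>I. f i (x i)) * indicator (Pi\<^sub>E I A) x = (\<Prod>i\<in>I. f i (x i) * indicator (A i) (x i))"
      proof (cases "\<forall>i\<in>I. x i \<in> A i")
        case True
        then have "x \<in> Pi\<^sub>E I A" using x by (auto simp: space_PiM PiE_iff)
        then show ?thesis using True by (auto intro!: prod.cong)
      next
        case False
        then obtain i where i: "i \<in> I" "x i \<notin> A i" by auto
        then have "x \<notin> Pi\<^sub>E I A" by (auto simp: PiE_iff)
        moreover have "(\<Prod>i\<in>I. f i (x i) * indicator (A i) (x i)) = 0"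
          using i \<open>finite I\<close> by (intro prod_zero) (auto intro!: bexI[of _ i])
        ultimately show ?thesis by simp
      qed
    qed
    also have "\<dots> = (\<Prod>i\<in>I. \<integral>\<^sup>+x. f i x * indicator (A i) x \<partial>N i)"
      using \<open>finite I\<close> A by (intro N.product_nn_integral_prod) auto
    also have "\<dots> = (\<Prod>i\<in>I. emeasure (density (N i) (f i)) (A i))"
      using A by (intro prod.cong refl emeasure_density[symmetric]) auto
    finally show "emeasure (density (PiM I N) (\<lambda>x. \<Prod>i\<in>I. f i (x i))) (Pi\<^sub>E I A)
      = (\<Prod>i\<in>I. emeasure (density (N i) (f i)) (A i))" .
  qed
qed

text \<open>The gap of the exponents is the square of \<open>y / 2 - x\<close>. Doubling the
  variance leaves room to absorb the shift \<open>x\<close> into a constant depending on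
  \<open>x\<^sup>2\<close> only, and the power constraint bounds the product of these
  constants.\<close>

lemma W_awgn_le: "W_awgn y x \<le> exp (x\<^sup>2 / 2) * sqrt 2 * normal_density 0 (sqrt 2) y"
proof -
  have "0 \<le> (y / 2 - x)\<^sup>2" by simp
  moreover have "x\<^sup>2 / 2 + - y\<^sup>2 / 4 - - ((y - x)\<^sup>2) / 2 = (y / 2 - x)\<^sup>2"
    by (simp add: power2_eq_square field_simps)
  ultimately have "- ((y - x)\<^sup>2) / 2 \<le> x\<^sup>2 / 2 + - y\<^sup>2 / 4" by linarith
  then have "exp (- ((y - x)\<^sup>2) / 2) \<le> exp (x\<^sup>2 / 2) * exp (- y\<^sup>2 / 4)" unfolding exp_add[symmetric] by simp
  then have "1 / sqrt (2 * pi) * exp (- ((y - x)\<^sup>2) / 2) \<le> 1 / sqrt (2 * pi) * (exp (x\<^sup>2 / 2) * exp (- y\<^sup>2 / 4))"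
    by (intro mult_left_mono) auto
  also have "\<dots> = exp (x\<^sup>2 / 2) * sqrt 2 * normal_density 0 (sqrt 2) y"
    by (simp add: normal_density_def real_sqrt_mult) (simp add: field_simps)
  finally show ?thesis unfolding W_awgn_def .
qed

text \<open>All channel laws under the power constraint are dominated by one multiple of a fixed
  probability measure, so for each blocklength the code size is bounded.\<close>
lemma code_size_bounded:
  assumes code: "is_av_code n M eps P x D" and eps: "eps < 1"
  shows "real M * (1 - eps) \<le> exp (real n * P / 2) * sqrt 2 ^ n"
proof (cases "M = 0")
  case False
  define V where "V = PiM {..<n} (\<lambda>_. density lborel (\<lambda>y. ennreal (normal_density 0 (sqrt 2) y)))"
  define C where "C = exp (real n * P / 2) * sqrt 2 ^ n"
  have C: "C \<ge> 0" by (simp add: C_def)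
  interpret V: prob_space V unfolding V_def by (intro prob_space_PiM prob_space_normal_density) simp
  have sf: "sigma_finite_measure (density lborel (\<lambda>y. ennreal (normal_density a t y)))" if "t > 0" for a t
    using that by (intro prob_space_imp_sigma_finite prob_space_normal_density)
  have Vd: "V = density (out_space n) (\<lambda>y. \<Prod>i<n. ennreal (normal_density 0 (sqrt 2) (y i)))"
    unfolding V_def out_space_def
    by (rule PiM_density) (auto intro: lborel.sigma_finite_measure_axioms sf)
  have Wd: "Wn n z = density (out_space n) (\<lambda>y. \<Prod>i<n. ennreal (W_awgn (y i) (z i)))" for z
    unfolding Wn_def out_space_def W_awgn_eq_normal
    by (rule PiM_density) (auto intro: lborel.sigma_finite_measure_axioms sf)
  have D: "D m \<in> sets (out_space n)" and pow: "(\<Sum>i<n. (x m i)\<^sup>2) \<le> real n * P" if "m \<in> {1..M}" for m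
    using code that unfolding is_av_code_def by auto
  have disj: "disjoint_family_on D {1..M}"
    using code unfolding is_av_code_def disjoint_family_on_def by blast
  have dom: "emeasure (Wn n (x m)) (D m) \<le> ennreal C * emeasure V (D m)" if m: "m \<in> {1..M}" for m
  proof -
    have [measurable]: "D m \<in> sets (PiM {..<n} (\<lambda>_. borel))" using D[OF m] by (simp add: sets_out_space)
    have "emeasure (Wn n (x m)) (D m) = (\<integral>\<^sup>+y. (\<Prod>i<n. ennreal (W_awgn (y i) (x m i))) * indicator (D m) y \<partial>out_space n)"
      unfolding Wd W_awgn_eq_normal by (rule emeasure_density) measurable
    also have "\<dots> \<le> (\<integral>\<^sup>+y. ennreal C * ((\<Prod>i<n. ennreal (normal_density 0 (sqrt 2) (y i))) * indicator (D m) y) \<partial>out_space n)"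
    proof (rule nn_integral_mono)
      fix y
      have "(\<Prod>i<n. W_awgn (y i) (x m i)) \<le> (\<Prod>i<n. exp ((x m i)\<^sup>2 / 2) * sqrt 2 * normal_density 0 (sqrt 2) (y i))"
        by (intro prod_mono conjI W_awgn_le) (simp add: W_awgn_eq_normal)
      also have "\<dots> = exp ((\<Sum>i<n. (x m i)\<^sup>2) / 2) * sqrt 2 ^ n * (\<Prod>i<n. normal_density 0 (sqrt 2) (y i))"
        by (simp add: prod.distrib exp_sum[symmetric] sum_divide_distrib)
      also have "\<dots> \<le> C * (\<Prod>i<n. normal_density 0 (sqrt 2) (y i))"
        unfolding C_def using pow[OF m] by (intro mult_right_mono prod_nonneg) auto
      finally have "ennreal (\<Prod>i<n. W_awgn (y i) (x m i)) \<le> ennreal (C * (\<Prod>i<n. normal_density 0 (sqrt 2) (y i)))"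
        by (rule ennreal_leI)
      then have "(\<Prod>i<n. ennreal (W_awgn (y i) (x m i))) \<le> ennreal C * (\<Prod>i<n. ennreal (normal_density 0 (sqrt 2) (y i)))"
        using C by (simp add: prod_ennreal W_awgn_eq_normal ennreal_mult prod_nonneg)
      then show "(\<Prod>i<n. ennreal (W_awgn (y i) (x m i))) * indicator (D m) y
        \<le> ennreal C * ((\<Prod>i<n. ennreal (normal_density 0 (sqrt 2) (y i))) * indicator (D m) y)"
        by (simp add: indicator_def)
    qed
    also have "\<dots> = ennreal C * (\<integral>\<^sup>+y. ((\<Prod>i<n. ennreal (normal_density 0 (sqrt 2) (y i))) * indicator (D m) y) \<partial>out_space n)"
      by (rule nn_integral_cmult) measurable
    also have "(\<integral>\<^sup>+y. ((\<Prod>i<n. ennreal (normal_density 0 (sqrt 2) (y i))) * indicator (D m) y) \<partial>out_space n) = emeasure V (D m)"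
      unfolding Vd by (rule emeasure_density[symmetric]) measurable
    finally show ?thesis .
  qed
  have VD: "D m \<in> sets V" if "m \<in> {1..M}" for m using D[OF that] by (simp add: Vd)
  \<comment> \<open>The disjoint regions share total \<open>V\<close>-mass at most one, so the
    success probabilities add up to at most \<open>C\<close>; by the error constraint the sum is
    also at least \<open>M * (1 - eps)\<close>.\<close>
  have "(\<Sum>m=1..M. measure (Wn n (x m)) (D m)) \<le> (\<Sum>m=1..M. C * measure V (D m))"
  proof (rule sum_mono)
    fix m assume m: "m \<in> {1..M}"
    interpret Wm: prob_space "Wn n (x m)" by (rule prob_space_Wn)
    show "measure (Wn n (x m)) (D m) \<le> C * measure V (D m)"
      using dom[OF m] C by (simp add: Wm.emeasure_eq_measure V.emeasure_eq_measure ennreal_mult[symmetric])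
  qed
  also have "\<dots> = C * measure V (\<Union>m\<in>{1..M}. D m)"
    using disj VD by (subst V.finite_measure_finite_Union) (auto simp: sum_distrib_left)
  also have "\<dots> \<le> C" using C by (simp add: mult_left_le)
  finally have up: "(\<Sum>m=1..M. measure (Wn n (x m)) (D m)) \<le> C" .
  have "(\<Sum>m=1..M. measure (Wn n (x m)) (space (out_space n) - D m)) = (\<Sum>m=1..M. 1 - measure (Wn n (x m)) (D m))"
  proof (rule sum.cong)
    fix m assume m: "m \<in> {1..M}"
    interpret Wm: prob_space "Wn n (x m)" by (rule prob_space_Wn)
    have "D m \<in> sets (Wn n (x m))" using D[OF m] by (simp add: Wd)
    then show "measure (Wn n (x m)) (space (out_space n) - D m) = 1 - measure (Wn n (x m)) (D m)"
      using Wm.prob_compl[of "D m"] by (simp add: space_Wn space_out_space)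
  qed simp
  also have "\<dots> = real M - (\<Sum>m=1..M. measure (Wn n (x m)) (D m))" by (simp add: sum_subtractf)
  finally have eq: "(\<Sum>m=1..M. measure (Wn n (x m)) (space (out_space n) - D m)) = \<dots>" .
  have "1 / real M * (\<Sum>m=1..M. measure (Wn n (x m)) (space (out_space n) - D m)) \<le> eps"
    using code unfolding is_av_code_def by blast
  then have "(\<Sum>m=1..M. measure (Wn n (x m)) (space (out_space n) - D m)) \<le> real M * eps"
    using False by (simp add: divide_le_eq mult.commute)
  then show ?thesis using up unfolding eq C_def by (simp add: algebra_simps)
qed simp

text \<open>\<open>GREATEST\<close> dominates its members only when they are bounded; any bound
  depending on \<open>n\<close> will do.\<close>

lemma code_size_le_Mstar:
  assumes "is_av_code n M eps P x D" "eps < 1"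
  shows "M \<le> Mstar n eps P"
  unfolding Mstar_def
proof (rule Greatest_le_nat)
  show "\<exists>x D. is_av_code n M eps P x D" using assms by blast
  fix K assume "\<exists>x D. is_av_code n K eps P x D"
  then have "real K * (1 - eps) \<le> exp (real n * P / 2) * sqrt 2 ^ n" using code_size_bounded assms(2) by blast
  then have "real K \<le> exp (real n * P / 2) * sqrt 2 ^ n / (1 - eps)" using assms(2) by (simp add: pos_le_divide_eq)
  then show "K \<le> nat \<lceil>exp (real n * P / 2) * sqrt 2 ^ n / (1 - eps)\<rceil>" by linarith
qed

text \<open>One message that is always decoded correctly. It gives \<open>Mstar \<ge> 1\<close>, so
  the logarithm is nonnegative at every block length.\<close>

lemma trivial_code:
  assumes "P \<ge> 0" "eps \<ge> 0"
  shows "is_av_code n 1 eps P (\<lambda>_ _. 0) (\<lambda>_. space (out_space n))"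
  unfolding is_av_code_def
proof (intro conjI ballI impI)
  show "(\<Sum>i<n. (0::real)\<^sup>2) \<le> real n * P" using assms by simp
  show "1 / real 1 * (\<Sum>m=1..1. measure (Wn n (\<lambda>_. 0)) (space (out_space n) - space (out_space n))) \<le> eps"
    using assms by (simp only: Diff_cancel measure_empty sum.neutral_const mult_zero_right)
qed (rule sets.top, simp)

section \<open>Asymptotics\<close>

text \<open>From \<open>ln z \<le> z - 1\<close> at the quotient of the two arguments. The quadratic
  remainder matters: with \<open>w - a\<close> of order \<open>1 / sqrt n\<close> it stays bounded
  after multiplication by \<open>n\<close>.\<close>

lemma ln_one_plus_square_lower:
  fixes a w :: real
  assumes a: "a \<ge> 0"
  shows "ln (1 + w\<^sup>2) \<ge> ln (1 + a\<^sup>2) + 2 * a / (1 + a\<^sup>2) * (w - a) - (w - a)\<^sup>2"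
proof -
  define p where "p = 1 + w\<^sup>2"
  define r where "r = 1 + a\<^sup>2"
  have p: "p > 0" and r: "r > 0" by (auto simp: p_def r_def add_pos_nonneg)
  have "ln (r / p) \<le> r / p - 1" using p r by (intro ln_le_minus_one) auto
  then have 1: "ln p - ln r \<ge> 1 - r / p" using p r by (simp add: ln_div)
  have "2 * a * w + a\<^sup>2 \<le> p * r"
  proof -
    have "p * r - (2 * a * w + a\<^sup>2) = (1 - a * w)\<^sup>2 + w\<^sup>2" by (simp add: p_def r_def power2_eq_square algebra_simps)
    then show ?thesis by (smt (verit) zero_le_power2)
  qed
  then have "(1 - (2 * a * w + a\<^sup>2)) / (p * r) \<ge> -1" using p r by (simp add: pos_le_divide_eq)
  then have "(w - a)\<^sup>2 * ((1 - (2 * a * w + a\<^sup>2)) / (p * r)) \<ge> (w - a)\<^sup>2 * (-1)" by (intro mult_left_mono) auto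
  moreover have "(1 - r / p) - 2 * a / r * (w - a) = (w - a)\<^sup>2 * ((1 - (2 * a * w + a\<^sup>2)) / (p * r))"
  proof -
    have "((1 - r / p) - 2 * a / r * (w - a)) * (p * r) = (p - r) * r - 2 * a * (w - a) * p"
      using p r by (simp add: field_simps)
    also have "\<dots> = (w - a)\<^sup>2 * (1 - (2 * a * w + a\<^sup>2))"
      by (simp add: p_def r_def power2_eq_square algebra_simps)
    finally show ?thesis using p r by (simp add: eq_divide_eq)
  qed
  ultimately show ?thesis using 1 unfolding p_def r_def by linarith
qed

text \<open>Allows the standard deviation at \<open>w\<close> to be replaced by that at
  \<open>sqrt P\<close>, at a cost of order \<open>1 / sqrt n\<close> in the argument of
  \<open>Phi\<close>.\<close>

lemma inverse_sqrt_lipschitz: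
  fixes a w :: real
  assumes a: "a \<ge> 0" and w: "w \<ge> 0"
  shows "\<bar>1 / sqrt (1 + w\<^sup>2 / 2) - 1 / sqrt (1 + a\<^sup>2 / 2)\<bar> \<le> \<bar>w - a\<bar>"
proof -
  define f where "f = sqrt (1 + w\<^sup>2 / 2)"
  define g where "g = sqrt (1 + a\<^sup>2 / 2)"
  have f: "f \<ge> 1" "f\<^sup>2 = 1 + w\<^sup>2 / 2" by (auto simp: f_def add_nonneg_nonneg)
  have g: "g \<ge> 1" "g\<^sup>2 = 1 + a\<^sup>2 / 2" by (auto simp: g_def add_nonneg_nonneg)
  have fw: "w \<le> 2 * f" by (rule power2_le_imp_le) (use f in \<open>auto simp: power_mult_distrib\<close>)
  have ga: "a \<le> 2 * g" by (rule power2_le_imp_le) (use g in \<open>auto simp: power_mult_distrib\<close>)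
  have "(g - f) * (g + f) = (a - w) * (a + w) / 2"
    using f(2) g(2) by (simp add: power2_eq_square algebra_simps)
  then have "\<bar>(g - f) * (g + f)\<bar> = \<bar>(a - w) * (a + w) / 2\<bar>" by simp
  then have "\<bar>g - f\<bar> * (g + f) = \<bar>a - w\<bar> * ((a + w) / 2)"
    using f(1) g(1) a w by (simp add: abs_mult)
  also have "\<dots> \<le> \<bar>a - w\<bar> * (g + f)" using fw ga by (intro mult_left_mono) auto
  finally have gf: "\<bar>g - f\<bar> \<le> \<bar>a - w\<bar>" using f g by (simp add: mult_le_cancel_right)
  have fg: "f * g \<ge> 1" using mult_mono[of 1 f 1 g] f g by simp
  have "1 / f - 1 / g = (g - f) / (f * g)" using f g by (simp add: field_simps)
  then have "\<bar>1 / f - 1 / g\<bar> = \<bar>g - f\<bar> / (f * g)" using f g by (simp add: abs_mult)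
  also have "\<dots> \<le> \<bar>g - f\<bar> / 1" using fg by (intro divide_left_mono) auto
  also have "\<dots> \<le> \<bar>w - a\<bar>" using gf by simp
  finally show ?thesis unfolding f_def g_def .
qed

text \<open>The factor \<open>sqrt (i + 3)\<close> contributed by the code size, set against the
  order \<open>1 / i\<close> of the competitor bound.\<close>

lemma competitor_prefactor:
  "sqrt (real i + 3) * (sqrt (real i + 4) / ((real i + 1) * sqrt (real i + 2))) \<le> 6 / sqrt (real i + 3)"
proof -
  define m where "m = sqrt (real i + 3)"
  have m: "m > 0" "m * m = real i + 3" by (auto simp: m_def)
  have "sqrt (real i + 4) \<le> sqrt (4 * (real i + 2))" by (intro real_sqrt_le_mono) simp
  then have s: "sqrt (real i + 4) \<le> 2 * sqrt (real i + 2)" unfolding real_sqrt_mult by simp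
  have "sqrt (real i + 4) / ((real i + 1) * sqrt (real i + 2)) \<le> 2 * sqrt (real i + 2) / ((real i + 1) * sqrt (real i + 2))"
    using s by (intro divide_right_mono) auto
  also have "\<dots> = 2 / (real i + 1)" by simp
  also have "\<dots> \<le> 6 / (real i + 3)" by (simp add: divide_simps)
  also have "\<dots> = 6 / (m * m)" using m by simp
  finally have "m * (sqrt (real i + 4) / ((real i + 1) * sqrt (real i + 2))) \<le> m * (6 / (m * m))"
    using m by (intro mult_left_mono) auto
  also have "m * (6 / (m * m)) = 6 / m" using m(1) by simp
  finally show ?thesis unfolding m_def .
qed

lemma code_existence_asymptotic:
  fixes P eps :: real
  assumes P: "P > 0" and eps: "0 < eps" "eps < 1"
  defines "q \<equiv> Phi_inv eps" and "V \<equiv> P * (P + 2) / (2 * (P + 1)\<^sup>2)"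
  shows "\<exists>K N. \<forall>i\<ge>N. \<exists>M\<ge>1. (\<exists>x D. is_av_code (i + 5) M eps P x D) \<and>
    (real i + 3) * (ln (1 + P) / 2) + sqrt (real i + 3) * sqrt V * q + ln (real i + 3) / 2 - K \<le> ln (real M)"
proof -
  \<comment> \<open>\<open>L\<close> is the limiting standard deviation, and \<open>d\<close> bounds
    the normal density below on \<open>[q - 1, q]\<close>. \<open>K0\<close> bounds
    \<open>beta\<^sup>2\<close>, and \<open>K1 / m\<close> will bound the competitor term.
    \<open>c0\<close> solves \<open>d * c0 = 12 + K1\<close>, so a shift by \<open>c0 / m\<close>
    pays for both error terms; the part \<open>K0\<close> of \<open>c\<close> pays for replacing the
    standard deviation by \<open>L\<close>.\<close>
  define L where "L = sqrt (1 + P / 2)"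
  define d where "d = std_normal_density (\<bar>q\<bar> + 1)"
  define K0 where "K0 = (L * (\<bar>q\<bar> + 1))\<^sup>2"
  define K1 where "K1 = 24 * (1 + 4 * P) / P"
  define c0 where "c0 = (12 + K1) / d"
  define c where "c = K0 + c0"
  have L: "L \<ge> 1" unfolding L_def using P by simp
  have L0: "L \<noteq> 0" using L by linarith
  have d: "d > 0" unfolding d_def by (rule normal_density_pos) simp
  have K0: "K0 \<ge> 0" and K1: "K1 \<ge> 0" unfolding K0_def K1_def using P by auto
  have c0: "c0 \<ge> 0" unfolding c0_def using d K1 by simp
  have c: "c \<ge> 0" "c0 \<le> c" unfolding c_def using K0 c0 by auto
  have Pq: "Phi q = eps" unfolding q_def by (rule Phi_Phi_inv[OF eps])
  \<comment> \<open>From \<open>m \<ge> c\<close> the shift \<open>c / m\<close> is at most one; the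
    other bound keeps \<open>w\<close> between \<open>sqrt P / 2\<close> and
    \<open>2 * sqrt P\<close>.\<close>
  define m0 where "m0 = max c (2 * L * (\<bar>q\<bar> + 1) / sqrt P)"
  define N where "N = nat \<lceil>m0\<^sup>2\<rceil>"
  \<comment> \<open>The three losses in \<open>ln M\<close>: the shift of the argument, the
    quadratic remainder of the logarithm, and the rounding of \<open>T\<close>, which at most halves
    it.\<close>
  define K where "K = sqrt V * c + K0 / 2 + ln 2"
  show ?thesis
  proof (rule exI[of _ K], rule exI[of _ N], intro allI impI)
    fix i assume i: "N \<le> i"
    define m where "m = sqrt (real i + 3)"
    have m1: "m \<ge> 1" and m2: "m\<^sup>2 = real i + 3" by (auto simp: m_def)
    have m0: "m0 \<le> m"
    proof -
      have "m0\<^sup>2 \<le> real i" using i unfolding N_def by linarith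
      then have "m0\<^sup>2 \<le> m\<^sup>2" using m2 by simp
      then show ?thesis by (rule power2_le_imp_le) (use m1 in simp)
    qed
    have mc: "c \<le> m" and mL: "2 * L * (\<bar>q\<bar> + 1) / sqrt P \<le> m" using m0 unfolding m0_def by auto
    define beta where "beta = L * (q - c / m)"
    have cm: "0 \<le> c / m" "c / m \<le> 1" using mc m1 c by (auto simp: divide_le_eq)
    have beta: "\<bar>beta\<bar> \<le> L * (\<bar>q\<bar> + 1)"
    proof -
      have "\<bar>q - c / m\<bar> \<le> \<bar>q\<bar> + 1" using cm by linarith
      then show ?thesis unfolding beta_def abs_mult using L by (intro mult_mono) auto
    qed
    have beta2: "beta\<^sup>2 \<le> K0" unfolding K0_def using beta by (metis abs_ge_zero power2_abs power_mono)
    define w where "w = sqrt P + beta / m"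
    have sP: "sqrt P > 0" using P by simp
    have dw: "\<bar>beta / m\<bar> \<le> sqrt P / 2"
    proof -
      have "2 * \<bar>beta\<bar> \<le> m * sqrt P" using mL beta sP by (simp add: divide_le_eq)
      then show ?thesis using m1 by (simp add: divide_le_eq mult.commute)
    qed
    have wl: "sqrt P / 2 \<le> w" and wu: "w \<le> 2 * sqrt P" using dw sP unfolding w_def by linarith+
    have w: "w > 0" using wl sP by linarith
    have w2l: "P / 4 \<le> w\<^sup>2"
      using power_mono[OF wl, of 2] P by (simp add: power_divide)
    have w2u: "w\<^sup>2 \<le> 4 * P"
      using power_mono[OF wu, of 2] P w by (simp add: power_mult_distrib)
    define s where "s = sqrt (1 + w\<^sup>2)"
    have s: "s \<ge> 1" "s\<^sup>2 = 1 + w\<^sup>2" by (auto simp: s_def add_nonneg_nonneg)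
    \<comment> \<open>The exponent \<open>i + 3\<close> equals \<open>m\<^sup>2\<close>, matching
      the target; it exceeds the exponent \<open>i + 1\<close> of the competitor bound by two, and
      the extra \<open>s\<^sup>2\<close> is bounded and absorbed into \<open>K1\<close>.\<close>
    define T where "T = m * s ^ (i + 3)"
    have T1: "T \<ge> 1" unfolding T_def using mult_mono[of 1 m 1 "s ^ (i + 3)"] m1 s one_le_power[of s "i + 3"] by simp
    define M where "M = nat \<lfloor>T\<rfloor>"
    have MT: "real M \<le> T" "T / 2 \<le> real M" "M \<ge> 1"
    proof -
      have "1 \<le> \<lfloor>T\<rfloor>" using T1 by simp
      then have "real M = real_of_int \<lfloor>T\<rfloor>" "1 \<le> real_of_int \<lfloor>T\<rfloor>" unfolding M_def by linarith+
      then show "real M \<le> T" "T / 2 \<le> real M" "M \<ge> 1" using floor_correct[of T] by linarith+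
    qed
    have term1: "Phi ((w * m - sqrt (real (i + 5) * P)) / sqrt (1 + w\<^sup>2 / 2)) \<le> eps - d * (c0 / m)"
    proof -
      \<comment> \<open>The amplitude uses the full block length \<open>i + 5\<close>, while the chi
        approximation is centered at \<open>sqrt (i + 3)\<close>; the mismatch has the favorable
        sign.\<close>
      have "m * sqrt P \<le> sqrt (real (i + 5) * P)"
        unfolding m_def real_sqrt_mult[symmetric] using P by (intro real_sqrt_le_mono mult_right_mono) auto
      then have "w * m - sqrt (real (i + 5) * P) \<le> beta"
        using m1 unfolding w_def by (simp add: distrib_right mult.commute[of m] mult.commute[of P])
      then have "(w * m - sqrt (real (i + 5) * P)) / sqrt (1 + w\<^sup>2 / 2) \<le> beta / sqrt (1 + w\<^sup>2 / 2)"
        by (intro divide_right_mono) auto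
      also have "\<dots> = beta / L + beta * (1 / sqrt (1 + w\<^sup>2 / 2) - 1 / L)" by (simp add: right_diff_distrib)
      also have "beta * (1 / sqrt (1 + w\<^sup>2 / 2) - 1 / L) \<le> \<bar>beta\<bar> * \<bar>beta / m\<bar>"
      proof -
        have "\<bar>1 / sqrt (1 + w\<^sup>2 / 2) - 1 / sqrt (1 + (sqrt P)\<^sup>2 / 2)\<bar> \<le> \<bar>w - sqrt P\<bar>"
          using sP w by (intro inverse_sqrt_lipschitz) auto
        then have "\<bar>1 / sqrt (1 + w\<^sup>2 / 2) - 1 / L\<bar> \<le> \<bar>beta / m\<bar>" using P unfolding L_def w_def by simp
        then have "\<bar>beta\<bar> * \<bar>1 / sqrt (1 + w\<^sup>2 / 2) - 1 / L\<bar> \<le> \<bar>beta\<bar> * \<bar>beta / m\<bar>" by (intro mult_left_mono) auto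
        then show ?thesis unfolding abs_mult[symmetric] by linarith
      qed
      also have "\<bar>beta\<bar> * \<bar>beta / m\<bar> = beta\<^sup>2 / m" using m1 by (simp add: power2_eq_square abs_divide)
      also have "\<dots> \<le> K0 / m" using beta2 m1 by (intro divide_right_mono) auto
      also have "beta / L + K0 / m = q - c0 / m"
        unfolding beta_def c_def using L0 by (simp add: add_divide_distrib)
      finally have "Phi ((w * m - sqrt (real (i + 5) * P)) / sqrt (1 + w\<^sup>2 / 2)) \<le> Phi (q - c0 / m)"
        by (intro Phi_mono) simp
      also have "\<dots> \<le> eps - d * (c0 / m)"
      proof -
        have h: "0 \<le> c0 / m" "c0 / m \<le> 1" using c0 c mc m1 by (auto simp: divide_le_eq)
        have "d * (q - (q - c0 / m)) \<le> Phi q - Phi (q - c0 / m)"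
          unfolding d_def using h by (intro Phi_diff_ge std_normal_density_lower) auto
        then show ?thesis using Pq by simp
      qed
      finally show ?thesis .
    qed
    have term2: "real M * (sqrt (real i + 4) / (2 * pi * w\<^sup>2 * s ^ (i + 1) * ((real i + 1) * sqrt (real i + 2)))) \<le> K1 / m"
    proof -
      define z where "z = sqrt (real i + 4) / ((real i + 1) * sqrt (real i + 2))"
      have z: "z \<ge> 0" unfolding z_def by simp
      have mz: "m * z \<le> 6 / m" unfolding z_def m_def by (rule competitor_prefactor)
      have "real M * (sqrt (real i + 4) / (2 * pi * w\<^sup>2 * s ^ (i + 1) * ((real i + 1) * sqrt (real i + 2))))
        = real M * (z / (2 * pi * w\<^sup>2 * s ^ (i + 1)))" unfolding z_def by (simp add: mult_ac)
      also have "\<dots> \<le> T * (z / (2 * pi * w\<^sup>2 * s ^ (i + 1)))"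
        using MT z s by (intro mult_right_mono) auto
      also have "\<dots> = (m * z) * (s\<^sup>2 / (2 * pi * w\<^sup>2))"
      proof -
        define e where "e = s ^ (i + 1)"
        have "s ^ (i + 3) = e * s\<^sup>2"
          unfolding e_def by (simp add: power_add power2_eq_square power3_eq_cube mult_ac)
        moreover have "e \<noteq> 0" unfolding e_def using s by simp
        ultimately show ?thesis unfolding T_def e_def[symmetric] by (simp add: field_simps)
      qed
      also have "\<dots> \<le> (6 / m) * ((1 + 4 * P) / (P / 4))"
      proof (intro mult_mono mz)
        have "P / 4 \<le> w\<^sup>2" by (rule w2l)
        also have "\<dots> \<le> 2 * pi * w\<^sup>2" using pi_ge_two by (simp add: mult_le_cancel_right1)
        finally show "s\<^sup>2 / (2 * pi * w\<^sup>2) \<le> (1 + 4 * P) / (P / 4)"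
          using w2u P s by (intro frac_le) auto
      qed (use m1 in auto)
      also have "\<dots> = K1 / m" unfolding K1_def by simp
      finally show ?thesis .
    qed
    have "d * c0 = 12 + K1" using d by (simp add: c0_def)
    then have total: "d * (c0 / m) = 12 / m + K1 / m" by (simp only: times_divide_eq_right add_divide_distrib)
    have "\<exists>x D. is_av_code (i + 5) M eps P x D"
    proof (rule spherical_code[OF _ w])
      show "Phi ((w * sqrt (real i + 3) - sqrt (real (i + 5) * P)) / sqrt (1 + w\<^sup>2 / 2)) + 12 / sqrt (real i + 3)
        + real M * (sqrt (real i + 4) / (2 * pi * w\<^sup>2 * sqrt (1 + w\<^sup>2) ^ (i + 1) * ((real i + 1) * sqrt (real i + 2)))) \<le> eps"
        using term1 term2 total unfolding m_def[symmetric] s_def[symmetric] by linarith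
    qed (use P MT in auto)
    moreover have "(real i + 3) * (ln (1 + P) / 2) + sqrt (real i + 3) * sqrt V * q + ln (real i + 3) / 2 - K \<le> ln (real M)"
    proof -
      have "ln (T / 2) \<le> ln (real M)" using MT T1 by (intro ln_mono) auto
      moreover have "ln (T / 2) = ln m + (real i + 3) * ln s - ln 2"
      proof -
        have "m > 0" "s > 0" using m1 s by auto
        then show ?thesis unfolding T_def by (simp add: ln_div ln_mult_pos ln_realpow)
      qed
      moreover have "ln m = ln (real i + 3) / 2" unfolding m_def by (simp add: ln_sqrt)
      moreover have "ln s = ln (1 + w\<^sup>2) / 2" unfolding s_def by (simp add: ln_sqrt add_pos_nonneg)
      moreover have "(real i + 3) * (ln (1 + P) / 2) + m * sqrt V * q - sqrt V * c - K0 / 2 \<le> (real i + 3) * (ln (1 + w\<^sup>2) / 2)"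
      proof -
        \<comment> \<open>Slope of the rate times the limiting standard deviation: here the
          dispersion appears.\<close>
        have VL: "sqrt P * L / (1 + P) = sqrt V"
        proof -
          have "V = P * (1 + P / 2) / (1 + P)\<^sup>2" unfolding V_def
            using P by (simp add: divide_simps add.commute)
          then show ?thesis unfolding L_def using P by (simp add: real_sqrt_divide real_sqrt_mult)
        qed
        have "ln (1 + w\<^sup>2) \<ge> ln (1 + (sqrt P)\<^sup>2) + 2 * sqrt P / (1 + (sqrt P)\<^sup>2) * (w - sqrt P) - (w - sqrt P)\<^sup>2"
          using sP by (intro ln_one_plus_square_lower) auto
        then have "ln (1 + w\<^sup>2) \<ge> ln (1 + P) + 2 * sqrt P / (1 + P) * (beta / m) - (beta / m)\<^sup>2"
          using P unfolding w_def by simp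
        then have "m\<^sup>2 * (ln (1 + w\<^sup>2) / 2) \<ge> m\<^sup>2 * ((ln (1 + P) + 2 * sqrt P / (1 + P) * (beta / m) - (beta / m)\<^sup>2) / 2)"
          by (intro mult_left_mono) auto
        also have "m\<^sup>2 * ((ln (1 + P) + 2 * sqrt P / (1 + P) * (beta / m) - (beta / m)\<^sup>2) / 2)
          = m\<^sup>2 * (ln (1 + P) / 2) + m * (sqrt P / (1 + P) * beta) - beta\<^sup>2 / 2"
        proof -
          define x where "x = beta / m"
          define k where "k = sqrt P / (1 + P)"
          have bx: "beta = m * x" using m1 by (simp add: x_def)
          have k2: "2 * sqrt P / (1 + P) = 2 * k" by (simp add: k_def)
          show ?thesis unfolding x_def[symmetric] k2 k_def[symmetric] bx
            by (simp add: power2_eq_square algebra_simps add_divide_distrib diff_divide_distrib)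
        qed
        also have "sqrt P / (1 + P) * beta = sqrt V * (q - c / m)"
          unfolding VL[symmetric] beta_def by simp
        also have "m * (sqrt V * (q - c / m)) = m * sqrt V * q - sqrt V * c"
          using m1 by (simp add: right_diff_distrib)
        finally show ?thesis using beta2 unfolding m2 by linarith
      qed
      ultimately show ?thesis unfolding K_def m_def[symmetric] by (simp add: distrib_left)
    qed
    ultimately show "\<exists>M\<ge>1. (\<exists>x D. is_av_code (i + 5) M eps P x D) \<and>
      (real i + 3) * (ln (1 + P) / 2) + sqrt (real i + 3) * sqrt V * q + ln (real i + 3) / 2 - K \<le> ln (real M)"
      using MT(3) by blast
  qed
qed

text \<open>Replacing \<open>i + 3 = n - 2\<close> by \<open>n\<close> changes each of the three
  terms by a bounded amount. The finitely many small block lengths are covered by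
  \<open>Mstar \<ge> 1\<close> and a larger constant.\<close>

lemma Mstar_asymptotic:
  fixes P eps :: real
  assumes P: "P > 0" and eps: "0 < eps" "eps < 1"
  defines "q \<equiv> Phi_inv eps" and "V \<equiv> P * (P + 2) / (2 * (P + 1)\<^sup>2)"
  shows "\<exists>K. \<forall>n\<ge>1. real n * (ln (1 + P) / 2) + sqrt (real n * V) * q + ln (real n) / 2 - K \<le> ln (real (Mstar n eps P))"
proof -
  have V: "V \<ge> 0" unfolding V_def using P by simp
  obtain K N where KN: "\<And>i. i \<ge> N \<Longrightarrow> \<exists>M\<ge>1. (\<exists>x D. is_av_code (i + 5) M eps P x D) \<and>
    (real i + 3) * (ln (1 + P) / 2) + sqrt (real i + 3) * sqrt V * q + ln (real i + 3) / 2 - K \<le> ln (real M)"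
    using code_existence_asymptotic[OF P eps] unfolding q_def V_def by blast
  define R where "R n = real n * (ln (1 + P) / 2) + sqrt (real n * V) * q + ln (real n) / 2" for n
  define K1 where "K1 = K + ln (1 + P) + 2 * sqrt V * \<bar>q\<bar> + ln 3 / 2"
  define K2 where "K2 = (\<Sum>n<N + 5. \<bar>R n\<bar>)"
  have lp: "ln (1 + P) \<ge> 0" using P by simp
  have big: "R n - K1 \<le> ln (real (Mstar n eps P))" if n: "n \<ge> N + 5" for n
  proof -
    define i where "i = n - 5"
    have ni: "n = i + 5" using n by (simp add: i_def)
    have "i \<ge> N" using n by (simp add: i_def)
    from KN[OF this] obtain M x D where M: "M \<ge> 1" "is_av_code n M eps P x D"
      "(real i + 3) * (ln (1 + P) / 2) + sqrt (real i + 3) * sqrt V * q + ln (real i + 3) / 2 - K \<le> ln (real M)"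
      unfolding ni by blast
    have "M \<le> Mstar n eps P" using M(2) eps(2) by (rule code_size_le_Mstar)
    then have "ln (real M) \<le> ln (real (Mstar n eps P))" using M(1) by (intro ln_mono) auto
    moreover have "real n * (ln (1 + P) / 2) = (real i + 3) * (ln (1 + P) / 2) + ln (1 + P)"
      by (simp add: ni algebra_simps)
    moreover have "sqrt (real n * V) * q \<le> sqrt (real i + 3) * sqrt V * q + 2 * sqrt V * \<bar>q\<bar>"
    proof -
      have a: "sqrt (real i + 3) \<le> sqrt (real n)" by (simp add: ni)
      have "real n \<le> (sqrt (real i + 3) + 2)\<^sup>2" by (simp add: ni power2_eq_square algebra_simps)
      then have b: "sqrt (real n) \<le> sqrt (real i + 3) + 2" by (intro real_le_lsqrt) auto
      \<comment> \<open>The sign of \<open>q\<close> is unknown, so the change of the square root is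
        charged with \<open>\<bar>q\<bar>\<close>.\<close>
      have "(sqrt (real n) - sqrt (real i + 3)) * (sqrt V * q) \<le> (sqrt (real n) - sqrt (real i + 3)) * (sqrt V * \<bar>q\<bar>)"
        using a V by (intro mult_left_mono) auto
      also have "\<dots> \<le> 2 * (sqrt V * \<bar>q\<bar>)" using b V by (intro mult_right_mono) auto
      finally show ?thesis by (simp add: real_sqrt_mult algebra_simps)
    qed
    moreover have "ln (real n) \<le> ln (real i + 3) + ln 3"
    proof -
      have "ln (real n) \<le> ln ((real i + 3) * 3)" by (intro ln_mono) (auto simp: ni)
      also have "\<dots> = ln (real i + 3) + ln 3" by (intro ln_mult_pos) auto
      finally show ?thesis .
    qed
    ultimately show ?thesis using M(3) unfolding R_def K1_def by linarith
  qed
  have pos: "0 \<le> ln (real (Mstar n eps P))" for n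
  proof -
    have "1 \<le> Mstar n eps P" using trivial_code[of P eps n] P eps by (intro code_size_le_Mstar) auto
    then show ?thesis by simp
  qed
  have "R n - (\<bar>K1\<bar> + K2) \<le> ln (real (Mstar n eps P))" for n
  proof (cases "n \<ge> N + 5")
    case True
    have "K2 \<ge> 0" unfolding K2_def by (intro sum_nonneg) auto
    then show ?thesis using big[OF True] by linarith
  next
    case False
    then have "\<bar>R n\<bar> \<le> K2" unfolding K2_def by (intro member_le_sum) auto
    then show ?thesis using pos[of n] by linarith
  qed
  then show ?thesis unfolding R_def by blast
qed

theorem theorem1:
  fixes b eps P :: real
  assumes "b > 1" and "0 < eps" and "eps < 1" and "0 < P"
  shows "\<exists>c::real. \<forall>n::nat. n \<ge> 1 \<longrightarrow>
           log b (real (Mstar n eps P))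
             \<ge> real n * cap b P + sqrt (real n * disp b P) * Phi_inv eps
                + 1/2 * log b (real n) + c"
proof -
  define V where "V = P * (P + 2) / (2 * (P + 1)\<^sup>2)"
  obtain K where K: "\<And>n. n \<ge> 1 \<Longrightarrow> real n * (ln (1 + P) / 2) + sqrt (real n * V) * Phi_inv eps + ln (real n) / 2 - K
      \<le> ln (real (Mstar n eps P))"
    using Mstar_asymptotic[OF assms(4,2,3)] unfolding V_def by blast
  have lb: "ln b > 0" using assms by simp
  show ?thesis
  proof (intro exI[of _ "- K / ln b"] allI impI)
    fix n :: nat assume n: "n \<ge> 1"
    \<comment> \<open>The square of \<open>log b (exp 1)\<close> leaves the root as the factor
      \<open>1 / ln b\<close>, so every term scales alike under the change of base.\<close>
    have "real n * disp b P = real n * V / (ln b)\<^sup>2"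
      using lb by (simp add: disp_def V_def log_def power_divide)
    then have s: "sqrt (real n * disp b P) = sqrt (real n * V) / ln b"
      using lb by (simp add: real_sqrt_divide)
    have "real n * cap b P + sqrt (real n * disp b P) * Phi_inv eps + 1/2 * log b (real n) + - K / ln b
      = (real n * (ln (1 + P) / 2) + sqrt (real n * V) * Phi_inv eps + ln (real n) / 2 - K) / ln b"
      unfolding s by (simp add: cap_def log_def add_divide_distrib diff_divide_distrib)
    also have "\<dots> \<le> ln (real (Mstar n eps P)) / ln b" using K[OF n] lb by (intro divide_right_mono) auto
    finally show "log b (real (Mstar n eps P))
      \<ge> real n * cap b P + sqrt (real n * disp b P) * Phi_inv eps + 1/2 * log b (real n) + - K / ln b"
      by (simp add: log_def)
  qed
qed

end
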